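(* Let $X_1,X_2,\ldots$ be i.i.d. real random variables with distribution $P_0=P_{\theta_0,\eta_0}$ for some $(\theta_0,\eta_0)\in\Theta\times\mathcal H$, where $\{P_{\theta,\eta}:\theta\in\Theta,\eta\in\mathcal H\}$ is the symmetric location model with normal-mixture errors (see context). Endow the model with a product prior $\Pi=\Pi_\Theta\times\Pi_{\mathcal H}$, where $\Pi_\Theta$ is thick at $\theta_0$ and $\Pi_{\mathcal H}(U)>0$ for every weak neighborhood $U$ of $\eta_0$. Then $$\sup_B\left|\Pi\big(\sqrt n(\theta-\theta_0)\in B\mid X_1,\ldots,X_n\big)-N_{\Delta_n,I_{\theta_0,\eta_0}^{-1}}(B)\right|\to 0$$ in $P_0$-probability as $n\to\infty$, where the supremum is over all Borel sets $B\subset\mathbb R$ and $$\Delta_n=\frac1{\sqrt n}\sum_{i=1}^n I_{\theta_0,\eta_0}^{-1}\,\dot\ell_{\theta_0,\eta_0}(X_i).$$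
   Context: $\Theta$ is an open subset of $\mathbb R$. Fix constants $M>0$ and $0<\sigma_1<\sigma_2<\infty$. $\mathcal H$ is the set of all Borel probability measures $\eta$ supported on $[-M,M]\times[\sigma_1,\sigma_2]$ satisfying $d\eta(z,\sigma)=d\eta(-z,\sigma)$ (invariance under $(z,\sigma)\mapsto(-z,\sigma)$). $\phi_\sigma$ is the density of the univariate normal distribution with mean $0$ and variance $\sigma^2$; $p_\eta(x)=\int\phi_\sigma(x-z)\,d\eta(z,\sigma)$; $P_{\theta,\eta}$ has Lebesgue density $p_{\theta,\eta}(x)=p_\eta(x-\theta)$; $\ell_{\theta,\eta}=\log p_{\theta,\eta}$. The score function is $\dot\ell_{\theta,\eta}(x)=\partial\ell_{\theta,\eta}(x)/\partial\theta$ and the Fisher information is $I_{\theta,\eta}=\int\dot\ell_{\theta,\eta}^2\,dP_{\theta,\eta}$. A weak neighborhood of $\eta_0$ is a neighborhood in the topology of weak convergence on $\mathcal H$, i.e. a set containing one of the form $\{\eta\in\mathcal H: |\int f_i\,d\eta-\int f_i\,d\eta_0|<\epsilon,\ i=1,\ldots,m\}$ with $\epsilon>0$ and $f_1,\ldots,f_m$ bounded continuous functions on $[-M,M]\times[\sigma_1,\sigma_2]$. A prior $\Pi_\Theta$ is thick at $\theta_0$ if it has a positive continuous Lebesgue density in a neighborhood of $\theta_0$. $\Pi(\cdot\mid X_1,\ldots,X_n)$ is the posterior distribution given by Bayes' rule, $\Pi(A\mid X_1,\dots,X_n)=\int_A\prod_i p_{\theta,\eta}(X_i)\,d\Pi(\theta,\eta)\big/\int\prod_i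 p_{\theta,\eta}(X_i)\,d\Pi(\theta,\eta)$. $N_{\mu,\Sigma}$ denotes the normal distribution with mean $\mu$ and variance $\Sigma$. *)

theory Defs
  imports "HOL-Probability.Probability"
begin

text \<open>A mixing measure lives on pairs \<open>(z, \<sigma>)\<close> of a location \<open>z\<close> and a standard
  deviation \<open>\<sigma>\<close>; the support box below contains all of its mass.\<close>

definition mix_box :: "real \<Rightarrow> real \<Rightarrow> real \<Rightarrow> (real \<times> real) set" where
  "mix_box M \<sigma>1 \<sigma>2 = {-M..M} \<times> {\<sigma>1..\<sigma>2}"

definition mixing_measures :: "real \<Rightarrow> real \<Rightarrow> real \<Rightarrow> (real \<times> real) measure set" where
  "mixing_measures M \<sigma>1 \<sigma>2 =
     {\<eta>. prob_space \<eta> \<and> sets \<eta> = sets borel \<and> emeasure \<eta> (mix_box M \<sigma>1 \<sigma>2) = 1 \<and>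
        distr \<eta> borel (\<lambda>(z, \<sigma>). (- z, \<sigma>)) = \<eta>}"

text \<open>The test functions are only constrained on the box, hence the integrals over the box.\<close>

definition weak_nbhd ::
  "real \<Rightarrow> real \<Rightarrow> real \<Rightarrow> (real \<times> real) measure \<Rightarrow> (real \<times> real) measure set \<Rightarrow> bool" where
  "weak_nbhd M \<sigma>1 \<sigma>2 \<eta>0 U \<longleftrightarrow>
     U \<subseteq> mixing_measures M \<sigma>1 \<sigma>2 \<and>
     (\<exists>(F :: (real \<times> real \<Rightarrow> real) set) \<epsilon>. finite F \<and> \<epsilon> > 0 \<and>
        (\<forall>f\<in>F. continuous_on (mix_box M \<sigma>1 \<sigma>2) f \<and> bounded (f ` mix_box M \<sigma>1 \<sigma>2)) \<and>
        {\<eta> \<in> mixing_measures M \<sigma>1 \<sigma>2.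
           \<forall>f\<in>F. \<bar>(LINT w:mix_box M \<sigma>1 \<sigma>2|\<eta>. f w) - (LINT w:mix_box M \<sigma>1 \<sigma>2|\<eta>0. f w)\<bar> < \<epsilon>} \<subseteq> U)"

definition weakly_open ::
  "real \<Rightarrow> real \<Rightarrow> real \<Rightarrow> (real \<times> real) measure set \<Rightarrow> bool" where
  "weakly_open M \<sigma>1 \<sigma>2 U \<longleftrightarrow>
     U \<subseteq> mixing_measures M \<sigma>1 \<sigma>2 \<and> (\<forall>\<eta>\<in>U. weak_nbhd M \<sigma>1 \<sigma>2 \<eta> U)"

text \<open>The set of mixing measures with the Borel \<open>\<sigma>\<close>-algebra of the weak topology; \<open>sigma\<close>
  yields a measure of which only the measurable space matters.\<close>

definition weak_borel :: "real \<Rightarrow> real \<Rightarrow> real \<Rightarrow> (real \<times> real) measure measure" where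
  "weak_borel M \<sigma>1 \<sigma>2 = sigma (mixing_measures M \<sigma>1 \<sigma>2) {U. weakly_open M \<sigma>1 \<sigma>2 U}"

definition mix_density :: "(real \<times> real) measure \<Rightarrow> real \<Rightarrow> real" where
  "mix_density \<eta> x = (LINT (z, \<sigma>)|\<eta>. normal_density 0 \<sigma> (x - z))"

definition loc_density :: "real \<Rightarrow> (real \<times> real) measure \<Rightarrow> real \<Rightarrow> real" where
  "loc_density \<theta> \<eta> x = mix_density \<eta> (x - \<theta>)"

definition loc_measure :: "real \<Rightarrow> (real \<times> real) measure \<Rightarrow> real measure" where
  "loc_measure \<theta> \<eta> = density lborel (\<lambda>x. ennreal (loc_density \<theta> \<eta> x))"

definition score :: "real \<Rightarrow> (real \<times> real) measure \<Rightarrow> real \<Rightarrow> real" where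
  "score \<theta> \<eta> x = deriv (\<lambda>t. ln (loc_density t \<eta> x)) \<theta>"

definition fisher_info :: "real \<Rightarrow> (real \<times> real) measure \<Rightarrow> real" where
  "fisher_info \<theta> \<eta> = (LINT x|loc_measure \<theta> \<eta>. (score \<theta> \<eta> x)\<^sup>2)"

definition thick_at :: "real measure \<Rightarrow> real \<Rightarrow> bool" where
  "thick_at \<pi> \<theta>0 \<longleftrightarrow>
     (\<exists>V f. open V \<and> \<theta>0 \<in> V \<and> V \<subseteq> space \<pi> \<and> continuous_on V f \<and> (\<forall>x\<in>V. f x > (0 :: real)) \<and>
        (\<forall>A\<in>sets borel. A \<subseteq> V \<longrightarrow> emeasure \<pi> A = (\<integral>\<^sup>+x\<in>A. ennreal (f x) \<partial>lborel)))"

text \<open>Posterior given the observations \<open>xs 0, \<dots>, xs (n - 1)\<close>.\<close>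

definition likelihood ::
  "nat \<Rightarrow> (nat \<Rightarrow> real) \<Rightarrow> real \<times> (real \<times> real) measure \<Rightarrow> real" where
  "likelihood n xs = (\<lambda>(\<theta>, \<eta>). \<Prod>i<n. loc_density \<theta> \<eta> (xs i))"

definition posterior ::
  "(real \<times> (real \<times> real) measure) measure \<Rightarrow> nat \<Rightarrow> (nat \<Rightarrow> real) \<Rightarrow>
     (real \<times> (real \<times> real) measure) set \<Rightarrow> real" where
  "posterior \<pi> n xs A =
     (LINT p:A|\<pi>. likelihood n xs p) / (LINT p|\<pi>. likelihood n xs p)"

definition normal_measure :: "real \<Rightarrow> real \<Rightarrow> real measure" where
  "normal_measure \<mu> v = density lborel (\<lambda>x. ennreal (normal_density \<mu> (sqrt v) x))"

text \<open>Measurability is part of the notion because \<open>measure\<close> is \<open>0\<close> on non-measurable sets.\<close>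

definition tendsto_zero_in_prob :: "'w measure \<Rightarrow> (nat \<Rightarrow> 'w \<Rightarrow> real) \<Rightarrow> bool" where
  "tendsto_zero_in_prob P Y \<longleftrightarrow>
     (\<forall>n. Y n \<in> borel_measurable P) \<and>
     (\<forall>\<epsilon>>0. (\<lambda>n. measure P {\<omega> \<in> space P. \<bar>Y n \<omega>\<bar> > \<epsilon>}) \<longlonglongrightarrow> 0)"

end

theory Submission
  imports Defs
begin

text \<open>Given the mixing measure \<open>\<eta>\<close>, the posterior of \<open>\<theta>\<close> is a one-dimensional posterior with a smooth likelihood,
and the posterior of the theorem is the average of these over \<open>\<eta>\<close>.  Write \<open>l\<^sub>\<eta> = ln p\<^sub>\<eta>\<close>,
\<open>z\<^sub>i = X\<^sub>i - \<theta>\<^sub>0\<close>, \<open>u = \<theta> - \<theta>\<^sub>0\<close> and \<open>h = sqrt n * u\<close>.  A second-order Taylor expansion of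
\<open>\<Sum>\<^sub>i l\<^sub>\<eta>(z\<^sub>i - u)\<close> gives a linear term \<open>- u \<Sum>\<^sub>i l\<^sub>\<eta>'(z\<^sub>i)\<close> and a quadratic term
\<open>u\<^sup>2 / 2 \<Sum>\<^sub>i l\<^sub>\<eta>''(z\<^sub>i - \<xi>\<^sub>i)\<close>.  Symmetry is what makes the nuisance parameter harmless:
\<open>l\<^sub>\<eta>'\<close> is odd and \<open>p\<^sub>\<eta>\<^sub>0\<close> is even, so every score has mean zero under the truth and no \<open>\<eta>\<close> near \<open>\<eta>\<^sub>0\<close>
shifts the centre of its normal limit.  Hence, once \<open>\<eta>\<close> is close to \<open>\<eta>\<^sub>0\<close>, all the one-dimensional
posteriors are close to one and the same normal distribution, and so is their average, whatever the weights.

Two features of the model make the uniformity in \<open>\<eta>\<close> elementary.  First, \<open>l\<^sub>\<eta>\<close>, \<open>l\<^sub>\<eta>'\<close> and \<open>l\<^sub>\<eta>''\<close>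
are bounded by \<open>C * (1 + x\<^sup>2)\<close> with \<open>C\<close> the same for all \<open>\<eta>\<close>, while the errors have Gaussian tails.
Secondly, for a continuously differentiable \<open>g\<close> the centred sum \<open>\<Sum>\<^sub>i g(z\<^sub>i) - n * P\<^sub>0 g\<close> is an integral
of \<open>g'\<close> against the empirical process, so that
\<open>\<bar>g'\<bar> \<le> C * (1 + x\<^sup>2)\<^sup>2\<close> bounds it by \<open>C\<close> times a single random variable
(\<open>emp_norm_controls\<close>), whose expectation is of order \<open>sqrt n\<close> (\<open>emp_norm_expectation\<close>).  This replaces
chaining and entropy bounds: one random variable controls all \<open>g\<close> at once.

What remains is deterministic.  A sample is called controlled if that
random variable is at most \<open>t * sqrt n\<close>, the empirical moment of \<open>(1 + x\<^sup>2)\<^sup>2\<close> is at most \<open>v\<close>, and the average of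
\<open>l\<^sub>\<eta>\<^sub>0''\<close> is within \<open>\<rho>\<close> of minus the information.  For suitable \<open>t\<close> and \<open>v\<close> and every \<open>\<rho>\<close>
this has probability close to one for large \<open>n\<close> (\<open>controlled_with_high_probability\<close>).  On controlled samples

\<^item> the log-likelihood ratio is at most \<open>- c * n\<close> away from the truth (\<open>llr_far\<close>), because the
  Kullback-Leibler divergence is bounded below there (\<open>kl_separation\<close>), while the evidence is at least
  \<open>m * exp (- c * n / 2)\<close> (\<open>evidence_lower_bound\<close>); so the posterior concentrates near the truth;

\<^item> near the truth the Taylor expansion holds with an error of at most \<open>\<delta> * (\<bar>h\<bar> + h\<^sup>2)\<close>
  (\<open>llr_local_expansion\<close>), and a density proportional to
  \<open>exp (h * S - h\<^sup>2 * I / 2)\<close> up to such an error is close to normal in total variation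
  (\<open>normal_approximation\<close>).

The mixing measure is not identifiable in general: the normal kernel solves the heat equation in location and variance, so a point mass
can be swept to the boundary of the box without changing the density.  For this reason closeness to \<open>\<eta>\<^sub>0\<close> is measured throughout by the values of \<open>p\<^sub>\<eta>\<close> at
finitely many points.  Such sets are weakly open, hence carry prior mass, and by the smoothness of \<open>p\<^sub>\<eta>\<close> they
control its derivatives as well.\<close>

section \<open>Derivatives of the normal density\<close>

text \<open>The \<open>k\<close>-th derivative of the centred normal density, by the three-term recursion of the Hermite polynomials.\<close>

fun gauss_deriv :: "nat \<Rightarrow> real \<Rightarrow> real \<Rightarrow> real" where
  "gauss_deriv 0 \<sigma> u = normal_density 0 \<sigma> u"
| "gauss_deriv (Suc 0) \<sigma> u = - (u * normal_density 0 \<sigma> u) / \<sigma>\<^sup>2"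
| "gauss_deriv (Suc (Suc k)) \<sigma> u =
     - (u * gauss_deriv (Suc k) \<sigma> u + real (Suc k) * gauss_deriv k \<sigma> u) / \<sigma>\<^sup>2"

lemma gauss_deriv_0: "gauss_deriv 0 \<sigma> = normal_density 0 \<sigma>"
  by (rule ext) simp

lemma gauss_deriv_has_derivative:
  assumes "\<sigma> > 0"
  shows "(gauss_deriv k \<sigma> has_real_derivative gauss_deriv (Suc k) \<sigma> u) (at u)"
proof (induction k rule: less_induct)
  case (less k)
  have zero: "(gauss_deriv 0 \<sigma> has_real_derivative gauss_deriv (Suc 0) \<sigma> u) (at u)" for u
    unfolding gauss_deriv.simps normal_density_def[abs_def] using assms
    by (auto intro!: derivative_eq_intros simp: field_simps power2_eq_square)
  consider "k = 0" | "k = 1" | j where "k = Suc (Suc j)"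
    by (metis One_nat_def not0_implies_Suc)
  then show ?case
  proof cases
    case 1
    show ?thesis unfolding 1 by (rule zero)
  next
    case 2
    have nd: "(normal_density 0 \<sigma> has_real_derivative - (u * normal_density 0 \<sigma> u) / \<sigma>\<^sup>2) (at u)"
      using zero[of u] by (simp add: gauss_deriv_0)
    have "((\<lambda>u. - (u * normal_density 0 \<sigma> u) / \<sigma>\<^sup>2) has_real_derivative
        gauss_deriv (Suc (Suc 0)) \<sigma> u) (at u)"
      using assms by (auto intro!: derivative_eq_intros nd simp: field_simps)
    then show ?thesis using 2 by simp
  next
    case 3
    have "(gauss_deriv (Suc j) \<sigma> has_real_derivative gauss_deriv (Suc (Suc j)) \<sigma> u) (at u)"
      "(gauss_deriv j \<sigma> has_real_derivative gauss_deriv (Suc j) \<sigma> u) (at u)"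
      using less[of "Suc j"] less[of j] 3 by auto
    note d = this
    have "((\<lambda>u. - (u * gauss_deriv (Suc j) \<sigma> u + real (Suc j) * gauss_deriv j \<sigma> u) / \<sigma>\<^sup>2)
      has_real_derivative - ((1 * gauss_deriv (Suc j) \<sigma> u + gauss_deriv (Suc (Suc j)) \<sigma> u * u)
        + real (Suc j) * gauss_deriv (Suc j) \<sigma> u) / \<sigma>\<^sup>2) (at u)"
      by (intro DERIV_cdivide DERIV_minus DERIV_add DERIV_mult DERIV_cmult DERIV_ident d)
    moreover have "- ((1 * gauss_deriv (Suc j) \<sigma> u + gauss_deriv (Suc (Suc j)) \<sigma> u * u)
        + real (Suc j) * gauss_deriv (Suc j) \<sigma> u) / \<sigma>\<^sup>2 = gauss_deriv (Suc (Suc (Suc j))) \<sigma> u"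
      unfolding gauss_deriv.simps(3)[of "Suc j"] of_nat_Suc[of "Suc j"]
      by (intro arg_cong2[where f="(/)"] arg_cong[where f=uminus] refl) (simp only: distrib_right mult_1_left ac_simps)
    ultimately have "((\<lambda>u. - (u * gauss_deriv (Suc j) \<sigma> u + real (Suc j) * gauss_deriv j \<sigma> u) / \<sigma>\<^sup>2)
      has_real_derivative gauss_deriv (Suc (Suc (Suc j))) \<sigma> u) (at u)" by (simp only:)
    then show ?thesis using 3 by simp
  qed
qed

lemma gauss_deriv_measurable[measurable]:
  "(\<lambda>w. gauss_deriv k (g w) (h w)) \<in> borel_measurable N"
  if [measurable]: "g \<in> borel_measurable N" "h \<in> borel_measurable N"
proof (induction k rule: less_induct)
  case (less k)
  have [measurable]: "(\<lambda>w. normal_density 0 (g w) (h w)) \<in> borel_measurable N"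
    unfolding normal_density_def by measurable
  consider "k = 0" | "k = 1" | j where "k = Suc (Suc j)"
    by (metis One_nat_def not0_implies_Suc)
  then show ?case
  proof cases
    case 3
    have [measurable]: "(\<lambda>w. gauss_deriv (Suc j) (g w) (h w)) \<in> borel_measurable N"
      "(\<lambda>w. gauss_deriv j (g w) (h w)) \<in> borel_measurable N"
      using less 3 by auto
    show ?thesis unfolding 3 gauss_deriv.simps by measurable
  qed auto
qed

lemma gauss_deriv_even_odd: "gauss_deriv k \<sigma> (- u) = (-1)^k * gauss_deriv k \<sigma> u"
  by (induction k \<sigma> u rule: gauss_deriv.induct) (auto simp: normal_density_def field_simps)

lemma gauss_deriv_continuous_on:
  assumes "\<And>w. w \<in> S \<Longrightarrow> g w > 0" "continuous_on S g" "continuous_on S h"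
  shows "continuous_on S (\<lambda>w. gauss_deriv k (g w) (h w))"
proof (induction k rule: less_induct)
  case (less k)
  have nd: "continuous_on S (\<lambda>w. normal_density 0 (g w) (h w))"
    unfolding normal_density_def using assms
    by (intro continuous_intros) (auto simp: less_imp_neq[symmetric] dest: assms(1) less_imp_neq)
  consider "k = 0" | "k = 1" | j where "k = Suc (Suc j)"
    by (metis One_nat_def not0_implies_Suc)
  then show ?case
  proof cases
    case 3
    have "continuous_on S (\<lambda>w. gauss_deriv (Suc j) (g w) (h w))"
      "continuous_on S (\<lambda>w. gauss_deriv j (g w) (h w))"
      using less 3 by auto
    then show ?thesis unfolding 3 gauss_deriv.simps using assms
      by (intro continuous_intros) (auto dest: assms(1))
  next
    case 2
    show ?thesis unfolding 2 One_nat_def gauss_deriv.simps using assms nd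
      by (intro continuous_intros) (auto dest: assms(1))
  qed (use nd in simp)
qed

text \<open>Each derivative is a polynomial times the density itself.  Comparing with the density rather than with a constant
is what later gives polynomial bounds for the logarithmic derivatives of mixtures.\<close>

lemma gauss_deriv_le_density:
  assumes "0 < a"
  shows "\<exists>C\<ge>0. \<forall>\<sigma>\<ge>a. \<forall>u. \<bar>gauss_deriv k \<sigma> u\<bar> \<le> C * (1 + \<bar>u\<bar>)^k * normal_density 0 \<sigma> u"
proof (induction k rule: less_induct)
  case (less k)
  consider "k = 0" | "k = 1" | j where "k = Suc (Suc j)"
    by (metis One_nat_def not0_implies_Suc)
  then show ?case
  proof cases
    case 1
    then show ?thesis by (intro exI[of _ 1]) auto
  next
    case 2
    have "\<bar>gauss_deriv 1 \<sigma> u\<bar> \<le> 1/a\<^sup>2 * (1 + \<bar>u\<bar>)^1 * normal_density 0 \<sigma> u" if "\<sigma> \<ge> a" for \<sigma> u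
    proof -
      have "a\<^sup>2 \<le> \<sigma>\<^sup>2" using that assms by (simp add: power_mono)
      then have "\<bar>u\<bar> / \<sigma>\<^sup>2 \<le> (1 + \<bar>u\<bar>) / a\<^sup>2" using assms by (intro frac_le) auto
      from mult_right_mono[OF this, of "normal_density 0 \<sigma> u"] show ?thesis
        by (simp add: abs_mult)
    qed
    then show ?thesis unfolding 2 by (intro exI[of _ "1/a\<^sup>2"]) auto
  next
    case 3
    obtain C1 where C1: "C1 \<ge> 0" "\<And>\<sigma> u. \<sigma> \<ge> a \<Longrightarrow>
      \<bar>gauss_deriv (Suc j) \<sigma> u\<bar> \<le> C1 * (1 + \<bar>u\<bar>)^(Suc j) * normal_density 0 \<sigma> u"
      using less[of "Suc j"] 3 by auto
    obtain C2 where C2: "C2 \<ge> 0" "\<And>\<sigma> u. \<sigma> \<ge> a \<Longrightarrow>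
      \<bar>gauss_deriv j \<sigma> u\<bar> \<le> C2 * (1 + \<bar>u\<bar>)^j * normal_density 0 \<sigma> u"
      using less[of j] 3 by auto
    have "\<bar>gauss_deriv k \<sigma> u\<bar> \<le> (C1 + real (Suc j) * C2)/a\<^sup>2 * (1 + \<bar>u\<bar>)^k * normal_density 0 \<sigma> u"
      if s: "\<sigma> \<ge> a" for \<sigma> u
    proof -
      let ?n = "normal_density 0 \<sigma> u" and ?w = "1 + \<bar>u\<bar>"
      have sq: "a\<^sup>2 \<le> \<sigma>\<^sup>2" "0 < a\<^sup>2" using s assms by (auto simp add: power_mono)
      have A: "\<bar>u\<bar> * \<bar>gauss_deriv (Suc j) \<sigma> u\<bar> \<le> ?w * (C1 * ?w^(Suc j) * ?n)"
        using C1 s by (intro mult_mono) auto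
      have B: "\<bar>gauss_deriv j \<sigma> u\<bar> \<le> C2 * ?w^k * ?n"
      proof -
        have "?w^j \<le> ?w^k" using 3 by (intro power_increasing) auto
        then have "C2 * ?w^j * ?n \<le> C2 * ?w^k * ?n" using C2(1)
          by (intro mult_right_mono mult_left_mono) auto
        with C2(2)[OF s, of u] show ?thesis by linarith
      qed
      have "\<bar>u * gauss_deriv (Suc j) \<sigma> u + real (Suc j) * gauss_deriv j \<sigma> u\<bar>
         \<le> \<bar>u\<bar> * \<bar>gauss_deriv (Suc j) \<sigma> u\<bar> + real (Suc j) * \<bar>gauss_deriv j \<sigma> u\<bar>"
        by (rule order_trans[OF abs_triangle_ineq]) (simp add: abs_mult)
      also have "\<dots> \<le> ?w * (C1 * ?w^(Suc j) * ?n) + real (Suc j) * (C2 * ?w^k * ?n)"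
        using A B by (intro add_mono mult_left_mono) auto
      also have "\<dots> = (C1 + real (Suc j) * C2) * ?w^k * ?n"
        unfolding 3 by (simp add: algebra_simps)
      finally have main: "\<bar>u * gauss_deriv (Suc j) \<sigma> u + real (Suc j) * gauss_deriv j \<sigma> u\<bar>
         \<le> (C1 + real (Suc j) * C2) * ?w^k * ?n" .
      have "\<bar>gauss_deriv k \<sigma> u\<bar>
         = \<bar>u * gauss_deriv (Suc j) \<sigma> u + real (Suc j) * gauss_deriv j \<sigma> u\<bar> / \<sigma>\<^sup>2"
        unfolding 3 gauss_deriv.simps(3)[of j] abs_divide abs_minus by simp
      also have "\<dots> \<le> ((C1 + real (Suc j) * C2) * ?w^k * ?n) / a\<^sup>2"
        using main sq C1(1) C2(1) by (intro frac_le) auto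
      finally show ?thesis by simp
    qed
    moreover have "(C1 + real (Suc j) * C2)/a\<^sup>2 \<ge> 0" using C1(1) C2(1) by auto
    ultimately show ?thesis by blast
  qed
qed

lemma normal_density_le:
  assumes "0 < a" "a \<le> \<sigma>" "\<sigma> \<le> b"
  shows "normal_density 0 \<sigma> u \<le> 1 / (a * sqrt (2 * pi)) * exp (- u\<^sup>2 / (2 * b\<^sup>2))"
proof -
  have s: "0 < \<sigma>" using assms by auto
  have "sqrt (2 * pi * \<sigma>\<^sup>2) = \<sigma> * sqrt (2 * pi)" using s by (simp add: real_sqrt_mult)
  moreover have "1 / (\<sigma> * sqrt (2*pi)) \<le> 1 / (a * sqrt (2*pi))"
    using assms s by (intro divide_left_mono mult_right_mono) auto
  moreover have "\<sigma>\<^sup>2 \<le> b\<^sup>2" using assms s by (intro power_mono) auto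
  then have "u\<^sup>2 / (2 * b\<^sup>2) \<le> u\<^sup>2 / (2 * \<sigma>\<^sup>2)" using s assms by (intro divide_left_mono) auto
  ultimately show ?thesis unfolding normal_density_def using assms s
    by (intro mult_mono) auto
qed

lemma normal_density_ge:
  assumes "0 < a" "a \<le> \<sigma>" "\<sigma> \<le> b"
  shows "normal_density 0 \<sigma> u \<ge> 1 / (b * sqrt (2 * pi)) * exp (- u\<^sup>2 / (2 * a\<^sup>2))"
proof -
  have s: "0 < \<sigma>" using assms by auto
  have "sqrt (2 * pi * \<sigma>\<^sup>2) = \<sigma> * sqrt (2 * pi)" using s by (simp add: real_sqrt_mult)
  moreover have "1 / (\<sigma> * sqrt (2*pi)) \<ge> 1 / (b * sqrt (2*pi))"
    using assms s by (intro divide_left_mono mult_right_mono) auto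
  moreover have "a\<^sup>2 \<le> \<sigma>\<^sup>2" using assms s by (intro power_mono) auto
  then have "u\<^sup>2 / (2 * a\<^sup>2) \<ge> u\<^sup>2 / (2 * \<sigma>\<^sup>2)" using s assms by (intro divide_left_mono) auto
  ultimately show ?thesis unfolding normal_density_def using assms s
    by (intro mult_mono) auto
qed

text \<open>From \<open>y ^ k \<le> k! * exp y\<close> and \<open>2 * b\<^sup>2 * \<bar>u\<bar> \<le> u\<^sup>2 + b ^ 4\<close>.\<close>

lemma polynomial_times_gauss_bounded:
  fixes u b :: real
  assumes "0 < b"
  shows "(1 + \<bar>u\<bar>)^k * exp (- u\<^sup>2 / (2 * b\<^sup>2)) \<le> fact k * exp (1 + b\<^sup>2 / 2)"
proof -
  have e: "(1 + \<bar>u\<bar>)^k \<le> (fact k :: real) * exp (1 + \<bar>u\<bar>)"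
  proof -
    have "(1 + \<bar>u\<bar>)^k / fact k \<le> (\<Sum>j\<le>k. (1 + \<bar>u\<bar>)^j / fact j)"
      by (rule member_le_sum[of k "{..k}" "\<lambda>j. (1 + \<bar>u\<bar>)^j / fact j :: real"]) auto
    also have "\<dots> \<le> exp (1 + \<bar>u\<bar>)"
      using sum_le_suminf[OF summable_exp_generic[of "1 + \<bar>u\<bar>"], of "{..k}"]
      by (simp add: exp_def divide_inverse mult.commute)
    finally show ?thesis by (simp add: field_simps)
  qed
  have "0 \<le> (\<bar>u\<bar> - b\<^sup>2)\<^sup>2" by simp
  then have "\<bar>u\<bar> * b\<^sup>2 * 2 \<le> u\<^sup>2 + b\<^sup>2 * b\<^sup>2"
    unfolding power2_diff by (simp add: power2_eq_square algebra_simps)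
  then have "\<bar>u\<bar> - u\<^sup>2 / (2 * b\<^sup>2) \<le> b\<^sup>2 / 2"
    using assms by (simp add: field_simps power2_eq_square)
  then have "exp (1 + \<bar>u\<bar>) * exp (- u\<^sup>2 / (2 * b\<^sup>2)) \<le> exp (1 + b\<^sup>2/2)"
    unfolding exp_add[symmetric] by simp
  then have *: "fact k * (exp (1 + \<bar>u\<bar>) * exp (- u\<^sup>2 / (2 * b\<^sup>2))) \<le> fact k * exp (1 + b\<^sup>2/2)"
    by (intro mult_left_mono) auto
  have "(1 + \<bar>u\<bar>)^k * exp (- u\<^sup>2 / (2 * b\<^sup>2)) \<le> fact k * exp (1 + \<bar>u\<bar>) * exp (- u\<^sup>2 / (2 * b\<^sup>2))"
    using e by (intro mult_right_mono) auto
  with * show ?thesis by (simp only: mult.assoc)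
qed

lemma gauss_deriv_bounded:
  assumes "0 < a"
  shows "\<exists>D>0. \<forall>\<sigma>\<in>{a..b}. \<forall>u. \<bar>gauss_deriv k \<sigma> u\<bar> \<le> D"
proof -
  obtain C where C: "C \<ge> 0" "\<And>\<sigma> u. \<sigma> \<ge> a \<Longrightarrow> \<bar>gauss_deriv k \<sigma> u\<bar> \<le> C * (1 + \<bar>u\<bar>)^k * normal_density 0 \<sigma> u"
    using gauss_deriv_le_density[OF assms, of k] by auto
  let ?D = "C * (1 / (a * sqrt (2 * pi)) * (fact k * exp (1 + b\<^sup>2 / 2)))"
  have "\<bar>gauss_deriv k \<sigma> u\<bar> \<le> ?D" if s: "\<sigma> \<in> {a..b}" for \<sigma> u
  proof -
    have "\<bar>gauss_deriv k \<sigma> u\<bar> \<le> C * ((1 + \<bar>u\<bar>)^k * normal_density 0 \<sigma> u)"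
      using C(2)[of \<sigma> u] s by (simp add: mult.assoc)
    also have "\<dots> \<le> C * ((1 + \<bar>u\<bar>)^k * (1 / (a * sqrt (2 * pi)) * exp (- u\<^sup>2 / (2 * b\<^sup>2))))"
      using s assms C(1) by (intro mult_left_mono normal_density_le) auto
    also have "\<dots> = C * (1 / (a * sqrt (2 * pi)) * ((1 + \<bar>u\<bar>)^k * exp (- u\<^sup>2 / (2 * b\<^sup>2))))"
      by (simp add: mult_ac)
    also have "\<dots> \<le> ?D" using assms C(1) s
      by (intro mult_left_mono polynomial_times_gauss_bounded) auto
    finally show ?thesis .
  qed
  moreover have "?D + 1 > 0" using C(1) assms by (intro add_nonneg_pos) auto
  ultimately show ?thesis
    by (intro exI[of _ "?D+1"] conjI ballI allI order_trans[OF _ less_imp_le[OF less_add_one]])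
qed

lemma has_derivative_from_quadratic_bound:
  fixes f :: "real \<Rightarrow> real"
  assumes "\<And>t. \<bar>f (x + t) - f x - t * d\<bar> \<le> K * t\<^sup>2"
  shows "(f has_real_derivative d) (at x)"
proof -
  have "((\<lambda>t. (f (x + t) - f x) / t - d) \<longlongrightarrow> 0) (at 0)"
  proof (rule Lim_null_comparison)
    show "\<forall>\<^sub>F t in at 0. norm ((f (x + t) - f x) / t - d) \<le> K * \<bar>t\<bar>"
    proof (rule eventually_at_filter[THEN iffD2, OF always_eventually], safe)
      fix t :: real assume t: "t \<noteq> 0"
      have "\<bar>(f (x + t) - f x) / t - d\<bar> = \<bar>f (x + t) - f x - t * d\<bar> / \<bar>t\<bar>"
        unfolding abs_divide[symmetric] using t
        by (intro arg_cong[where f=abs]) (simp add: field_simps)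
      also have "\<dots> \<le> K * t\<^sup>2 / \<bar>t\<bar>" using assms by (intro divide_right_mono) auto
      also have "\<dots> = K * \<bar>t\<bar>" using t by (simp add: power2_eq_square field_simps)
      finally show "norm ((f (x + t) - f x) / t - d) \<le> K * \<bar>t\<bar>" by simp
    qed
    show "((\<lambda>t. K * \<bar>t\<bar>) \<longlongrightarrow> 0) (at 0)"
      by (auto intro!: tendsto_eq_intros)
  qed
  then show ?thesis unfolding DERIV_def by (simp add: LIM_zero_iff)
qed

lemma quadratic_bound_from_second_derivative:
  fixes f :: "real \<Rightarrow> real"
  assumes "\<And>x. (f has_real_derivative f' x) (at x)" "\<And>x. (f' has_real_derivative f'' x) (at x)"
    and "\<And>x. \<bar>f'' x\<bar> \<le> D"
  shows "\<bar>f (x + t) - f x - t * f' x\<bar> \<le> D * t\<^sup>2"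
proof -
  have lip: "\<bar>f' y - f' x\<bar> \<le> D * \<bar>y - x\<bar>" for y
    using field_differentiable_bound[of UNIV f' f'' D y x] assms(2,3) by auto
  have "\<bar>(\<lambda>y. f y - y * f' x) (x + t) - (\<lambda>y. f y - y * f' x) x\<bar> \<le> (D * \<bar>t\<bar>) * \<bar>x + t - x\<bar>"
  proof (rule field_differentiable_bound[of "closed_segment x (x+t)" _ "\<lambda>y. f' y - f' x", unfolded real_norm_def])
    fix y assume y: "y \<in> closed_segment x (x + t)"
    then have "\<bar>y - x\<bar> \<le> \<bar>t\<bar>" by (auto simp: closed_segment_eq_real_ivl split: if_splits)
    moreover have "D \<ge> 0" using assms(3)[of 0] by linarith
    ultimately have "D * \<bar>y - x\<bar> \<le> D * \<bar>t\<bar>" by (rule mult_left_mono)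
    with lip[of y] show "\<bar>f' y - f' x\<bar> \<le> D * \<bar>t\<bar>" by linarith
    show "((\<lambda>y. f y - y * f' x) has_field_derivative f' y - f' x) (at y within closed_segment x (x + t))"
      using assms(1)[of y] by (auto intro!: derivative_eq_intros intro: has_field_derivative_at_within)
  qed auto
  then show ?thesis by (simp add: algebra_simps power2_eq_square)
qed

section \<open>Mixture densities\<close>

declare gauss_deriv.simps(2,3)[simp del]

text \<open>The scales are bounded away from zero and infinity and the locations are bounded, so all the constants below are
uniform over the mixing measures.\<close>

locale mixture_box =
  fixes M s1 s2 :: real
  assumes M_pos: "0 < M" and s1_pos: "0 < s1" and s1_less_s2: "s1 < s2"
begin

abbreviation (input) mixing :: "(real \<times> real) measure set" where
  "mixing \<equiv> mixing_measures M s1 s2"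

text \<open>The \<open>k\<close>-th derivative of the mixture density, obtained by differentiating under the integral sign.\<close>

definition mix_deriv :: "nat \<Rightarrow> (real \<times> real) measure \<Rightarrow> real \<Rightarrow> real" where
  "mix_deriv k \<eta> x = (LINT w|\<eta>. gauss_deriv k (snd w) (x - fst w))"

lemma mix_density_eq: "mix_density = mix_deriv 0"
  by (intro ext) (simp add: mix_density_def mix_deriv_def case_prod_unfold)

lemma mixing_prob: "\<eta> \<in> mixing \<Longrightarrow> prob_space \<eta>"
  and mixing_sets: "\<eta> \<in> mixing \<Longrightarrow> sets \<eta> = sets borel"
  and mixing_reflect: "\<eta> \<in> mixing \<Longrightarrow> distr \<eta> borel (\<lambda>w. (- fst w, snd w)) = \<eta>"
  by (auto simp: mixing_measures_def case_prod_unfold)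

lemma mixing_AE:
  assumes "\<eta> \<in> mixing"
  shows "AE w in \<eta>. \<bar>fst w\<bar> \<le> M \<and> s1 \<le> snd w \<and> snd w \<le> s2"
proof -
  interpret prob_space \<eta> by (rule mixing_prob[OF assms])
  have "mix_box M s1 s2 \<in> sets \<eta>"
    unfolding mixing_sets[OF assms] mix_box_def
    by (intro borel_closed closed_Times) auto
  moreover have "prob (mix_box M s1 s2) = 1"
    using assms by (simp add: mixing_measures_def measure_def)
  ultimately have "AE w in \<eta>. w \<in> mix_box M s1 s2" by (simp add: prob_eq_1)
  then show ?thesis by eventually_elim (auto simp: mix_box_def)
qed

lemma kernel_measurable:
  assumes "\<eta> \<in> mixing"
  shows "(\<lambda>w. gauss_deriv k (snd w) (x - fst w)) \<in> borel_measurable \<eta>"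
proof -
  have "(\<lambda>w :: real \<times> real. gauss_deriv k (snd w) (x - fst w)) \<in> borel_measurable borel"
    unfolding borel_prod[symmetric] by measurable
  then show ?thesis using mixing_sets[OF assms] by (simp cong: measurable_cong_sets)
qed

lemma kernel_integrable:
  assumes "\<eta> \<in> mixing"
  shows "integrable \<eta> (\<lambda>w. gauss_deriv k (snd w) (x - fst w))"
proof -
  interpret prob_space \<eta> by (rule mixing_prob[OF assms])
  obtain D where D: "\<And>\<sigma> u. \<sigma> \<in> {s1..s2} \<Longrightarrow> \<bar>gauss_deriv k \<sigma> u\<bar> \<le> D"
    using gauss_deriv_bounded[OF s1_pos, of s2 k] by blast
  show ?thesis
    by (rule integrable_const_bound[of _ D, OF _ kernel_measurable[OF assms]])
      (use mixing_AE[OF assms] in eventually_elim, auto intro: D)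
qed

lemma mix_deriv_bounded: "\<exists>D>0. \<forall>\<eta>\<in>mixing. \<forall>x. \<bar>mix_deriv k \<eta> x\<bar> \<le> D"
proof -
  obtain D where D: "D > 0" "\<And>\<sigma> u. \<sigma> \<in> {s1..s2} \<Longrightarrow> \<bar>gauss_deriv k \<sigma> u\<bar> \<le> D"
    using gauss_deriv_bounded[OF s1_pos, of s2 k] by blast
  have "\<bar>mix_deriv k \<eta> x\<bar> \<le> D" if \<eta>: "\<eta> \<in> mixing" for \<eta> x
  proof -
    interpret prob_space \<eta> by (rule mixing_prob[OF \<eta>])
    have "\<bar>mix_deriv k \<eta> x\<bar> \<le> (LINT w|\<eta>. \<bar>gauss_deriv k (snd w) (x - fst w)\<bar>)"
      unfolding mix_deriv_def by (rule integral_abs_bound)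
    also have "\<dots> \<le> (LINT w|\<eta>. D)"
    proof (rule integral_mono_AE)
      show "AE w in \<eta>. \<bar>gauss_deriv k (snd w) (x - fst w)\<bar> \<le> D"
        using mixing_AE[OF \<eta>] by eventually_elim (auto intro: D)
    qed (auto intro: kernel_integrable[OF \<eta>])
    finally show ?thesis by (simp add: prob_space)
  qed
  with D(1) show ?thesis by auto
qed

text \<open>The kernels have second derivatives bounded uniformly over the box, so their first-order Taylor error is at most
\<open>D * t\<^sup>2\<close>; integrating this bound over the mixing measure gives differentiability of the mixture.\<close>

lemma mix_deriv_has_derivative:
  assumes \<eta>: "\<eta> \<in> mixing"
  shows "(mix_deriv k \<eta> has_real_derivative mix_deriv (Suc k) \<eta> x) (at x)"
proof -
  interpret prob_space \<eta> by (rule mixing_prob[OF \<eta>])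
  obtain D where D: "\<And>\<sigma> u. \<sigma> \<in> {s1..s2} \<Longrightarrow> \<bar>gauss_deriv (Suc (Suc k)) \<sigma> u\<bar> \<le> D"
    using gauss_deriv_bounded[OF s1_pos, of s2 "Suc (Suc k)"] by blast
  let ?K = "\<lambda>k x w. gauss_deriv k (snd w) (x - fst w)"
  note int = kernel_integrable[OF \<eta>]
  show ?thesis
  proof (rule has_derivative_from_quadratic_bound[of _ _ _ D])
    fix t
    have eq: "mix_deriv k \<eta> (x + t) - mix_deriv k \<eta> x - t * mix_deriv (Suc k) \<eta> x
       = (LINT w|\<eta>. ?K k (x+t) w - ?K k x w - t * ?K (Suc k) x w)"
      unfolding mix_deriv_def by (simp add: int del: gauss_deriv.simps)
    have "\<bar>mix_deriv k \<eta> (x + t) - mix_deriv k \<eta> x - t * mix_deriv (Suc k) \<eta> x\<bar>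
        \<le> (LINT w|\<eta>. \<bar>?K k (x+t) w - ?K k x w - t * ?K (Suc k) x w\<bar>)"
      unfolding eq by (rule integral_abs_bound)
    also have "\<dots> \<le> (LINT w|\<eta>. D * t\<^sup>2)"
    proof (rule integral_mono_AE)
      show "integrable \<eta> (\<lambda>w. \<bar>?K k (x+t) w - ?K k x w - t * ?K (Suc k) x w\<bar>)"
        by (intro integrable_abs Bochner_Integration.integrable_diff int integrable_mult_right)
      show "AE w in \<eta>. \<bar>?K k (x+t) w - ?K k x w - t * ?K (Suc k) x w\<bar> \<le> D * t\<^sup>2"
        using mixing_AE[OF \<eta>]
      proof eventually_elim
        case (elim w)
        then have s: "snd w > 0" "snd w \<in> {s1..s2}" using s1_pos by auto
        have "\<bar>gauss_deriv k (snd w) (x - fst w + t) - gauss_deriv k (snd w) (x - fst w)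
            - t * gauss_deriv (Suc k) (snd w) (x - fst w)\<bar> \<le> D * t\<^sup>2"
          by (rule quadratic_bound_from_second_derivative[OF gauss_deriv_has_derivative
                gauss_deriv_has_derivative D]) (use s in auto)
        then show ?case by (simp add: algebra_simps)
      qed
    qed auto
    finally show "\<bar>mix_deriv k \<eta> (x + t) - mix_deriv k \<eta> x - t * mix_deriv (Suc k) \<eta> x\<bar> \<le> D * t\<^sup>2"
      by (simp add: prob_space)
  qed
qed

lemma mix_deriv_isCont: "\<eta> \<in> mixing \<Longrightarrow> isCont (mix_deriv k \<eta>) x"
  using mix_deriv_has_derivative DERIV_isCont by blast

lemma mix_deriv_continuous_on: "\<eta> \<in> mixing \<Longrightarrow> continuous_on A (mix_deriv k \<eta>)"
  by (simp add: continuous_at_imp_continuous_on mix_deriv_isCont)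

lemma mix_deriv_measurable: "\<eta> \<in> mixing \<Longrightarrow> mix_deriv k \<eta> \<in> borel_measurable borel"
  by (simp add: borel_measurable_continuous_onI mix_deriv_continuous_on)

lemma mix_deriv_even_odd:
  assumes "\<eta> \<in> mixing"
  shows "mix_deriv k \<eta> (- x) = (- 1) ^ k * mix_deriv k \<eta> x"
proof -
  have meas: "(\<lambda>w. (- fst w, snd w)) \<in> measurable \<eta> borel"
    using mixing_sets[OF assms] unfolding borel_prod[symmetric]
    by (subst measurable_cong_sets[OF mixing_sets[OF assms, unfolded borel_prod[symmetric]] refl]) measurable
  have "mix_deriv k \<eta> (- x) = (LINT w|distr \<eta> borel (\<lambda>w. (- fst w, snd w)). gauss_deriv k (snd w) (- x - fst w))"
    unfolding mixing_reflect[OF assms] mix_deriv_def ..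
  also have "\<dots> = (LINT w|\<eta>. gauss_deriv k (snd w) (- (x - fst w)))"
    by (subst integral_distr[OF meas]) (use kernel_measurable[OF assms] mixing_sets[OF assms] in
      \<open>auto simp: algebra_simps cong: measurable_cong_sets\<close>)
  also have "\<dots> = (-1)^k * mix_deriv k \<eta> x"
    unfolding gauss_deriv_even_odd mix_deriv_def by simp
  finally show ?thesis .
qed

lemma mix_deriv_le_density:
  "\<exists>C>0. \<forall>\<eta>\<in>mixing. \<forall>x. \<bar>mix_deriv k \<eta> x\<bar> \<le> C * (1 + \<bar>x\<bar>) ^ k * mix_deriv 0 \<eta> x"
proof -
  obtain C where C: "C \<ge> 0" "\<And>\<sigma> u. \<sigma> \<ge> s1 \<Longrightarrow>
      \<bar>gauss_deriv k \<sigma> u\<bar> \<le> C * (1 + \<bar>u\<bar>)^k * normal_density 0 \<sigma> u"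
    using gauss_deriv_le_density[OF s1_pos, of k] by auto
  have "\<bar>mix_deriv k \<eta> x\<bar> \<le> (C + 1) * (1 + M) ^ k * (1 + \<bar>x\<bar>) ^ k * mix_deriv 0 \<eta> x" if \<eta>: "\<eta> \<in> mixing" for \<eta> x
  proof -
    have "\<bar>mix_deriv k \<eta> x\<bar> \<le> (LINT w|\<eta>. \<bar>gauss_deriv k (snd w) (x - fst w)\<bar>)"
      unfolding mix_deriv_def by (rule integral_abs_bound)
    also have "\<dots> \<le> (LINT w|\<eta>. (C + 1) * (1 + M) ^ k * (1 + \<bar>x\<bar>) ^ k * gauss_deriv 0 (snd w) (x - fst w))"
    proof (rule integral_mono_AE)
      show "AE w in \<eta>. \<bar>gauss_deriv k (snd w) (x - fst w)\<bar>
          \<le> (C + 1) * (1 + M) ^ k * (1 + \<bar>x\<bar>) ^ k * gauss_deriv 0 (snd w) (x - fst w)"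
        using mixing_AE[OF \<eta>]
      proof eventually_elim
        case (elim w)
        have "1 + \<bar>x - fst w\<bar> \<le> (1 + M) * (1 + \<bar>x\<bar>)"
        proof -
          have "1 + \<bar>x - fst w\<bar> \<le> 1 + \<bar>x\<bar> + M" using elim by linarith
          also have "\<dots> \<le> 1 + \<bar>x\<bar> + M + M * \<bar>x\<bar>" using M_pos by simp
          finally show ?thesis by (simp add: algebra_simps)
        qed
        then have "(1 + \<bar>x - fst w\<bar>) ^ k \<le> (1 + M) ^ k * (1 + \<bar>x\<bar>) ^ k"
          unfolding power_mult_distrib[symmetric] by (intro power_mono) auto
        then have "C * (1 + \<bar>x - fst w\<bar>) ^ k \<le> (C + 1) * ((1 + M) ^ k * (1 + \<bar>x\<bar>) ^ k)"
          using C(1) M_pos by (intro mult_mono) auto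
        from mult_right_mono[OF this, of "normal_density 0 (snd w) (x - fst w)"]
        show ?case using C(2)[of "snd w" "x - fst w"] elim by (simp add: mult.assoc)
      qed
    qed (intro integrable_abs integrable_mult_right kernel_integrable[OF \<eta>])+
    finally show ?thesis unfolding mix_deriv_def by simp
  qed
  then show ?thesis using C(1) M_pos by (intro exI[of _ "(C + 1) * (1 + M) ^ k"]) auto
qed

lemma mix_deriv_lower:
  assumes \<eta>: "\<eta> \<in> mixing"
  shows "mix_deriv 0 \<eta> x \<ge> 1 / (s2 * sqrt (2 * pi)) * exp (- (\<bar>x\<bar> + M)\<^sup>2 / (2 * s1\<^sup>2))"
proof -
  interpret prob_space \<eta> by (rule mixing_prob[OF \<eta>])
  have "(LINT w|\<eta>. 1 / (s2 * sqrt (2 * pi)) * exp (- (\<bar>x\<bar> + M)\<^sup>2 / (2 * s1\<^sup>2))) \<le> mix_deriv 0 \<eta> x"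
    unfolding mix_deriv_def
  proof (rule integral_mono_AE[OF _ kernel_integrable[OF \<eta>]])
    show "AE w in \<eta>. 1 / (s2 * sqrt (2 * pi)) * exp (- (\<bar>x\<bar> + M)\<^sup>2 / (2 * s1\<^sup>2))
        \<le> gauss_deriv 0 (snd w) (x - fst w)"
      using mixing_AE[OF \<eta>]
    proof eventually_elim
      case (elim w)
      have "\<bar>x - fst w\<bar>\<^sup>2 \<le> (\<bar>x\<bar> + M)\<^sup>2" using elim by (intro power_mono) auto
      then have "- (\<bar>x\<bar> + M)\<^sup>2 / (2 * s1\<^sup>2) \<le> - (x - fst w)\<^sup>2 / (2 * s1\<^sup>2)"
        using s1_pos by (intro divide_right_mono) auto
      then have "1 / (s2 * sqrt (2 * pi)) * exp (- (\<bar>x\<bar> + M)\<^sup>2 / (2 * s1\<^sup>2))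
         \<le> 1 / (s2 * sqrt (2 * pi)) * exp (- (x - fst w)\<^sup>2 / (2 * s1\<^sup>2))"
        using s1_pos s1_less_s2 by (intro mult_left_mono) auto
      also have "\<dots> \<le> gauss_deriv 0 (snd w) (x - fst w)"
        using normal_density_ge[OF s1_pos, of "snd w" s2] elim by simp
      finally show ?case .
    qed
  qed auto
  then show ?thesis by (simp add: prob_space)
qed

lemma mix_deriv_pos: "\<eta> \<in> mixing \<Longrightarrow> mix_deriv 0 \<eta> x > 0"
  by (rule less_le_trans[OF _ mix_deriv_lower]) (use s1_pos s1_less_s2 in auto)

text \<open>Moving the centre by at most \<open>M\<close> costs a constant factor once the variance is doubled:
\<open>(x - z)\<^sup>2 \<ge> x\<^sup>2 / 2 - z\<^sup>2\<close>.\<close>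

lemma mix_deriv_upper:
  "\<exists>B>0. \<forall>\<eta>\<in>mixing. \<forall>x. mix_deriv 0 \<eta> x \<le> B * exp (- x\<^sup>2 / (2 * (sqrt 2 * s2)\<^sup>2))"
proof -
  let ?B = "1 / (s1 * sqrt (2 * pi)) * exp (M\<^sup>2 / (2 * s2\<^sup>2))"
  have "mix_deriv 0 \<eta> x \<le> ?B * exp (- x\<^sup>2 / (2 * (sqrt 2 * s2)\<^sup>2))" if \<eta>: "\<eta> \<in> mixing" for \<eta> x
  proof -
    interpret prob_space \<eta> by (rule mixing_prob[OF \<eta>])
    have "mix_deriv 0 \<eta> x \<le> (LINT w|\<eta>. ?B * exp (- x\<^sup>2 / (2 * (sqrt 2 * s2)\<^sup>2)))"
      unfolding mix_deriv_def
    proof (rule integral_mono_AE[OF kernel_integrable[OF \<eta>]])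
      show "AE w in \<eta>. gauss_deriv 0 (snd w) (x - fst w) \<le> ?B * exp (- x\<^sup>2 / (2 * (sqrt 2 * s2)\<^sup>2))"
        using mixing_AE[OF \<eta>]
      proof eventually_elim
        case (elim w)
        let ?z = "fst w"
        have "0 \<le> (x - 2 * ?z)\<^sup>2" by simp
        then have "x\<^sup>2 / 2 - ?z\<^sup>2 \<le> (x - ?z)\<^sup>2" by (simp add: power2_eq_square algebra_simps)
        moreover have "?z\<^sup>2 \<le> M\<^sup>2" using elim M_pos by (simp add: abs_le_square_iff[symmetric])
        ultimately have "- (x - ?z)\<^sup>2 \<le> M\<^sup>2 - x\<^sup>2 / 2" by linarith
        then have "- (x - ?z)\<^sup>2 / (2 * s2\<^sup>2) \<le> (M\<^sup>2 - x\<^sup>2 / 2) / (2 * s2\<^sup>2)"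
          by (intro divide_right_mono) auto
        also have "\<dots> = M\<^sup>2 / (2 * s2\<^sup>2) + - x\<^sup>2 / (2 * (sqrt 2 * s2)\<^sup>2)"
          using s1_pos s1_less_s2 by (simp add: power_mult_distrib diff_divide_distrib)
        finally have "exp (- (x - ?z)\<^sup>2 / (2 * s2\<^sup>2)) \<le> exp (M\<^sup>2 / (2 * s2\<^sup>2)) * exp (- x\<^sup>2 / (2 * (sqrt 2 * s2)\<^sup>2))"
          unfolding exp_add[symmetric] by simp
        then have "1 / (s1 * sqrt (2 * pi)) * exp (- (x - ?z)\<^sup>2 / (2 * s2\<^sup>2))
          \<le> 1 / (s1 * sqrt (2 * pi)) * (exp (M\<^sup>2 / (2 * s2\<^sup>2)) * exp (- x\<^sup>2 / (2 * (sqrt 2 * s2)\<^sup>2)))"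
          using s1_pos by (intro mult_left_mono) auto
        with normal_density_le[OF s1_pos, of "snd w" s2 "x - ?z"] elim
        show ?case unfolding gauss_deriv.simps mult.assoc by linarith
      qed
    qed auto
    then show ?thesis by (simp add: prob_space)
  qed
  then show ?thesis using s1_pos by (intro exI[of _ ?B]) auto
qed

lemma polynomial_density_integrable:
  assumes \<eta>: "\<eta> \<in> mixing" and f: "f \<in> borel_measurable borel"
    and bound: "\<And>x. \<bar>f x\<bar> \<le> C * (1 + x\<^sup>2) ^ m"
  shows "integrable lborel (\<lambda>x. f x * mix_deriv 0 \<eta> x)"
proof -
  obtain B where B: "B > 0" "\<And>x. mix_deriv 0 \<eta> x \<le> B * exp (- x\<^sup>2 / (2 * (sqrt 2 * s2)\<^sup>2))"
    using mix_deriv_upper \<eta> by blast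
  let ?b = "sqrt 2 * s2"
  have b: "?b > 0" using s1_pos s1_less_s2 by auto
  have C0: "C \<ge> 0" using bound[of 0] by simp
  have int: "integrable lborel (\<lambda>x. C * 2^m * B * sqrt (2 * pi * ?b\<^sup>2) *
      (normal_density 0 ?b x + normal_density 0 ?b x * \<bar>x - 0\<bar> ^ (2*m)))"
    using b by (intro integrable_mult_right Bochner_Integration.integrable_add
        integrable_normal_density integrable_normal_moment_abs)
  show ?thesis
  proof (rule Bochner_Integration.integrable_bound[OF int])
    show "(\<lambda>x. f x * mix_deriv 0 \<eta> x) \<in> borel_measurable lborel"
      using f mix_deriv_measurable[OF \<eta>, of 0] by measurable
    show "AE x in lborel. norm (f x * mix_deriv 0 \<eta> x) \<le> norm (C * 2^m * B * sqrt (2 * pi * ?b\<^sup>2) *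
      (normal_density 0 ?b x + normal_density 0 ?b x * \<bar>x - 0\<bar> ^ (2*m)))"
    proof (rule AE_I2)
      fix x :: real
      have rearrange: "c * (p * (1 + a)) * (d * (s * n)) = c * p * d * s * (n + n * a)"
        for a c d n p s :: real by (simp add: algebra_simps)
      have "(1 + x\<^sup>2) ^ m \<le> (2 * max 1 (x\<^sup>2)) ^ m" by (intro power_mono) (auto simp: max_def)
      also have "\<dots> = 2^m * (max 1 (x\<^sup>2))^m" by (rule power_mult_distrib)
      also have "(max 1 (x\<^sup>2))^m \<le> 1 + (x\<^sup>2)^m" by (auto simp: max_def)
      finally have p: "(1 + x\<^sup>2) ^ m \<le> 2^m * (1 + \<bar>x\<bar>^(2*m))" by (simp add: power_mult)
      have "norm (f x * mix_deriv 0 \<eta> x) = \<bar>f x\<bar> * mix_deriv 0 \<eta> x"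
        using mix_deriv_pos[OF \<eta>, of x] by (simp add: abs_mult)
      also have "\<dots> \<le> (C * (2^m * (1 + \<bar>x\<bar>^(2*m)))) * (B * exp (- x\<^sup>2 / (2 * ?b\<^sup>2)))"
        using mix_deriv_pos[OF \<eta>, of x] B(2)[of x] C0
        by (intro mult_mono order_trans[OF bound mult_left_mono[OF p C0]]) auto
      also have "exp (- x\<^sup>2 / (2 * ?b\<^sup>2)) = sqrt (2 * pi * ?b\<^sup>2) * normal_density 0 ?b x"
        using b s1_pos s1_less_s2 by (simp add: normal_density_def)
      finally have "norm (f x * mix_deriv 0 \<eta> x) \<le> C * 2^m * B * sqrt (2 * pi * ?b\<^sup>2) *
        (normal_density 0 ?b x + normal_density 0 ?b x * \<bar>x - 0\<bar> ^ (2*m))"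
        unfolding rearrange diff_0_right .
      then show "norm (f x * mix_deriv 0 \<eta> x) \<le> norm (C * 2^m * B * sqrt (2 * pi * ?b\<^sup>2) *
        (normal_density 0 ?b x + normal_density 0 ?b x * \<bar>x - 0\<bar> ^ (2*m)))"
        by (rule order_trans) (simp only: real_norm_def abs_ge_self)
    qed
  qed
qed

lemma density_integrable: "\<eta> \<in> mixing \<Longrightarrow> integrable lborel (mix_deriv 0 \<eta>)"
  using polynomial_density_integrable[of \<eta> "\<lambda>_. 1" 1 0] by simp

lemma density_integral: 
  assumes \<eta>: "\<eta> \<in> mixing" shows "(LINT x|lborel. mix_deriv 0 \<eta> x) = 1"
proof -
  interpret \<eta>: prob_space \<eta> by (rule mixing_prob[OF \<eta>])
  interpret pair_sigma_finite \<eta> lborel ..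
  have m: "(\<lambda>(w, x). ennreal (gauss_deriv 0 (snd w) (x - fst w))) \<in> borel_measurable (\<eta> \<Otimes>\<^sub>M lborel)"
  proof -
    have "(\<lambda>(w :: real \<times> real, x). ennreal (gauss_deriv 0 (snd w) (x - fst w)))
       \<in> borel_measurable ((borel \<Otimes>\<^sub>M borel) \<Otimes>\<^sub>M borel)" by measurable
    moreover have "sets (\<eta> \<Otimes>\<^sub>M lborel) = sets ((borel \<Otimes>\<^sub>M borel) \<Otimes>\<^sub>M (borel :: real measure))"
      by (rule sets_pair_measure_cong[OF mixing_sets[OF \<eta>, folded borel_prod] sets_lborel])
    ultimately show ?thesis
      using measurable_cong_sets[of "\<eta> \<Otimes>\<^sub>M lborel" _ borel borel] by blast
  qed
  have "ennreal (LINT x|lborel. mix_deriv 0 \<eta> x) = (\<integral>\<^sup>+x. ennreal (mix_deriv 0 \<eta> x) \<partial>lborel)"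
    using mix_deriv_pos[OF \<eta>] by (intro nn_integral_eq_integral[symmetric] density_integrable \<eta>) (auto simp: less_imp_le)
  also have "\<dots> = (\<integral>\<^sup>+x. (\<integral>\<^sup>+w. ennreal (gauss_deriv 0 (snd w) (x - fst w)) \<partial>\<eta>) \<partial>lborel)"
    unfolding mix_deriv_def by (intro nn_integral_cong nn_integral_eq_integral[symmetric] kernel_integrable \<eta>) auto
  also have "\<dots> = (\<integral>\<^sup>+w. (\<integral>\<^sup>+x. ennreal (gauss_deriv 0 (snd w) (x - fst w)) \<partial>lborel) \<partial>\<eta>)"
    using Fubini[OF m] by simp
  also have "\<dots> = (\<integral>\<^sup>+w. 1 \<partial>\<eta>)"
  proof (rule nn_integral_cong_AE)
    show "AE w in \<eta>. (\<integral>\<^sup>+x. ennreal (gauss_deriv 0 (snd w) (x - fst w)) \<partial>lborel) = 1"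
      using mixing_AE[OF \<eta>]
    proof eventually_elim
      case (elim w)
      then have s: "snd w > 0" using s1_pos by auto
      have "(\<integral>\<^sup>+x. ennreal (gauss_deriv 0 (snd w) (x - fst w)) \<partial>lborel) =
          (\<integral>\<^sup>+x. ennreal (normal_density (fst w) (snd w) x) \<partial>lborel)"
        by (simp add: normal_density_def)
      also have "\<dots> = ennreal (LINT x|lborel. normal_density (fst w) (snd w) x)"
        using s by (intro nn_integral_eq_integral) auto
      finally show ?case using s by simp
    qed
  qed
  finally show ?thesis by (simp add: \<eta>.emeasure_space_1)
qed

end

lemma odd_integral_zero:
  fixes f :: "real \<Rightarrow> real"
  assumes "\<And>x. f (- x) = - f x"
  shows "(LINT x|lborel. f x) = 0"
  using lborel_integral_real_affine[of "-1" f 0] assms by simp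

section \<open>Score and information\<close>

context mixture_box begin

definition log_density :: "(real \<times> real) measure \<Rightarrow> real \<Rightarrow> real" where
  "log_density \<eta> x = ln (mix_deriv 0 \<eta> x)"

text \<open>As a function of the location parameter \<open>\<theta>\<close>, the score at \<open>x\<close> is minus this function at \<open>x - \<theta>\<close>.\<close>

definition log_slope :: "(real \<times> real) measure \<Rightarrow> real \<Rightarrow> real" where
  "log_slope \<eta> x = mix_deriv 1 \<eta> x / mix_deriv 0 \<eta> x"

definition log_curv :: "(real \<times> real) measure \<Rightarrow> real \<Rightarrow> real" where
  "log_curv \<eta> x = mix_deriv 2 \<eta> x / mix_deriv 0 \<eta> x - (log_slope \<eta> x)\<^sup>2"

definition info :: "(real \<times> real) measure \<Rightarrow> real" where
  "info \<eta> = (LINT x|lborel. (log_slope \<eta> x)\<^sup>2 * mix_deriv 0 \<eta> x)"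

lemma log_density_has_derivative:
  assumes "\<eta> \<in> mixing"
  shows "(log_density \<eta> has_real_derivative log_slope \<eta> x) (at x)"
  unfolding log_density_def[abs_def] log_slope_def using assms
  by (auto intro!: derivative_eq_intros mix_deriv_has_derivative simp: mix_deriv_pos)

lemma log_slope_has_derivative:
  assumes "\<eta> \<in> mixing"
  shows "(log_slope \<eta> has_real_derivative log_curv \<eta> x) (at x)"
proof -
  have "((\<lambda>x. mix_deriv 1 \<eta> x / mix_deriv 0 \<eta> x) has_real_derivative
     (mix_deriv (Suc 1) \<eta> x * mix_deriv 0 \<eta> x - mix_deriv 1 \<eta> x * mix_deriv (Suc 0) \<eta> x) / (mix_deriv 0 \<eta> x * mix_deriv 0 \<eta> x)) (at x)"
    using mix_deriv_pos[OF assms, of x] by (intro DERIV_divide mix_deriv_has_derivative assms) auto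
  moreover have "(mix_deriv (Suc 1) \<eta> x * mix_deriv 0 \<eta> x - mix_deriv 1 \<eta> x * mix_deriv (Suc 0) \<eta> x) / (mix_deriv 0 \<eta> x * mix_deriv 0 \<eta> x)
     = log_curv \<eta> x"
    using mix_deriv_pos[OF assms, of x] unfolding log_curv_def log_slope_def
    by (simp add: field_simps power2_eq_square numeral_2_eq_2)
  ultimately show ?thesis unfolding log_slope_def[abs_def] by simp
qed

lemma log_density_continuous: "\<eta> \<in> mixing \<Longrightarrow> continuous_on A (log_density \<eta>)"
  by (meson DERIV_isCont continuous_at_imp_continuous_on log_density_has_derivative)

lemma log_slope_continuous: "\<eta> \<in> mixing \<Longrightarrow> continuous_on A (log_slope \<eta>)"
  by (meson DERIV_isCont continuous_at_imp_continuous_on log_slope_has_derivative)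

lemma log_curv_continuous: "\<eta> \<in> mixing \<Longrightarrow> continuous_on A (log_curv \<eta>)"
  unfolding log_curv_def[abs_def] using mix_deriv_pos[of \<eta>]
  by (intro continuous_intros mix_deriv_continuous_on log_slope_continuous) (auto simp: less_le)

lemma log_measurable:
  assumes "\<eta> \<in> mixing"
  shows "log_density \<eta> \<in> borel_measurable borel" "log_slope \<eta> \<in> borel_measurable borel"
    "log_curv \<eta> \<in> borel_measurable borel"
  using assms by (auto intro!: borel_measurable_continuous_onI log_density_continuous
      log_slope_continuous log_curv_continuous)

lemma one_plus_abs_power_le: "(1 + \<bar>x\<bar>)\<^sup>2 \<le> 2 * (1 + x\<^sup>2)" for x :: real
  using zero_le_power2[of "1 - \<bar>x\<bar>"] unfolding power2_sum power2_diff power2_abs by simp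

lemma log_slope_bound: "\<exists>C>0. \<forall>\<eta>\<in>mixing. \<forall>x. \<bar>log_slope \<eta> x\<bar> \<le> C * (1 + \<bar>x\<bar>)"
proof -
  obtain C where C: "C > 0" "\<And>\<eta> x. \<eta> \<in> mixing \<Longrightarrow> \<bar>mix_deriv 1 \<eta> x\<bar> \<le> C * (1 + \<bar>x\<bar>)^1 * mix_deriv 0 \<eta> x"
    using mix_deriv_le_density[of 1] by blast
  have "\<bar>log_slope \<eta> x\<bar> \<le> C * (1 + \<bar>x\<bar>)" if "\<eta> \<in> mixing" for \<eta> x
    using C(2)[OF that, of x] mix_deriv_pos[OF that, of x]
    by (simp add: log_slope_def field_simps)
  with C(1) show ?thesis by blast
qed

lemma log_curv_bound: "\<exists>C>0. \<forall>\<eta>\<in>mixing. \<forall>x. \<bar>log_curv \<eta> x\<bar> \<le> C * (1 + x\<^sup>2)"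
proof -
  obtain C where C: "C > 0" "\<And>\<eta> x. \<eta> \<in> mixing \<Longrightarrow> \<bar>mix_deriv 2 \<eta> x\<bar> \<le> C * (1 + \<bar>x\<bar>)^2 * mix_deriv 0 \<eta> x"
    using mix_deriv_le_density[of 2] by blast
  obtain B where B: "B > 0" "\<And>\<eta> x. \<eta> \<in> mixing \<Longrightarrow> \<bar>log_slope \<eta> x\<bar> \<le> B * (1 + \<bar>x\<bar>)"
    using log_slope_bound by blast
  have "\<bar>log_curv \<eta> x\<bar> \<le> (2 * (C + B\<^sup>2)) * (1 + x\<^sup>2)" if \<eta>: "\<eta> \<in> mixing" for \<eta> x
  proof -
    have 1: "\<bar>mix_deriv 2 \<eta> x / mix_deriv 0 \<eta> x\<bar> \<le> C * (1 + \<bar>x\<bar>)\<^sup>2"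
      using C(2)[OF \<eta>, of x] mix_deriv_pos[OF \<eta>, of x] by (simp add: divide_le_eq)
    have 2: "(log_slope \<eta> x)\<^sup>2 \<le> (B * (1 + \<bar>x\<bar>))\<^sup>2"
      using B(2)[OF \<eta>, of x] by (metis abs_ge_zero power2_abs power_mono)
    have "\<bar>log_curv \<eta> x\<bar> \<le> \<bar>mix_deriv 2 \<eta> x / mix_deriv 0 \<eta> x\<bar> + (log_slope \<eta> x)\<^sup>2"
      unfolding log_curv_def by (rule order_trans[OF abs_triangle_ineq4]) simp
    also have "\<dots> \<le> (C + B\<^sup>2) * (1 + \<bar>x\<bar>)\<^sup>2"
      using add_mono[OF 1 2] unfolding power_mult_distrib distrib_right .
    also have "\<dots> \<le> (C + B\<^sup>2) * (2 * (1 + x\<^sup>2))"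
      using C(1) by (intro mult_left_mono one_plus_abs_power_le) (auto simp: add_nonneg_nonneg less_imp_le)
    finally show ?thesis by (simp only: mult_ac)
  qed
  moreover have "2 * (C + B\<^sup>2) > 0" using C(1) by (simp add: add_pos_nonneg)
  ultimately show ?thesis by blast
qed

lemma log_density_upper:
  "\<exists>B. \<forall>\<eta>\<in>mixing. \<forall>x. log_density \<eta> x \<le> B - x\<^sup>2 / (4 * s2\<^sup>2)"
proof -
  obtain B where B: "B > 0" "\<And>\<eta> x. \<eta> \<in> mixing \<Longrightarrow> mix_deriv 0 \<eta> x \<le> B * exp (- x\<^sup>2 / (2 * (sqrt 2 * s2)\<^sup>2))"
    using mix_deriv_upper by blast
  have "log_density \<eta> x \<le> ln B - x\<^sup>2 / (4 * s2\<^sup>2)" if \<eta>: "\<eta> \<in> mixing" for \<eta> x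
  proof -
    have "log_density \<eta> x \<le> ln (B * exp (- x\<^sup>2 / (2 * (sqrt 2 * s2)\<^sup>2)))"
      unfolding log_density_def using B \<eta> mix_deriv_pos[OF \<eta>, of x] by simp
    also have "\<dots> = ln B - x\<^sup>2 / (4 * s2\<^sup>2)"
      using B(1) by (simp add: ln_mult power_mult_distrib)
    finally show ?thesis .
  qed
  then show ?thesis by blast
qed

lemma log_density_bound: "\<exists>C>0. \<forall>\<eta>\<in>mixing. \<forall>x. \<bar>log_density \<eta> x\<bar> \<le> C * (1 + x\<^sup>2)"
proof -
  obtain B where B: "\<And>\<eta> x. \<eta> \<in> mixing \<Longrightarrow> log_density \<eta> x \<le> B - x\<^sup>2 / (4 * s2\<^sup>2)"
    using log_density_upper by blast
  define K where "K = \<bar>ln (1 / (s2 * sqrt (2 * pi)))\<bar> + (1 + M\<^sup>2) / s1\<^sup>2"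
  have "\<bar>log_density \<eta> x\<bar> \<le> (\<bar>B\<bar> + K + 1) * (1 + x\<^sup>2)" if \<eta>: "\<eta> \<in> mixing" for \<eta> x
  proof -
    have "ln (1 / (s2 * sqrt (2 * pi)) * exp (- (\<bar>x\<bar> + M)\<^sup>2 / (2 * s1\<^sup>2))) \<le> log_density \<eta> x"
      unfolding log_density_def
      using mix_deriv_lower[OF \<eta>, of x] s1_pos s1_less_s2 by (intro ln_mono) (auto simp: mix_deriv_pos \<eta>)
    moreover have "ln (1 / (s2 * sqrt (2 * pi)) * exp (- (\<bar>x\<bar> + M)\<^sup>2 / (2 * s1\<^sup>2)))
      = ln (1 / (s2 * sqrt (2 * pi))) - (\<bar>x\<bar> + M)\<^sup>2 / (2 * s1\<^sup>2)"
      using s1_pos s1_less_s2 by (subst ln_mult) auto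
    moreover have "(\<bar>x\<bar> + M)\<^sup>2 / (2 * s1\<^sup>2) \<le> (1 + M\<^sup>2) / s1\<^sup>2 * (1 + x\<^sup>2)"
    proof -
      have "0 \<le> (\<bar>x\<bar> - M)\<^sup>2" by simp
      then have "(\<bar>x\<bar> + M)\<^sup>2 \<le> 2 * x\<^sup>2 + 2 * M\<^sup>2" unfolding power2_sum power2_diff by simp
      also have "\<dots> \<le> 2 * ((1 + M\<^sup>2) * (1 + x\<^sup>2))" by (simp add: algebra_simps)
      finally show ?thesis using s1_pos by (simp add: field_simps)
    qed
    ultimately have lo: "- log_density \<eta> x \<le> \<bar>ln (1 / (s2 * sqrt (2 * pi)))\<bar> + (1 + M\<^sup>2) / s1\<^sup>2 * (1 + x\<^sup>2)"
      by linarith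
    have le: "a \<le> a * (1 + x\<^sup>2)" if "a \<ge> 0" for a :: real using that by (simp add: algebra_simps)
    have "- log_density \<eta> x \<le> K * (1 + x\<^sup>2)"
      unfolding K_def distrib_right using lo le[of "\<bar>ln (1 / (s2 * sqrt (2 * pi)))\<bar>"] by linarith
    moreover have "log_density \<eta> x \<le> \<bar>B\<bar> * (1 + x\<^sup>2)"
    proof -
      have "0 \<le> x\<^sup>2 / (4 * s2\<^sup>2)" by simp
      then show ?thesis using B[OF \<eta>, of x] le[of "\<bar>B\<bar>"] by linarith
    qed
    moreover have "K \<ge> 0" unfolding K_def using s1_pos by auto
    ultimately have "\<bar>log_density \<eta> x\<bar> \<le> (\<bar>B\<bar> + K) * (1 + x\<^sup>2)"
      using le[of K] le[of "\<bar>B\<bar>"] mult_nonneg_nonneg[of K "1+x\<^sup>2"] mult_nonneg_nonneg[of "\<bar>B\<bar>" "1+x\<^sup>2"]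
      unfolding distrib_right by linarith
    moreover have "0 \<le> 1 * (1 + x\<^sup>2)" by simp
    ultimately show ?thesis unfolding distrib_right by linarith
  qed
  moreover have "\<bar>B\<bar> + K + 1 > 0" unfolding K_def using s1_pos by (intro add_nonneg_pos add_nonneg_nonneg) auto
  ultimately show ?thesis by blast
qed

text \<open>The only use of the symmetry of the mixing measures in the expansion: an odd function integrates to zero
against an even density, whichever two mixing measures they come from.\<close>

lemma score_mean_zero:
  assumes "\<eta> \<in> mixing" "\<eta>0 \<in> mixing"
  shows "(LINT x|lborel. log_slope \<eta> x * mix_deriv 0 \<eta>0 x) = 0"
  by (rule odd_integral_zero) (simp add: log_slope_def mix_deriv_even_odd assms)

lemma mix_deriv_1_tendsto_zero:
  assumes \<eta>: "\<eta> \<in> mixing"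
  shows "(mix_deriv 1 \<eta> \<longlongrightarrow> 0) at_top" "(mix_deriv 1 \<eta> \<longlongrightarrow> 0) at_bot"
proof -
  let ?b = "sqrt 2 * s2"
  have b: "?b > 0" using s1_pos s1_less_s2 by auto
  obtain C where C: "C > 0" "\<And>x. \<bar>mix_deriv 1 \<eta> x\<bar> \<le> C * (1 + \<bar>x\<bar>)^1 * mix_deriv 0 \<eta> x"
    using mix_deriv_le_density[of 1] \<eta> by blast
  obtain B where B: "B > 0" "\<And>x. mix_deriv 0 \<eta> x \<le> B * exp (- x\<^sup>2 / (2 * ?b\<^sup>2))"
    using mix_deriv_upper \<eta> by blast
  define K where "K = C * B * (fact 2 * exp (1 + ?b\<^sup>2 / 2))"
  have le: "\<bar>mix_deriv 1 \<eta> x\<bar> \<le> K * inverse (1 + \<bar>x\<bar>)" for x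
  proof -
    have "\<bar>mix_deriv 1 \<eta> x\<bar> \<le> C * (1 + \<bar>x\<bar>) * (B * exp (- x\<^sup>2 / (2 * ?b\<^sup>2)))"
      by (rule order_trans[OF C(2)]) (use B(2)[of x] C(1) in \<open>auto intro!: mult_left_mono\<close>)
    also have "\<dots> = C * B * ((1 + \<bar>x\<bar>)^2 * exp (- x\<^sup>2 / (2 * ?b\<^sup>2))) * inverse (1 + \<bar>x\<bar>)"
      by (simp add: power2_eq_square field_simps)
    also have "\<dots> \<le> K * inverse (1 + \<bar>x\<bar>)"
      unfolding K_def using B(1) C(1)
      by (intro mult_right_mono mult_left_mono polynomial_times_gauss_bounded b) auto
    finally show ?thesis .
  qed
  have abs_top: "filterlim (\<lambda>x::real. 1 + \<bar>x\<bar>) at_top at_top"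
    by (rule filterlim_at_top_mono[OF filterlim_ident], rule always_eventually) auto
  have abs_bot: "filterlim (\<lambda>x::real. 1 + \<bar>x\<bar>) at_top at_bot"
    by (rule filterlim_at_top_mono[OF filterlim_uminus_at_top_at_bot], rule always_eventually) auto
  show "(mix_deriv 1 \<eta> \<longlongrightarrow> 0) at_top"
    by (rule Lim_null_comparison[of _ "\<lambda>x. K * inverse (1 + \<bar>x\<bar>)"])
      (use le abs_top abs_bot in \<open>auto intro!: tendsto_mult_right_zero tendsto_inverse_0_at_top\<close>)
  show "(mix_deriv 1 \<eta> \<longlongrightarrow> 0) at_bot"
    by (rule Lim_null_comparison[of _ "\<lambda>x. K * inverse (1 + \<bar>x\<bar>)"])
      (use le abs_top abs_bot in \<open>auto intro!: tendsto_mult_right_zero tendsto_inverse_0_at_top\<close>)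
qed

lemma log_slope_sq_bound: "\<exists>C>0. \<forall>\<eta>\<in>mixing. \<forall>x. (log_slope \<eta> x)\<^sup>2 \<le> C * (1 + x\<^sup>2)"
proof -
  obtain B where B: "B > 0" "\<And>\<eta> x. \<eta> \<in> mixing \<Longrightarrow> \<bar>log_slope \<eta> x\<bar> \<le> B * (1 + \<bar>x\<bar>)"
    using log_slope_bound by blast
  have "(log_slope \<eta> x)\<^sup>2 \<le> (2 * B\<^sup>2) * (1 + x\<^sup>2)" if \<eta>: "\<eta> \<in> mixing" for \<eta> x
  proof -
    have "(log_slope \<eta> x)\<^sup>2 \<le> (B * (1 + \<bar>x\<bar>))\<^sup>2"
      using B(2)[OF \<eta>, of x] by (metis abs_ge_zero power2_abs power_mono)
    also have "\<dots> \<le> B\<^sup>2 * (2 * (1 + x\<^sup>2))"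
      unfolding power_mult_distrib by (intro mult_left_mono one_plus_abs_power_le) auto
    finally show ?thesis by (simp only: mult_ac)
  qed
  moreover have "2 * B\<^sup>2 > 0" using B(1) by auto
  ultimately show ?thesis by blast
qed

lemma slope_sq_integrable: "\<eta> \<in> mixing \<Longrightarrow> integrable lborel (\<lambda>x. (log_slope \<eta> x)\<^sup>2 * mix_deriv 0 \<eta> x)"
proof -
  assume \<eta>: "\<eta> \<in> mixing"
  obtain C where "\<And>x. (log_slope \<eta> x)\<^sup>2 \<le> C * (1 + x\<^sup>2)"
    using log_slope_sq_bound \<eta> by blast
  then show ?thesis using log_measurable(2)[OF \<eta>]
    by (intro polynomial_density_integrable[OF \<eta>, of _ C 1]) auto
qed

lemma curv_integrable: "\<eta> \<in> mixing \<Longrightarrow> integrable lborel (\<lambda>x. log_curv \<eta> x * mix_deriv 0 \<eta> x)"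
proof -
  assume \<eta>: "\<eta> \<in> mixing"
  obtain C where "\<And>x. \<bar>log_curv \<eta> x\<bar> \<le> C * (1 + x\<^sup>2)"
    using log_curv_bound \<eta> by blast
  then show ?thesis using log_measurable(3)[OF \<eta>]
    by (intro polynomial_density_integrable[OF \<eta>, of _ C 1]) auto
qed

text \<open>\<open>l'' p = p'' - (l')\<^sup>2 p\<close>, and \<open>p''\<close> integrates to zero because \<open>p'\<close> vanishes at both ends.\<close>

lemma information_identity:
  assumes \<eta>: "\<eta> \<in> mixing"
  shows "(LINT x|lborel. log_curv \<eta> x * mix_deriv 0 \<eta> x) = - info \<eta>"
proof -
  have eq: "mix_deriv 2 \<eta> x = log_curv \<eta> x * mix_deriv 0 \<eta> x + (log_slope \<eta> x)\<^sup>2 * mix_deriv 0 \<eta> x" for x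
    using mix_deriv_pos[OF \<eta>, of x] by (simp add: log_curv_def field_simps)
  have int: "integrable lborel (mix_deriv 2 \<eta>)"
    unfolding eq[abs_def] using curv_integrable[OF \<eta>] slope_sq_integrable[OF \<eta>] by simp
  have "(LBINT x=-\<infinity>..\<infinity>. mix_deriv 2 \<eta> x) = 0 - 0"
  proof (rule interval_integral_FTC_integrable)
    show "(mix_deriv 1 \<eta> has_vector_derivative mix_deriv 2 \<eta> x) (at x)" for x
      using mix_deriv_has_derivative[OF \<eta>, of 1 x]
      by (simp add: has_real_derivative_iff_has_vector_derivative numeral_2_eq_2)
    show "set_integrable lborel (einterval (- \<infinity>) \<infinity>) (mix_deriv 2 \<eta>)"
      using int by (simp add: set_integrable_def)
    show "((mix_deriv 1 \<eta> \<circ> real_of_ereal) \<longlongrightarrow> 0) (at_right (- \<infinity>))"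
      using mix_deriv_1_tendsto_zero(2)[OF \<eta>] by (simp add: ereal_tendsto_simps)
    show "((mix_deriv 1 \<eta> \<circ> real_of_ereal) \<longlongrightarrow> 0) (at_left \<infinity>)"
      using mix_deriv_1_tendsto_zero(1)[OF \<eta>] by (simp add: ereal_tendsto_simps)
  qed (auto intro: mix_deriv_isCont \<eta>)
  then have "(LINT x|lborel. mix_deriv 2 \<eta> x) = 0"
    by (simp add: interval_lebesgue_integral_def set_lebesgue_integral_def)
  then have "(LINT x|lborel. log_curv \<eta> x * mix_deriv 0 \<eta> x) + info \<eta> = 0"
    unfolding info_def eq using curv_integrable[OF \<eta>] slope_sq_integrable[OF \<eta>] by simp
  then show ?thesis by simp
qed

text \<open>Otherwise \<open>p'\<close> vanishes almost everywhere and \<open>p\<close> is constant on the positive half-line, contradicting its Gaussian tail.\<close>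

lemma info_pos:
  assumes \<eta>: "\<eta> \<in> mixing"
  shows "info \<eta> > 0"
proof -
  have nn: "(log_slope \<eta> x)\<^sup>2 * mix_deriv 0 \<eta> x \<ge> 0" for x
    using mix_deriv_pos[OF \<eta>, of x] by simp
  have "info \<eta> \<noteq> 0"
  proof
    assume "info \<eta> = 0"
    then have "AE x in lborel. (log_slope \<eta> x)\<^sup>2 * mix_deriv 0 \<eta> x = 0"
      unfolding info_def using integral_nonneg_eq_0_iff_AE[OF slope_sq_integrable[OF \<eta>]] nn by simp
    then have ae: "AE x in lborel. mix_deriv 1 \<eta> x = 0"
      by eventually_elim (use mix_deriv_pos[OF \<eta>] in \<open>auto simp: log_slope_def less_le\<close>)
    have const: "mix_deriv 0 \<eta> x = mix_deriv 0 \<eta> 0" if "x \<ge> 0" for x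
    proof -
      have "(LINT y|lborel. indicator {0..x} y *\<^sub>R mix_deriv 1 \<eta> y) = mix_deriv 0 \<eta> x - mix_deriv 0 \<eta> 0"
      proof (rule integral_FTC_Icc[OF that])
        show "(mix_deriv 0 \<eta> has_vector_derivative mix_deriv 1 \<eta> y) (at y within {0..x})" for y
          using mix_deriv_has_derivative[OF \<eta>, of 0 y]
          by (simp add: has_real_derivative_iff_has_vector_derivative has_vector_derivative_at_within)
      qed (rule mix_deriv_continuous_on[OF \<eta>])
      moreover have "(LINT y|lborel. indicator {0..x} y *\<^sub>R mix_deriv 1 \<eta> y) = 0"
        using ae by (intro integral_eq_zero_AE) auto
      ultimately show ?thesis by simp
    qed
    obtain B where B: "\<And>x. log_density \<eta> x \<le> B - x\<^sup>2 / (4 * s2\<^sup>2)"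
      using log_density_upper \<eta> by blast
    define y where "y = 2 * s2 * sqrt (\<bar>B - log_density \<eta> 0\<bar> + 1)"
    have y: "y \<ge> 0" "y\<^sup>2 / (4 * s2\<^sup>2) = \<bar>B - log_density \<eta> 0\<bar> + 1"
      using s1_pos s1_less_s2 by (auto simp: y_def power_mult_distrib)
    have "log_density \<eta> y = log_density \<eta> 0" using const[OF y(1)] by (simp add: log_density_def)
    with B[of y] y(2) show False by linarith
  qed
  moreover have "info \<eta> \<ge> 0" unfolding info_def using nn by (intro Bochner_Integration.integral_nonneg)
  ultimately show ?thesis by simp
qed

end

section \<open>Neighbourhoods of the mixing measure\<close>

context mixture_box begin

text \<open>Mixing measures whose densities agree with that of \<open>\<eta>0\<close> up to \<open>\<epsilon>\<close> at the points of \<open>G\<close>; for finite \<open>G\<close> this is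
a weak neighbourhood defined by the test functions \<open>(z, \<sigma>) \<mapsto> \<phi>\<^sub>\<sigma>(x - z)\<close>, \<open>x \<in> G\<close>.\<close>

definition density_nbhd :: "(real \<times> real) measure \<Rightarrow> real set \<Rightarrow> real \<Rightarrow> (real \<times> real) measure set" where
  "density_nbhd \<eta>0 G \<epsilon> = {\<eta> \<in> mixing. \<forall>x\<in>G. \<bar>mix_deriv 0 \<eta> x - mix_deriv 0 \<eta>0 x\<bar> < \<epsilon>}"

definition locally_at :: "(real \<times> real) measure \<Rightarrow> ((real \<times> real) measure \<Rightarrow> bool) \<Rightarrow> bool" where
  "locally_at \<eta>0 Q \<longleftrightarrow> (\<exists>G \<epsilon>. finite G \<and> \<epsilon> > 0 \<and> (\<forall>\<eta>\<in>density_nbhd \<eta>0 G \<epsilon>. Q \<eta>))"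

lemma density_nbhd_mixing: "\<eta> \<in> density_nbhd \<eta>0 G \<epsilon> \<Longrightarrow> \<eta> \<in> mixing"
  by (simp add: density_nbhd_def)

lemma locally_at_mono: "locally_at \<eta>0 Q \<Longrightarrow> (\<And>\<eta>. \<eta> \<in> mixing \<Longrightarrow> Q \<eta> \<Longrightarrow> R \<eta>) \<Longrightarrow> locally_at \<eta>0 R"
  unfolding locally_at_def by (meson density_nbhd_mixing)

lemma locally_at_conj:
  assumes "locally_at \<eta>0 Q" "locally_at \<eta>0 R"
  shows "locally_at \<eta>0 (\<lambda>\<eta>. Q \<eta> \<and> R \<eta>)"
proof -
  from assms obtain G1 e1 G2 e2 where *: "finite G1" "e1 > 0" "finite G2" "e2 > 0"
    "\<forall>\<eta>\<in>density_nbhd \<eta>0 G1 e1. Q \<eta>" "\<forall>\<eta>\<in>density_nbhd \<eta>0 G2 e2. R \<eta>"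
    unfolding locally_at_def by blast
  then show ?thesis unfolding locally_at_def
    by (intro exI[of _ "G1 \<union> G2"] exI[of _ "min e1 e2"]) (auto simp: density_nbhd_def)
qed

lemma mix_deriv_lipschitz: "\<exists>D>0. \<forall>\<eta>\<in>mixing. \<forall>x y. \<bar>mix_deriv k \<eta> x - mix_deriv k \<eta> y\<bar> \<le> D * \<bar>x - y\<bar>"
proof -
  obtain D where D: "D > 0" "\<And>\<eta> x. \<eta> \<in> mixing \<Longrightarrow> \<bar>mix_deriv (Suc k) \<eta> x\<bar> \<le> D"
    using mix_deriv_bounded by blast
  have "\<bar>mix_deriv k \<eta> x - mix_deriv k \<eta> y\<bar> \<le> D * \<bar>x - y\<bar>" if "\<eta> \<in> mixing" for \<eta> x y
    using field_differentiable_bound[of UNIV "mix_deriv k \<eta>" "mix_deriv (Suc k) \<eta>" D x y]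
      mix_deriv_has_derivative[OF that] D(2)[OF that] by auto
  with D(1) show ?thesis by blast
qed

text \<open>Closeness at the points of a fine grid gives uniform closeness on an interval, since the densities are equi-Lipschitz.
For derivatives, induct: a function that is uniformly small on an interval and has a bounded second derivative has a small
first derivative on a shorter interval.\<close>

lemma locally_at_uniformly_close:
  assumes \<eta>0: "\<eta>0 \<in> mixing" and "\<omega> > 0"
  shows "locally_at \<eta>0 (\<lambda>\<eta>. \<forall>y. \<bar>y\<bar> \<le> A \<longrightarrow> \<bar>mix_deriv k \<eta> y - mix_deriv k \<eta>0 y\<bar> \<le> \<omega>)"
  using \<open>\<omega> > 0\<close>
proof (induction k arbitrary: A \<omega>)
  case 0
  obtain D where D: "D > 0" "\<And>\<eta> x y. \<eta> \<in> mixing \<Longrightarrow> \<bar>mix_deriv 0 \<eta> x - mix_deriv 0 \<eta> y\<bar> \<le> D * \<bar>x - y\<bar>"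
    using mix_deriv_lipschitz by blast
  let ?r = "\<omega> / (4 * D)"
  have r: "?r > 0" using 0 D by auto
  obtain G where G: "finite G" "{-A..A} \<subseteq> (\<Union>x\<in>G. ball x ?r)"
    using seq_compact_imp_totally_bounded[of "{-A..A}"] r compact_Icc compact_imp_seq_compact by metis
  have "\<bar>mix_deriv 0 \<eta> y - mix_deriv 0 \<eta>0 y\<bar> \<le> \<omega>" if \<eta>: "\<eta> \<in> density_nbhd \<eta>0 G (\<omega>/2)" and y: "\<bar>y\<bar> \<le> A" for \<eta> y
  proof -
    from y have "y \<in> {-A..A}" by auto
    then obtain x where x: "x \<in> G" "dist x y < ?r" using G by auto
    have "\<bar>mix_deriv 0 \<eta> x - mix_deriv 0 \<eta>0 x\<bar> < \<omega>/2" using \<eta> x by (auto simp: density_nbhd_def)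
    moreover have "D * \<bar>y - x\<bar> \<le> D * ?r" using x(2) D(1) by (intro mult_left_mono) (auto simp: dist_real_def)
    then have "D * \<bar>y - x\<bar> \<le> \<omega>/4" using D by simp
    ultimately show ?thesis using D(2)[OF density_nbhd_mixing[OF \<eta>], of y x] D(2)[OF \<eta>0, of y x] by linarith
  qed
  with G(1) 0 show ?case unfolding locally_at_def
    by (intro exI[of _ G] exI[of _ "\<omega>/2"]) auto
next
  case (Suc k)
  obtain D where D: "D > 0" "\<And>\<eta> x. \<eta> \<in> mixing \<Longrightarrow> \<bar>mix_deriv (Suc (Suc k)) \<eta> x\<bar> \<le> D"
    using mix_deriv_bounded by blast
  \<comment> \<open>A difference quotient of step \<open>t\<close> has error at most \<open>D * t \<le> \<omega> / 4\<close> for each of the two functions.\<close>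
  define t where "t = min 1 (\<omega> / (4 * D))"
  have t: "t > 0" "t \<le> 1" "D * t \<le> \<omega> / 4" using Suc.prems D(1) by (auto simp: t_def field_simps min_def)
  have "\<omega> * t / 4 > 0" using Suc.prems t by auto
  from Suc.IH[OF this, of "A + 1"] show ?case
  proof (rule locally_at_mono)
    fix \<eta> assume \<eta>: "\<eta> \<in> mixing"
      and cl: "\<forall>y. \<bar>y\<bar> \<le> A + 1 \<longrightarrow> \<bar>mix_deriv k \<eta> y - mix_deriv k \<eta>0 y\<bar> \<le> \<omega> * t / 4"
    show "\<forall>y. \<bar>y\<bar> \<le> A \<longrightarrow> \<bar>mix_deriv (Suc k) \<eta> y - mix_deriv (Suc k) \<eta>0 y\<bar> \<le> \<omega>"
    proof (intro allI impI)
      fix y :: real assume y: "\<bar>y\<bar> \<le> A"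
      have q: "\<bar>mix_deriv k \<nu> (y + t) - mix_deriv k \<nu> y - t * mix_deriv (Suc k) \<nu> y\<bar> \<le> D * t\<^sup>2" if "\<nu> \<in> mixing" for \<nu>
        by (rule quadratic_bound_from_second_derivative[OF mix_deriv_has_derivative mix_deriv_has_derivative])
          (use that D in auto)
      have "\<bar>y + t\<bar> \<le> A + 1" "\<bar>y\<bar> \<le> A + 1" using y t by auto
      with cl have c: "\<bar>mix_deriv k \<eta> (y+t) - mix_deriv k \<eta>0 (y+t)\<bar> \<le> \<omega> * t / 4"
        "\<bar>mix_deriv k \<eta> y - mix_deriv k \<eta>0 y\<bar> \<le> \<omega> * t / 4" by auto
      have "D * t\<^sup>2 \<le> \<omega> * t / 4"
        using mult_right_mono[OF t(3), of t] t(1) by (simp add: power2_eq_square mult.assoc)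
      then have "\<bar>t * mix_deriv (Suc k) \<eta> y - t * mix_deriv (Suc k) \<eta>0 y\<bar> \<le> \<omega> * t"
        using q[OF \<eta>] q[OF \<eta>0] c by linarith
      then have "t * \<bar>mix_deriv (Suc k) \<eta> y - mix_deriv (Suc k) \<eta>0 y\<bar> \<le> t * \<omega>"
        using t(1) by (simp add: right_diff_distrib[symmetric] abs_mult mult.commute)
      then show "\<bar>mix_deriv (Suc k) \<eta> y - mix_deriv (Suc k) \<eta>0 y\<bar> \<le> \<omega>" using t(1) by simp
    qed
  qed
qed

lemma density_lower_on_compact:
  assumes "0 \<le> A"
  shows "\<exists>c>0. \<forall>\<eta>\<in>mixing. \<forall>y. \<bar>y\<bar> \<le> A \<longrightarrow> mix_deriv 0 \<eta> y \<ge> c"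
proof (intro exI conjI ballI allI impI)
  let ?c = "1 / (s2 * sqrt (2 * pi)) * exp (- (A + M)\<^sup>2 / (2 * s1\<^sup>2))"
  show "?c > 0" using s1_pos s1_less_s2 by auto
  fix \<eta> and y :: real assume \<eta>: "\<eta> \<in> mixing" and y: "\<bar>y\<bar> \<le> A"
  have "(\<bar>y\<bar> + M)\<^sup>2 \<le> (A + M)\<^sup>2" using y M_pos by (intro power_mono) auto
  then have "- (A + M)\<^sup>2 / (2 * s1\<^sup>2) \<le> - (\<bar>y\<bar> + M)\<^sup>2 / (2 * s1\<^sup>2)"
    by (intro divide_right_mono) auto
  then have "?c \<le> 1 / (s2 * sqrt (2 * pi)) * exp (- (\<bar>y\<bar> + M)\<^sup>2 / (2 * s1\<^sup>2))"
    using s1_pos s1_less_s2 by (intro mult_left_mono) auto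
  with mix_deriv_lower[OF \<eta>, of y] show "?c \<le> mix_deriv 0 \<eta> y" by linarith
qed

lemma ln_lipschitz:
  fixes a b c :: real
  assumes "c > 0" "a \<ge> c" "b \<ge> c"
  shows "\<bar>ln a - ln b\<bar> \<le> \<bar>a - b\<bar> / c"
proof -
  have "ln a - ln b \<le> (a - b) / b" "ln b - ln a \<le> (b - a) / a"
    using assms by (auto intro!: ln_diff_le)
  moreover have "(a - b) / b \<le> \<bar>a - b\<bar> / c" "(b - a) / a \<le> \<bar>a - b\<bar> / c"
    using assms by (auto intro!: frac_le)
  ultimately show ?thesis by linarith
qed

text \<open>Used for the ratios of derivatives of \<open>p\<close> to \<open>p\<close> that make up the logarithmic derivatives.\<close>

lemma quotient_lipschitz:
  fixes a b a' b' c D :: real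
  assumes "c > 0" "a \<ge> c" "a' \<ge> c" "\<bar>b'\<bar> \<le> D" "a' \<le> D" "\<bar>a - a'\<bar> \<le> w" "\<bar>b - b'\<bar> \<le> w"
  shows "\<bar>b / a - b' / a'\<bar> \<le> 2 * D * w / c\<^sup>2"
proof -
  have "b / a - b' / a' = ((b - b') * a' + b' * (a' - a)) / (a * a')"
    using assms by (simp add: field_simps)
  also have "\<bar>\<dots>\<bar> = \<bar>(b - b') * a' + b' * (a' - a)\<bar> / (a * a')"
    using assms by (simp add: abs_mult)
  also have "\<dots> \<le> (2 * D * w) / c\<^sup>2"
  proof (rule frac_le)
    have "\<bar>(b - b') * a'\<bar> \<le> w * D" unfolding abs_mult using assms by (intro mult_mono) auto
    then have "\<bar>(b - b') * a'\<bar> \<le> D * w" by (simp only: mult.commute)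
    moreover have "\<bar>b' * (a' - a)\<bar> \<le> D * w" unfolding abs_mult using assms by (intro mult_mono) auto
    ultimately show "\<bar>(b - b') * a' + b' * (a' - a)\<bar> \<le> 2 * D * w"
      using abs_triangle_ineq[of "(b - b') * a'" "b' * (a' - a)"] by linarith
    show "c\<^sup>2 \<le> a * a'" unfolding power2_eq_square using assms by (intro mult_mono) auto
    show "0 \<le> 2 * D * w" using assms by auto
  qed (use assms in auto)
  finally show ?thesis .
qed

lemma locally_at_log_density_close:
  assumes \<eta>0: "\<eta>0 \<in> mixing" and "\<omega> > 0" "0 \<le> A"
  shows "locally_at \<eta>0 (\<lambda>\<eta>. \<forall>y. \<bar>y\<bar> \<le> A \<longrightarrow> \<bar>log_density \<eta> y - log_density \<eta>0 y\<bar> \<le> \<omega>)"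
proof -
  obtain c where c: "c > 0" "\<And>\<eta> y. \<eta> \<in> mixing \<Longrightarrow> \<bar>y\<bar> \<le> A \<Longrightarrow> mix_deriv 0 \<eta> y \<ge> c"
    using density_lower_on_compact[OF assms(3)] by blast
  have "\<omega> * c > 0" using assms c by auto
  from locally_at_uniformly_close[OF \<eta>0 this, of A 0] show ?thesis
  proof (rule locally_at_mono, intro allI impI)
    fix \<eta> and y :: real assume *: "\<eta> \<in> mixing" "\<bar>y\<bar> \<le> A"
      "\<forall>y. \<bar>y\<bar> \<le> A \<longrightarrow> \<bar>mix_deriv 0 \<eta> y - mix_deriv 0 \<eta>0 y\<bar> \<le> \<omega> * c"
    have "\<bar>log_density \<eta> y - log_density \<eta>0 y\<bar> \<le> \<bar>mix_deriv 0 \<eta> y - mix_deriv 0 \<eta>0 y\<bar> / c"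
      unfolding log_density_def using c * \<eta>0 by (intro ln_lipschitz) auto
    also have "\<dots> \<le> (\<omega> * c) / c" using * c(1) by (intro divide_right_mono) auto
    finally show "\<bar>log_density \<eta> y - log_density \<eta>0 y\<bar> \<le> \<omega>" using c(1) by simp
  qed
qed

lemma locally_at_log_curv_close:
  assumes \<eta>0: "\<eta>0 \<in> mixing" and "\<omega> > 0" "0 \<le> A"
  shows "locally_at \<eta>0 (\<lambda>\<eta>. \<forall>y. \<bar>y\<bar> \<le> A \<longrightarrow> \<bar>log_curv \<eta> y - log_curv \<eta>0 y\<bar> \<le> \<omega>)"
proof -
  obtain c where c: "c > 0" "\<And>\<eta> y. \<eta> \<in> mixing \<Longrightarrow> \<bar>y\<bar> \<le> A \<Longrightarrow> mix_deriv 0 \<eta> y \<ge> c"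
    using density_lower_on_compact[OF assms(3)] by blast
  obtain D0 where D0: "D0 > 0" "\<And>\<eta> x. \<eta> \<in> mixing \<Longrightarrow> \<bar>mix_deriv 0 \<eta> x\<bar> \<le> D0" using mix_deriv_bounded by blast
  obtain D1 where D1: "D1 > 0" "\<And>\<eta> x. \<eta> \<in> mixing \<Longrightarrow> \<bar>mix_deriv 1 \<eta> x\<bar> \<le> D1" using mix_deriv_bounded by blast
  obtain D2 where D2: "D2 > 0" "\<And>\<eta> x. \<eta> \<in> mixing \<Longrightarrow> \<bar>mix_deriv 2 \<eta> x\<bar> \<le> D2" using mix_deriv_bounded by blast
  obtain B where B: "B > 0" "\<And>\<eta> x. \<eta> \<in> mixing \<Longrightarrow> \<bar>log_slope \<eta> x\<bar> \<le> B * (1 + \<bar>x\<bar>)"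
    using log_slope_bound by blast
  define D where "D = D0 + D1 + D2"
  have D: "D > 0" "\<And>\<eta> x. \<eta> \<in> mixing \<Longrightarrow> \<bar>mix_deriv 0 \<eta> x\<bar> \<le> D \<and> \<bar>mix_deriv 1 \<eta> x\<bar> \<le> D \<and> \<bar>mix_deriv 2 \<eta> x\<bar> \<le> D"
    unfolding D_def using D0 D1 D2 by (auto intro: order_trans simp: add_increasing add_increasing2)
  define K where "K = 2 * D / c\<^sup>2 * (1 + 2 * B * (1 + A))"
  have K: "K > 0" unfolding K_def using D(1) c(1) B(1) assms(3) by (intro mult_pos_pos divide_pos_pos add_pos_nonneg) auto
  define w where "w = \<omega> / K"
  have w: "w > 0" "K * w = \<omega>" using K assms by (auto simp: w_def)
  have "locally_at \<eta>0 (\<lambda>\<eta>. (\<forall>y. \<bar>y\<bar> \<le> A \<longrightarrow> \<bar>mix_deriv 0 \<eta> y - mix_deriv 0 \<eta>0 y\<bar> \<le> w) \<and>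
     (\<forall>y. \<bar>y\<bar> \<le> A \<longrightarrow> \<bar>mix_deriv 1 \<eta> y - mix_deriv 1 \<eta>0 y\<bar> \<le> w) \<and>
     (\<forall>y. \<bar>y\<bar> \<le> A \<longrightarrow> \<bar>mix_deriv 2 \<eta> y - mix_deriv 2 \<eta>0 y\<bar> \<le> w))"
    by (intro locally_at_conj locally_at_uniformly_close \<eta>0 w)
  then show ?thesis
  proof (rule locally_at_mono, intro allI impI)
    fix \<eta> and y :: real assume \<eta>: "\<eta> \<in> mixing" and y: "\<bar>y\<bar> \<le> A" and
      "(\<forall>y. \<bar>y\<bar> \<le> A \<longrightarrow> \<bar>mix_deriv 0 \<eta> y - mix_deriv 0 \<eta>0 y\<bar> \<le> w) \<and>
       (\<forall>y. \<bar>y\<bar> \<le> A \<longrightarrow> \<bar>mix_deriv 1 \<eta> y - mix_deriv 1 \<eta>0 y\<bar> \<le> w) \<and>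
       (\<forall>y. \<bar>y\<bar> \<le> A \<longrightarrow> \<bar>mix_deriv 2 \<eta> y - mix_deriv 2 \<eta>0 y\<bar> \<le> w)"
    then have cl: "\<bar>mix_deriv 0 \<eta> y - mix_deriv 0 \<eta>0 y\<bar> \<le> w" "\<bar>mix_deriv 1 \<eta> y - mix_deriv 1 \<eta>0 y\<bar> \<le> w"
      "\<bar>mix_deriv 2 \<eta> y - mix_deriv 2 \<eta>0 y\<bar> \<le> w" by auto
    have d0: "mix_deriv 0 \<eta>0 y \<le> D" using D(2)[OF \<eta>0, of y] by auto
    have q2: "\<bar>mix_deriv 2 \<eta> y / mix_deriv 0 \<eta> y - mix_deriv 2 \<eta>0 y / mix_deriv 0 \<eta>0 y\<bar> \<le> 2 * D * w / c\<^sup>2"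
      using c(1) c(2)[OF \<eta> y] c(2)[OF \<eta>0 y] D(2)[OF \<eta>0, of y] d0 cl by (intro quotient_lipschitz) auto
    have q1: "\<bar>log_slope \<eta> y - log_slope \<eta>0 y\<bar> \<le> 2 * D * w / c\<^sup>2"
      unfolding log_slope_def
      using c(1) c(2)[OF \<eta> y] c(2)[OF \<eta>0 y] D(2)[OF \<eta>0, of y] d0 cl by (intro quotient_lipschitz) auto
    have s: "\<bar>log_slope \<nu> y\<bar> \<le> B * (1 + A)" if "\<nu> \<in> mixing" for \<nu>
      by (rule order_trans[OF B(2)[OF that]]) (use y B(1) in \<open>auto intro: mult_left_mono\<close>)
    have "\<bar>(log_slope \<eta> y)\<^sup>2 - (log_slope \<eta>0 y)\<^sup>2\<bar>
       = \<bar>log_slope \<eta> y - log_slope \<eta>0 y\<bar> * \<bar>log_slope \<eta> y + log_slope \<eta>0 y\<bar>"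
      unfolding abs_mult[symmetric] by (simp add: power2_eq_square algebra_simps)
    also have "\<dots> \<le> (2 * D * w / c\<^sup>2) * (2 * (B * (1 + A)))"
      using q1 s[OF \<eta>] s[OF \<eta>0] abs_triangle_ineq[of "log_slope \<eta> y" "log_slope \<eta>0 y"]
        w(1) D(1) by (intro mult_mono) auto
    finally have "\<bar>log_curv \<eta> y - log_curv \<eta>0 y\<bar> \<le> 2 * D * w / c\<^sup>2 + (2 * D * w / c\<^sup>2) * (2 * (B * (1 + A)))"
      unfolding log_curv_def using q2 by linarith
    also have "\<dots> = K * w" unfolding K_def by (simp add: algebra_simps add_divide_distrib)
    finally show "\<bar>log_curv \<eta> y - log_curv \<eta>0 y\<bar> \<le> \<omega>" using w(2) by simp
  qed
qed

text \<open>The weight \<open>(1 + x\<^sup>2)\<^sup>2\<close> grows faster than the envelope \<open>C * (1 + x\<^sup>2)\<close>, so outside a compact interval the bound holds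
for every mixing measure; inside, uniform closeness on compacts suffices.\<close>

lemma locally_at_weighted_close:
  fixes \<Phi> :: "(real \<times> real) measure \<Rightarrow> real \<Rightarrow> real"
  assumes \<eta>0: "\<eta>0 \<in> mixing" and \<rho>: "\<rho> > 0"
    and bound: "\<And>\<eta> x. \<eta> \<in> mixing \<Longrightarrow> \<bar>\<Phi> \<eta> x\<bar> \<le> C * (1 + x\<^sup>2)"
    and cont: "continuous_on UNIV (\<Phi> \<eta>0)"
    and close: "\<And>A \<omega>. 0 \<le> A \<Longrightarrow> \<omega> > 0 \<Longrightarrow> locally_at \<eta>0 (\<lambda>\<eta>. \<forall>y. \<bar>y\<bar> \<le> A \<longrightarrow> \<bar>\<Phi> \<eta> y - \<Phi> \<eta>0 y\<bar> \<le> \<omega>)"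
  shows "\<exists>e>0. locally_at \<eta>0 (\<lambda>\<eta>. \<forall>\<xi> x. \<bar>\<xi>\<bar> \<le> e \<longrightarrow> \<bar>\<Phi> \<eta> (x - \<xi>) - \<Phi> \<eta>0 x\<bar> \<le> \<rho> * (1 + x\<^sup>2)\<^sup>2)"
proof -
  have C0: "C \<ge> 0" using bound[OF \<eta>0, of 0] by simp
  \<comment> \<open>For \<open>\<bar>x\<bar> > A\<close> the two terms of the difference together are at most \<open>4 * C * (1 + x\<^sup>2) \<le> \<rho> * (1 + x\<^sup>2)\<^sup>2\<close>.\<close>
  define A where "A = 4 * C / \<rho> + 1"
  have A: "A \<ge> 1" using C0 \<rho> by (simp add: A_def)
  have "uniformly_continuous_on {-(A+1)..A+1} (\<Phi> \<eta>0)"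
    by (intro compact_uniformly_continuous continuous_on_subset[OF cont]) auto
  then obtain d where d: "d > 0" "\<And>x y. x \<in> {-(A+1)..A+1} \<Longrightarrow> y \<in> {-(A+1)..A+1} \<Longrightarrow> dist y x < d \<Longrightarrow>
     dist (\<Phi> \<eta>0 y) (\<Phi> \<eta>0 x) < \<rho>/2"
    unfolding uniformly_continuous_on_def using \<rho> half_gt_zero[OF \<rho>] by meson
  define e where "e = min 1 (d/2)"
  have e: "e > 0" "e \<le> 1" "e < d" using d(1) by (auto simp: e_def)
  have "locally_at \<eta>0 (\<lambda>\<eta>. \<forall>y. \<bar>y\<bar> \<le> A + 1 \<longrightarrow> \<bar>\<Phi> \<eta> y - \<Phi> \<eta>0 y\<bar> \<le> \<rho>/2)"
    using A \<rho> by (intro close) auto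
  then have "locally_at \<eta>0 (\<lambda>\<eta>. \<forall>\<xi> x. \<bar>\<xi>\<bar> \<le> e \<longrightarrow> \<bar>\<Phi> \<eta> (x - \<xi>) - \<Phi> \<eta>0 x\<bar> \<le> \<rho> * (1 + x\<^sup>2)\<^sup>2)"
  proof (rule locally_at_mono, intro allI impI)
    fix \<eta> and \<xi> x :: real
    assume \<eta>: "\<eta> \<in> mixing" and cl: "\<forall>y. \<bar>y\<bar> \<le> A + 1 \<longrightarrow> \<bar>\<Phi> \<eta> y - \<Phi> \<eta>0 y\<bar> \<le> \<rho>/2" and \<xi>: "\<bar>\<xi>\<bar> \<le> e"
    show "\<bar>\<Phi> \<eta> (x - \<xi>) - \<Phi> \<eta>0 x\<bar> \<le> \<rho> * (1 + x\<^sup>2)\<^sup>2"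
    proof (cases "\<bar>x\<bar> \<le> A")
      case True
      have "\<bar>\<Phi> \<eta> (x - \<xi>) - \<Phi> \<eta>0 (x - \<xi>)\<bar> \<le> \<rho>/2" using cl True \<xi> e by auto
      moreover have "dist (\<Phi> \<eta>0 (x - \<xi>)) (\<Phi> \<eta>0 x) < \<rho>/2"
        using True \<xi> e A by (intro d(2)) (auto simp: dist_real_def)
      ultimately have "\<bar>\<Phi> \<eta> (x - \<xi>) - \<Phi> \<eta>0 x\<bar> \<le> \<rho> * 1" unfolding dist_real_def by linarith
      also have "\<dots> \<le> \<rho> * (1 + x\<^sup>2)\<^sup>2" using \<rho> by (intro mult_left_mono) (auto simp: one_le_power)
      finally show ?thesis .
    next
      case False
      have "\<bar>x\<bar> * 1 \<le> \<bar>x\<bar> * \<bar>x\<bar>" using False A by (intro mult_left_mono) auto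
      then have "A \<le> \<bar>x\<bar>\<^sup>2" using False A unfolding power2_eq_square by linarith
      then have big: "4 * C \<le> \<rho> * (1 + x\<^sup>2)" using \<rho> by (simp add: A_def field_simps)
      have "(x - \<xi>)\<^sup>2 \<le> (1 + \<bar>x\<bar>)\<^sup>2" using \<xi> e by (intro abs_le_square_iff[THEN iffD1]) auto
      also have "\<dots> \<le> 2 * (1 + x\<^sup>2)" by (rule one_plus_abs_power_le)
      finally have "1 + (x - \<xi>)\<^sup>2 \<le> 3 * (1 + x\<^sup>2)" using zero_le_power2[of x] by argo
      then have "\<bar>\<Phi> \<eta> (x - \<xi>)\<bar> \<le> C * (3 * (1 + x\<^sup>2))"
        using bound[OF \<eta>, of "x - \<xi>"] C0 mult_left_mono order_trans by blast
      with bound[OF \<eta>0, of x] have "\<bar>\<Phi> \<eta> (x - \<xi>) - \<Phi> \<eta>0 x\<bar> \<le> 4 * C * (1 + x\<^sup>2)"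
        by (simp add: algebra_simps)
      also have "\<dots> \<le> \<rho> * (1 + x\<^sup>2) * (1 + x\<^sup>2)" using big by (intro mult_right_mono) auto
      finally show ?thesis by (simp add: power2_eq_square mult.assoc)
    qed
  qed
  with e(1) show ?thesis by blast
qed

definition log_close :: "(real \<times> real) measure \<Rightarrow> real \<Rightarrow> real \<Rightarrow> (real \<times> real) measure \<Rightarrow> bool" where
  "log_close \<eta>0 \<rho> e \<eta> \<longleftrightarrow> (\<forall>\<xi> x. \<bar>\<xi>\<bar> \<le> e \<longrightarrow>
     \<bar>log_density \<eta> (x - \<xi>) - log_density \<eta>0 x\<bar> \<le> \<rho> * (1 + x\<^sup>2)\<^sup>2 \<and>
     \<bar>log_curv \<eta> (x - \<xi>) - log_curv \<eta>0 x\<bar> \<le> \<rho> * (1 + x\<^sup>2)\<^sup>2)"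

lemma log_closeD:
  assumes "log_close \<eta>0 \<rho> e \<eta>" "\<bar>\<xi>\<bar> \<le> e"
  shows "\<bar>log_density \<eta> (x - \<xi>) - log_density \<eta>0 x\<bar> \<le> \<rho> * (1 + x\<^sup>2)\<^sup>2"
    and "\<bar>log_curv \<eta> (x - \<xi>) - log_curv \<eta>0 x\<bar> \<le> \<rho> * (1 + x\<^sup>2)\<^sup>2"
  using assms unfolding log_close_def by blast+

lemma locally_at_log_close:
  assumes \<eta>0: "\<eta>0 \<in> mixing" and \<rho>: "\<rho> > 0"
  shows "\<exists>e>0. locally_at \<eta>0 (\<lambda>\<eta>. log_close \<eta>0 \<rho> e \<eta>)"
proof -
  obtain C1 where "\<And>\<eta> x. \<eta> \<in> mixing \<Longrightarrow> \<bar>log_density \<eta> x\<bar> \<le> C1 * (1 + x\<^sup>2)" using log_density_bound by blast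
  from locally_at_weighted_close[OF \<eta>0 \<rho> this log_density_continuous[OF \<eta>0] locally_at_log_density_close[OF \<eta>0]]
  obtain e1 where e1: "e1 > 0" "locally_at \<eta>0 (\<lambda>\<eta>. \<forall>\<xi> x. \<bar>\<xi>\<bar> \<le> e1 \<longrightarrow>
     \<bar>log_density \<eta> (x - \<xi>) - log_density \<eta>0 x\<bar> \<le> \<rho> * (1 + x\<^sup>2)\<^sup>2)" by blast
  obtain C2 where "\<And>\<eta> x. \<eta> \<in> mixing \<Longrightarrow> \<bar>log_curv \<eta> x\<bar> \<le> C2 * (1 + x\<^sup>2)" using log_curv_bound by blast
  from locally_at_weighted_close[OF \<eta>0 \<rho> this log_curv_continuous[OF \<eta>0] locally_at_log_curv_close[OF \<eta>0]]
  obtain e2 where e2: "e2 > 0" "locally_at \<eta>0 (\<lambda>\<eta>. \<forall>\<xi> x. \<bar>\<xi>\<bar> \<le> e2 \<longrightarrow>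
     \<bar>log_curv \<eta> (x - \<xi>) - log_curv \<eta>0 x\<bar> \<le> \<rho> * (1 + x\<^sup>2)\<^sup>2)" by blast
  show ?thesis
    by (rule exI[of _ "min e1 e2"], rule conjI, use e1(1) e2(1) in simp,
        rule locally_at_mono[OF locally_at_conj[OF e1(2) e2(2)]]) (auto simp: log_close_def)
qed

end

section \<open>Separation in Kullback-Leibler divergence\<close>

text \<open>With \<open>p = sqrt a\<close> and \<open>q = sqrt b\<close>, the arithmetic-geometric mean inequality bounds \<open>\<bar>p - q\<bar> * (p + q)\<close>,
and \<open>ln y \<le> y - 1\<close> bounds \<open>(p - q)\<^sup>2\<close> by the integrand of the Kullback-Leibler divergence.  Integrated and optimised
over \<open>t\<close>, this is a Pinsker inequality.\<close>

lemma abs_diff_le_kl_integrand: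
  fixes a b t :: real
  assumes "a > 0" "b > 0" "t > 0"
  shows "\<bar>a - b\<bar> \<le> (a - b + b * (ln b - ln a)) / (2 * t) + t * (a + b)"
proof -
  define p q where "p = sqrt a" and "q = sqrt b"
  have pq: "p > 0" "q > 0" "a = p\<^sup>2" "b = q\<^sup>2" using assms by (auto simp: p_def q_def)
  have "a - b = (p - q) * (p + q)" unfolding pq by (simp add: power2_eq_square algebra_simps)
  then have "\<bar>a - b\<bar> = \<bar>p - q\<bar> * (p + q)" using pq by (simp add: abs_mult)
  also have "\<dots> \<le> (p - q)\<^sup>2 / (2 * t) + t * (p + q)\<^sup>2 / 2"
  proof -
    have "0 \<le> (\<bar>p - q\<bar> - t * (p + q))\<^sup>2 / (2 * t)" using assms by simp
    also have "\<dots> = (p - q)\<^sup>2 / (2 * t) - \<bar>p - q\<bar> * (p + q) + t * (p + q)\<^sup>2 / 2"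
      using assms unfolding power2_diff[of "\<bar>p - q\<bar>"] by (simp add: field_simps power2_eq_square)
    finally show ?thesis by simp
  qed
  finally have 1: "\<bar>a - b\<bar> \<le> (p - q)\<^sup>2 / (2 * t) + t * (p + q)\<^sup>2 / 2" .
  have "(p + q)\<^sup>2 \<le> 2 * (a + b)"
    using zero_le_power2[of "p - q"] pq by (simp add: power2_eq_square algebra_simps)
  from mult_left_mono[OF this, of t] have 2: "t * (p + q)\<^sup>2 / 2 \<le> t * (a + b)" using assms by simp
  have "(p - q)\<^sup>2 \<le> a - b + b * (ln b - ln a)"
  proof -
    have "ln (p / q) \<le> p / q - 1" using pq by (intro ln_le_minus_one) auto
    then have "ln p - ln q \<le> p / q - 1" using pq by (simp add: ln_div)
    then have "2 * q\<^sup>2 * (ln p - ln q) \<le> 2 * q\<^sup>2 * (p / q - 1)" by (intro mult_left_mono) auto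
    also have "\<dots> = 2 * p * q - 2 * q\<^sup>2" using pq by (simp add: field_simps power2_eq_square)
    finally have "b * (ln a - ln b) \<le> 2 * p * q - 2 * q\<^sup>2"
      using pq by (simp add: ln_realpow algebra_simps)
    then have "b * (ln b - ln a) \<ge> 2 * q\<^sup>2 - 2 * p * q" by (simp add: algebra_simps)
    then show ?thesis using pq by (simp add: power2_diff)
  qed
  then have "(p - q)\<^sup>2 / (2 * t) \<le> (a - b + b * (ln b - ln a)) / (2 * t)"
    using assms by (intro divide_right_mono) auto
  with 1 2 show ?thesis by linarith
qed

context mixture_box begin

lemma shifted_density_integrable:
  assumes "\<eta> \<in> mixing"
  shows "integrable lborel (\<lambda>x. mix_deriv 0 \<eta> (x - u))" "(LINT x|lborel. mix_deriv 0 \<eta> (x - u)) = 1"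
  using lborel_integrable_real_affine[OF density_integrable[OF assms], of 1 "-u"]
    lborel_integral_real_affine[of 1 "mix_deriv 0 \<eta>" "-u"] density_integral[OF assms]
  by (auto simp: algebra_simps)

text \<open>The Kullback-Leibler divergence from the true error density to the density of \<open>\<eta>\<close> shifted by \<open>u\<close>.\<close>

definition kl :: "(real \<times> real) measure \<Rightarrow> real \<Rightarrow> (real \<times> real) measure \<Rightarrow> real" where
  "kl \<eta>0 u \<eta> = (LINT x|lborel. (log_density \<eta>0 x - log_density \<eta> (x - u)) * mix_deriv 0 \<eta>0 x)"

definition l1_dist :: "(real \<times> real) measure \<Rightarrow> real \<Rightarrow> (real \<times> real) measure \<Rightarrow> real" where
  "l1_dist \<eta>0 u \<eta> = (LINT x|lborel. \<bar>mix_deriv 0 \<eta> (x - u) - mix_deriv 0 \<eta>0 x\<bar>)"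

lemma l1_integrable:
  assumes "\<eta> \<in> mixing" "\<eta>0 \<in> mixing"
  shows "integrable lborel (\<lambda>x. mix_deriv 0 \<eta> (x - u) - mix_deriv 0 \<eta>0 x)"
  by (intro Bochner_Integration.integrable_diff shifted_density_integrable density_integrable assms)

lemma kl_integrable:
  assumes \<eta>: "\<eta> \<in> mixing" and \<eta>0: "\<eta>0 \<in> mixing"
  shows "integrable lborel (\<lambda>x. (log_density \<eta>0 x - log_density \<eta> (x - u)) * mix_deriv 0 \<eta>0 x)"
proof -
  obtain C where C: "C > 0" "\<And>\<eta> x. \<eta> \<in> mixing \<Longrightarrow> \<bar>log_density \<eta> x\<bar> \<le> C * (1 + x\<^sup>2)"
    using log_density_bound by blast
  note [measurable] = log_measurable[OF \<eta>] log_measurable[OF \<eta>0]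
  show ?thesis
  proof (rule polynomial_density_integrable[OF \<eta>0, where m=1 and C="C * (4 + 2 * u\<^sup>2)"])
    fix x
    have "0 \<le> (x + u)\<^sup>2" "0 \<le> u\<^sup>2 * x\<^sup>2" by simp_all
    moreover have "(x - u)\<^sup>2 = 2 * x\<^sup>2 + 2 * u\<^sup>2 - (x + u)\<^sup>2" by (simp add: power2_sum power2_diff)
    moreover have "(2 + 2 * u\<^sup>2) * (1 + x\<^sup>2) = 2 + 2 * x\<^sup>2 + 2 * u\<^sup>2 + 2 * (u\<^sup>2 * x\<^sup>2)"
      by (simp add: algebra_simps)
    ultimately have "1 + (x - u)\<^sup>2 \<le> (2 + 2 * u\<^sup>2) * (1 + x\<^sup>2)" by linarith
    then have "C * (1 + (x - u)\<^sup>2) \<le> C * ((2 + 2 * u\<^sup>2) * (1 + x\<^sup>2))"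
      using C(1) by (intro mult_left_mono) auto
    moreover have "C * (1 + x\<^sup>2) + C * ((2 + 2 * u\<^sup>2) * (1 + x\<^sup>2)) \<le> C * (4 + 2 * u\<^sup>2) * (1 + x\<^sup>2) ^ 1"
      using C(1) by (simp add: algebra_simps)
    ultimately show "\<bar>log_density \<eta>0 x - log_density \<eta> (x - u)\<bar> \<le> C * (4 + 2 * u\<^sup>2) * (1 + x\<^sup>2) ^ 1"
      using C(2)[OF \<eta>0, of x] C(2)[OF \<eta>, of "x - u"] by linarith
  qed measurable
qed

lemma kl_ge:
  assumes \<eta>: "\<eta> \<in> mixing" and \<eta>0: "\<eta>0 \<in> mixing" and m: "m > 0" "l1_dist \<eta>0 u \<eta> \<ge> m"
  shows "kl \<eta>0 u \<eta> \<ge> m\<^sup>2 / 4"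
proof -
  \<comment> \<open>This value maximises the lower bound \<open>2 * t * m - 4 * t\<^sup>2\<close> for the divergence.\<close>
  define t where "t = m / 4"
  have t: "t > 0" using m by (simp add: t_def)
  let ?a = "\<lambda>x. mix_deriv 0 \<eta> (x - u)" and ?b = "mix_deriv 0 \<eta>0"
  have "l1_dist \<eta>0 u \<eta> \<le> (LINT x|lborel. (?a x - ?b x + (log_density \<eta>0 x - log_density \<eta> (x - u)) * ?b x) / (2 * t)
      + t * (?a x + ?b x))"
    unfolding l1_dist_def
  proof (rule integral_mono)
    show "\<bar>?a x - ?b x\<bar> \<le> (?a x - ?b x + (log_density \<eta>0 x - log_density \<eta> (x - u)) * ?b x) / (2 * t)
      + t * (?a x + ?b x)" for x
      using abs_diff_le_kl_integrand[of "?a x" "?b x" t] mix_deriv_pos \<eta> \<eta>0 t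
      by (simp add: log_density_def mult.commute)
  qed (intro integrable_abs l1_integrable \<eta> \<eta>0 Bochner_Integration.integrable_add integrable_divide
        integrable_mult_right kl_integrable shifted_density_integrable density_integrable)+
  also have "\<dots> = (1 - 1 + kl \<eta>0 u \<eta>) / (2 * t) + t * (1 + 1)"
    using shifted_density_integrable[OF \<eta>, of u] density_integrable[OF \<eta>0] density_integral[OF \<eta>0]
      kl_integrable[OF \<eta> \<eta>0, of u]
    by (simp add: kl_def)
  finally have "m \<le> kl \<eta>0 u \<eta> / (2 * t) + 2 * t" using m by simp
  then have "m * (2 * t) \<le> kl \<eta>0 u \<eta> + 2 * t * (2 * t)"
    using t by (simp add: field_simps)
  then show ?thesis using t by (simp add: t_def power2_eq_square)
qed

lemma integral_indicator_ge:
  assumes f: "integrable lborel f" and nn: "\<And>x. f x \<ge> (0::real)" and "a \<le> b" and lo: "\<And>x. a < x \<Longrightarrow> x < b \<Longrightarrow> c \<le> f x"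
  shows "c * (b - a) \<le> (LINT x|lborel. f x)"
proof -
  have "c * (b - a) = (LINT x|lborel. c * indicator {a<..<b} x)"
    using \<open>a \<le> b\<close> by simp
  also have "\<dots> \<le> (LINT x|lborel. f x)"
  proof (rule integral_mono[OF _ f])
    show "integrable lborel (\<lambda>x. c * indicator {a<..<b} x)"
      by (intro integrable_mult_right integrable_real_indicator) (use \<open>a \<le> b\<close> in auto)
  qed (use nn lo in \<open>auto simp: indicator_def\<close>)
  finally show ?thesis .
qed

text \<open>Two densities that are symmetric about \<open>0\<close> and \<open>u\<close> have medians \<open>0\<close> and \<open>u\<close>.
Testing with \<open>sgn (x - u)\<close>, whose integral against the shifted density is zero, shows that
the \<open>L\<^sup>1\<close> distance is at least twice the mass that the true density puts between the medians.\<close>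

lemma l1_dist_location_ge:
  assumes \<eta>0: "\<eta>0 \<in> mixing" and e: "e > 0"
  shows "\<exists>m>0. \<forall>\<eta>\<in>mixing. \<forall>u. \<bar>u\<bar> > e \<longrightarrow> l1_dist \<eta>0 u \<eta> \<ge> m"
proof -
  obtain c where c: "c > 0" "\<And>y. \<bar>y\<bar> \<le> 1 \<Longrightarrow> mix_deriv 0 \<eta>0 y \<ge> c"
    using density_lower_on_compact[of 1] \<eta>0 by auto
  define d where "d = min e 1"
  have d: "d > 0" "d \<le> 1" "d \<le> e" using e by (auto simp: d_def)
  have "l1_dist \<eta>0 u \<eta> \<ge> c * d" if \<eta>: "\<eta> \<in> mixing" and u: "\<bar>u\<bar> > e" for \<eta> u
  proof -
    define \<tau> where "\<tau> = sgn u"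
    let ?a = "\<lambda>x. mix_deriv 0 \<eta> (x - u)" and ?b = "mix_deriv 0 \<eta>0"
    have [measurable]: "mix_deriv 0 \<eta>0 \<in> borel_measurable borel" "mix_deriv 0 \<eta> \<in> borel_measurable borel"
      using mix_deriv_measurable \<eta> \<eta>0 by auto
    have i1: "integrable lborel (\<lambda>x. sgn x * ?b x)"
      by (rule Bochner_Integration.integrable_bound[OF density_integrable[OF \<eta>0]])
        (auto simp: abs_mult sgn_if)
    have i2: "integrable lborel (\<lambda>x. sgn (x - u) * ?b x)"
      by (rule Bochner_Integration.integrable_bound[OF density_integrable[OF \<eta>0]])
        (auto simp: abs_mult sgn_if)
    have i3: "integrable lborel (\<lambda>x. sgn (x - u) * ?a x)"
      by (rule Bochner_Integration.integrable_bound[OF shifted_density_integrable(1)[OF \<eta>, of u]])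
        (auto simp: abs_mult sgn_if)
    have z1: "(LINT x|lborel. sgn x * ?b x) = 0"
      by (rule odd_integral_zero) (simp add: mix_deriv_even_odd \<eta>0 sgn_minus)
    have "(LINT x|lborel. sgn x * mix_deriv 0 \<eta> x) = 0"
      by (rule odd_integral_zero) (simp add: mix_deriv_even_odd \<eta> sgn_minus)
    then have z2: "(LINT x|lborel. sgn (x - u) * ?a x) = 0"
      using lborel_integral_real_affine[of 1 "\<lambda>x. sgn x * mix_deriv 0 \<eta> x" "-u"] by (simp add: algebra_simps)
    have int: "integrable lborel (\<lambda>x. \<tau> * (sgn x - sgn (x - u)) * ?b x)"
      using integrable_mult_right[OF Bochner_Integration.integrable_diff[OF i1 i2], of \<tau>] by (simp add: algebra_simps)
    have nn: "\<tau> * (sgn x - sgn (x - u)) * ?b x \<ge> 0" for x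
    proof -
      have "\<tau> * (sgn x - sgn (x - u)) \<ge> 0"
        using u e by (cases "u > 0") (auto simp: \<tau>_def sgn_if)
      then show ?thesis using mix_deriv_pos[OF \<eta>0, of x] by simp
    qed
    have "c * d \<le> (LINT x|lborel. \<tau> * (sgn x - sgn (x - u)) * ?b x)"
    proof (cases "u > 0")
      case True
      have "c * (d - 0) \<le> (LINT x|lborel. \<tau> * (sgn x - sgn (x - u)) * ?b x)"
      proof (rule integral_indicator_ge[OF int nn])
        fix x assume x: "0 < x" "x < d"
        then have "\<tau> * (sgn x - sgn (x - u)) = 2" using True u d by (auto simp: \<tau>_def)
        moreover have "?b x \<ge> c" using x d by (intro c(2)) auto
        ultimately show "c \<le> \<tau> * (sgn x - sgn (x - u)) * ?b x" using c(1) by simp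
      qed (use d in auto)
      then show ?thesis by simp
    next
      case False
      have "c * (0 - - d) \<le> (LINT x|lborel. \<tau> * (sgn x - sgn (x - u)) * ?b x)"
      proof (rule integral_indicator_ge[OF int nn])
        fix x assume x: "- d < x" "x < 0"
        then have "\<tau> * (sgn x - sgn (x - u)) = 2" using False u d e by (auto simp: \<tau>_def sgn_if)
        moreover have "?b x \<ge> c" using x d by (intro c(2)) auto
        ultimately show "c \<le> \<tau> * (sgn x - sgn (x - u)) * ?b x" using c(1) by simp
      qed (use d in auto)
      then show ?thesis by simp
    qed
    also have "\<dots> = (LINT x|lborel. \<tau> * (sgn x * ?b x - sgn (x - u) * ?b x))"
      by (simp add: algebra_simps)
    also have "\<dots> = (LINT x|lborel. \<tau> * (sgn (x - u) * ?a x - sgn (x - u) * ?b x))"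
      using i1 i2 i3 z1 z2 by simp
    also have "\<dots> \<le> l1_dist \<eta>0 u \<eta>"
      unfolding l1_dist_def
    proof (rule integral_mono)
      show "integrable lborel (\<lambda>x. \<tau> * (sgn (x - u) * ?a x - sgn (x - u) * ?b x))"
        by (intro integrable_mult_right Bochner_Integration.integrable_diff i2 i3)
      show "integrable lborel (\<lambda>x. \<bar>?a x - ?b x\<bar>)" by (intro integrable_abs l1_integrable \<eta> \<eta>0)
      show "\<tau> * (sgn (x - u) * ?a x - sgn (x - u) * ?b x) \<le> \<bar>?a x - ?b x\<bar>" for x
        by (auto simp: \<tau>_def sgn_if)
    qed
    finally show ?thesis .
  qed
  moreover have "c * d > 0" using c(1) d(1) by simp
  ultimately show ?thesis by blast
qed

text \<open>If the densities differ by \<open>e\<close> at a point of \<open>G\<close>, then, by the Lipschitz bound, the shifted densities still differ by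
\<open>e / 4\<close> on an interval of fixed length.\<close>

lemma l1_dist_mixing_ge:
  assumes \<eta>0: "\<eta>0 \<in> mixing" and e: "e > 0"
  shows "\<exists>m>0. \<exists>d>0. \<forall>\<eta>\<in>mixing. \<forall>u. \<bar>u\<bar> \<le> d \<longrightarrow> \<eta> \<notin> density_nbhd \<eta>0 G e \<longrightarrow> l1_dist \<eta>0 u \<eta> \<ge> m"
proof -
  obtain D where D: "D > 0" "\<And>\<eta> x y. \<eta> \<in> mixing \<Longrightarrow> \<bar>mix_deriv 0 \<eta> x - mix_deriv 0 \<eta> y\<bar> \<le> D * \<bar>x - y\<bar>"
    using mix_deriv_lipschitz by blast
  define r where "r = e / (8 * D)"
  have r: "r > 0" "2 * D * r = e / 4" using e D(1) by (auto simp: r_def)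
  have "l1_dist \<eta>0 u \<eta> \<ge> e / 4 * r"
    if \<eta>: "\<eta> \<in> mixing" and u: "\<bar>u\<bar> \<le> e / (2 * D)" and far: "\<eta> \<notin> density_nbhd \<eta>0 G e" for \<eta> u
  proof -
    from far \<eta> obtain g where g: "\<bar>mix_deriv 0 \<eta> g - mix_deriv 0 \<eta>0 g\<bar> \<ge> e"
      unfolding density_nbhd_def by (auto simp: not_less)
    let ?f = "\<lambda>x. mix_deriv 0 \<eta> (x - u) - mix_deriv 0 \<eta>0 x"
    have Du: "D * \<bar>u\<bar> \<le> e / 2" using mult_left_mono[OF u, of D] D(1) by simp
    have "e / 4 * ((g + u + r) - (g + u)) \<le> l1_dist \<eta>0 u \<eta>"
      unfolding l1_dist_def
    proof (rule integral_indicator_ge)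
      fix x assume x: "g + u < x" "x < g + u + r"
      have "D * \<bar>x - u - g\<bar> \<le> D * r" "D * \<bar>x - (g + u)\<bar> \<le> D * r"
        using x D(1) by (auto intro!: mult_left_mono)
      moreover have "\<bar>mix_deriv 0 \<eta> (x - u) - mix_deriv 0 \<eta> g\<bar> \<le> D * \<bar>x - u - g\<bar>" by (rule D(2)[OF \<eta>])
      moreover have "\<bar>mix_deriv 0 \<eta>0 x - mix_deriv 0 \<eta>0 (g + u)\<bar> \<le> D * \<bar>x - (g + u)\<bar>" by (rule D(2)[OF \<eta>0])
      moreover have "\<bar>mix_deriv 0 \<eta>0 (g + u) - mix_deriv 0 \<eta>0 g\<bar> \<le> D * \<bar>u\<bar>"
        using D(2)[OF \<eta>0, of "g + u" g] by simp
      ultimately show "e / 4 \<le> \<bar>?f x\<bar>" using g Du r by linarith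
    qed (use r in \<open>auto intro!: integrable_abs l1_integrable \<eta> \<eta>0\<close>)
    then show ?thesis by simp
  qed
  moreover have "e / 4 * r > 0" "e / (2 * D) > 0" using e r D by auto
  ultimately show ?thesis by blast
qed

lemma kl_separation:
  assumes \<eta>0: "\<eta>0 \<in> mixing" and e: "e > 0" "e' > 0"
  shows "\<exists>c>0. \<forall>\<eta>\<in>mixing. \<forall>u. \<bar>u\<bar> > e' \<or> \<eta> \<notin> density_nbhd \<eta>0 G e \<longrightarrow> kl \<eta>0 u \<eta> \<ge> c"
proof -
  obtain m1 d where m1: "m1 > 0" "d > 0"
    "\<And>\<eta> u. \<eta> \<in> mixing \<Longrightarrow> \<bar>u\<bar> \<le> d \<Longrightarrow> \<eta> \<notin> density_nbhd \<eta>0 G e \<Longrightarrow> l1_dist \<eta>0 u \<eta> \<ge> m1"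
    using l1_dist_mixing_ge[OF \<eta>0 e(1), of G] by blast
  \<comment> \<open>Shifts larger than \<open>d\<close> are separated by the medians, whatever the mixing measure.\<close>
  have "min d e' > 0" using m1 e by simp
  from l1_dist_location_ge[OF \<eta>0 this] obtain m2 where m2: "m2 > 0"
    "\<And>\<eta> u. \<eta> \<in> mixing \<Longrightarrow> \<bar>u\<bar> > min d e' \<Longrightarrow> l1_dist \<eta>0 u \<eta> \<ge> m2" by blast
  define m where "m = min m1 m2"
  have m: "m > 0" using m1 m2 by (simp add: m_def)
  have "kl \<eta>0 u \<eta> \<ge> m\<^sup>2 / 4" if \<eta>: "\<eta> \<in> mixing" and "\<bar>u\<bar> > e' \<or> \<eta> \<notin> density_nbhd \<eta>0 G e" for \<eta> u
  proof (rule kl_ge[OF \<eta> \<eta>0 m])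
    show "m \<le> l1_dist \<eta>0 u \<eta>"
      using m1(3)[OF \<eta>, of u] m2(2)[OF \<eta>, of u] that(2) unfolding m_def by (cases "\<bar>u\<bar> \<le> d") force+
  qed
  moreover have "m\<^sup>2 / 4 > 0" using m by simp
  ultimately show ?thesis by blast
qed

end

section \<open>Sums over an independent sample, uniformly over smooth functions\<close>

text \<open>The variance of a sum of independent variables is the sum of their variances.\<close>

lemma (in prob_space) iid_centered_sum_square:
  fixes Z :: "nat \<Rightarrow> 'a \<Rightarrow> real" and g :: "real \<Rightarrow> real"
  assumes ind: "indep_vars (\<lambda>_. borel) Z UNIV"
    and dist: "\<And>i. distr M borel (Z i) = Q"
    and g: "g \<in> borel_measurable borel" and int: "integrable Q (\<lambda>x. (g x)\<^sup>2)"
  shows "integrable M (\<lambda>\<omega>. (\<Sum>i<n. g (Z i \<omega>) - (LINT x|Q. g x))\<^sup>2)"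
    and "(LINT \<omega>|M. (\<Sum>i<n. g (Z i \<omega>) - (LINT x|Q. g x))\<^sup>2) \<le> real n * (LINT x|Q. (g x)\<^sup>2)"
proof -
  have Zm[measurable]: "Z i \<in> borel_measurable M" for i using ind by (auto simp: indep_vars_def2)
  note g[measurable]
  have Q: "prob_space Q" using prob_space_distr[OF Zm[of 0]] by (simp add: dist)
  interpret Q: prob_space Q by fact
  have sQ: "sets Q = sets borel" by (simp flip: dist[of 0])
  have gQ: "g \<in> borel_measurable Q" using g sQ by (simp cong: measurable_cong_sets)
  define \<mu> where "\<mu> = (LINT x|Q. g x)"
  have gi: "integrable Q g" using Q.square_integrable_imp_integrable[OF gQ int] .
  define Y where "Y i \<omega> = g (Z i \<omega>) - \<mu>" for i \<omega>
  have [measurable]: "Y i \<in> borel_measurable M" for i unfolding Y_def[abs_def] by measurable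
  have intQ: "(LINT \<omega>|M. f (Z i \<omega>)) = (LINT x|Q. f x)" if "f \<in> borel_measurable borel" for f :: "real \<Rightarrow> real" and i
    using that by (subst dist[of i, symmetric]) (simp add: integral_distr)
  have integQ: "integrable M (\<lambda>\<omega>. f (Z i \<omega>))" if "f \<in> borel_measurable borel" "integrable Q f" for f :: "real \<Rightarrow> real" and i
    using that(2) unfolding dist[of i, symmetric] by (subst (asm) integrable_distr_eq) (use that(1) in auto)
  have Yi: "integrable M (Y i)" for i
    unfolding Y_def by (intro Bochner_Integration.integrable_diff integQ gi g) auto
  have Y0: "(LINT \<omega>|M. Y i \<omega>) = 0" for i
    unfolding Y_def using integQ[OF g gi, of i] by (simp add: intQ \<mu>_def prob_space)
  have sq: "integrable Q (\<lambda>x. (g x - \<mu>)\<^sup>2)"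
    unfolding power2_diff using int gi by simp
  have "(LINT x|Q. (g x - \<mu>)\<^sup>2) = (LINT x|Q. (g x)\<^sup>2) - \<mu>\<^sup>2"
    using Q.variance_eq[OF gi int] by (simp add: \<mu>_def)
  then have sqle: "(LINT x|Q. (g x - \<mu>)\<^sup>2) \<le> (LINT x|Q. (g x)\<^sup>2)" by simp
  have cross: "integrable M (\<lambda>\<omega>. Y i \<omega> * Y j \<omega>) \<and>
     (LINT \<omega>|M. Y i \<omega> * Y j \<omega>) = (if i = j then (LINT x|Q. (g x - \<mu>)\<^sup>2) else 0)" for i j
  proof (cases "i = j")
    case True
    then show ?thesis
      using integQ[of "\<lambda>x. (g x - \<mu>)\<^sup>2" i] intQ[of "\<lambda>x. (g x - \<mu>)\<^sup>2" i] sq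
      by (simp add: Y_def power2_eq_square)
  next
    case False
    have iv: "indep_vars (\<lambda>_. borel) Y {i, j}"
      unfolding Y_def[abs_def]
      by (rule indep_vars_compose2[OF indep_vars_subset[OF ind]]) auto
    show ?thesis
      using indep_vars_lebesgue_integral[OF _ iv] indep_vars_integrable[OF _ iv] Yi Y0 False by simp
  qed
  have eq: "(\<Sum>i<n. g (Z i \<omega>) - (LINT x|Q. g x))\<^sup>2 = (\<Sum>i<n. \<Sum>j<n. Y i \<omega> * Y j \<omega>)" for \<omega>
    unfolding power2_eq_square sum_product by (simp add: Y_def \<mu>_def)
  show "integrable M (\<lambda>\<omega>. (\<Sum>i<n. g (Z i \<omega>) - (LINT x|Q. g x))\<^sup>2)"
    unfolding eq using cross by (intro Bochner_Integration.integrable_sum) auto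
  have "(LINT \<omega>|M. (\<Sum>i<n. g (Z i \<omega>) - (LINT x|Q. g x))\<^sup>2)
     = (\<Sum>i<n. \<Sum>j<n. LINT \<omega>|M. Y i \<omega> * Y j \<omega>)"
    unfolding eq using cross by (subst Bochner_Integration.integral_sum | simp)+
  also have "\<dots> = real n * (LINT x|Q. (g x - \<mu>)\<^sup>2)"
    using cross by simp
  also have "\<dots> \<le> real n * (LINT x|Q. (g x)\<^sup>2)"
    using sqle by (intro mult_left_mono) auto
  finally show "(LINT \<omega>|M. (\<Sum>i<n. g (Z i \<omega>) - (LINT x|Q. g x))\<^sup>2) \<le> real n * (LINT x|Q. (g x)\<^sup>2)" .
qed

lemma (in prob_space) iid_centered_sum_abs:
  fixes Z :: "nat \<Rightarrow> 'a \<Rightarrow> real" and g :: "real \<Rightarrow> real"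
  assumes ind: "indep_vars (\<lambda>_. borel) Z UNIV"
    and dist: "\<And>i. distr M borel (Z i) = Q"
    and g: "g \<in> borel_measurable borel" and int: "integrable Q (\<lambda>x. (g x)\<^sup>2)"
  shows "(\<integral>\<^sup>+\<omega>. ennreal \<bar>\<Sum>i<n. g (Z i \<omega>) - (LINT x|Q. g x)\<bar> \<partial>M) \<le> ennreal (sqrt (real n * (LINT x|Q. (g x)\<^sup>2)))"
proof -
  have Zm[measurable]: "Z i \<in> borel_measurable M" for i using ind by (auto simp: indep_vars_def2)
  note g[measurable]
  let ?S = "\<lambda>\<omega>. \<Sum>i<n. g (Z i \<omega>) - (LINT x|Q. g x)"
  note sq = iid_centered_sum_square[OF assms, of n]
  have m[measurable]: "?S \<in> borel_measurable M" by measurable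
  have i: "integrable M (\<lambda>\<omega>. \<bar>?S \<omega>\<bar>)"
    by (rule square_integrable_imp_integrable) (use sq in auto)
  have "(LINT \<omega>|M. \<bar>?S \<omega>\<bar>)\<^sup>2 \<le> (LINT \<omega>|M. (\<bar>?S \<omega>\<bar>)\<^sup>2)"
    using variance_eq[OF i] variance_positive[of "\<lambda>\<omega>. \<bar>?S \<omega>\<bar>"] sq(1) by simp
  also have "\<dots> \<le> real n * (LINT x|Q. (g x)\<^sup>2)" using sq(2) by simp
  finally have "(LINT \<omega>|M. \<bar>?S \<omega>\<bar>) \<le> sqrt (real n * (LINT x|Q. (g x)\<^sup>2))"
    by (rule real_le_rsqrt)
  then show ?thesis
    by (subst nn_integral_eq_integral[OF i]) (auto intro: ennreal_leI)
qed

text \<open>The kernel of the fundamental theorem of calculus: \<open>g y - g 0\<close> is the integral of \<open>g' x * ftc_kernel x y\<close> over \<open>x\<close>,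
for \<open>y\<close> of either sign.\<close>

definition ftc_kernel :: "real \<Rightarrow> real \<Rightarrow> real" where
  "ftc_kernel x y = indicator {0..} x - indicator {y..} x"

lemma ftc_kernel_measurable[measurable]: "(\<lambda>(x, y). ftc_kernel x y) \<in> borel_measurable (borel \<Otimes>\<^sub>M borel)"
proof -
  have "(\<lambda>(x, y). ftc_kernel x y) = (\<lambda>p. (if 0 \<le> fst p then 1 else 0) - (if snd p \<le> fst p then 1 else 0))"
    by (auto simp: ftc_kernel_def fun_eq_iff indicator_def)
  then show ?thesis by simp
qed

lemma ftc_kernel_measurable'[measurable (raw)]:
  assumes "f \<in> borel_measurable N" "g \<in> borel_measurable N"
  shows "(\<lambda>w. ftc_kernel (f w) (g w)) \<in> borel_measurable N"
  using measurable_compose[OF measurable_Pair[OF assms] ftc_kernel_measurable] by simp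

text \<open>The kernel vanishes unless \<open>\<bar>x\<bar> \<le> \<bar>y\<bar>\<close>, and this trades moments in \<open>y\<close> for decay in \<open>x\<close>.\<close>

lemma ftc_kernel_bound: "\<bar>ftc_kernel x y\<bar> \<le> ((1 + y\<^sup>2) / (1 + x\<^sup>2)) ^ k"
proof (cases "ftc_kernel x y = 0")
  case False
  then have "\<bar>x\<bar> \<le> \<bar>y\<bar>" by (cases "0 \<le> x"; cases "y \<le> x") (auto simp: ftc_kernel_def indicator_def)
  then have "x\<^sup>2 \<le> y\<^sup>2" by (simp add: abs_le_square_iff)
  then have "1 \<le> (1 + y\<^sup>2) / (1 + x\<^sup>2)" by (simp add: add_pos_nonneg)
  then have "1 \<le> ((1 + y\<^sup>2) / (1 + x\<^sup>2)) ^ k" by (rule one_le_power)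
  moreover have "\<bar>ftc_kernel x y\<bar> \<le> 1" by (auto simp: ftc_kernel_def indicator_def)
  ultimately show ?thesis by linarith
qed (simp add: add_nonneg_nonneg)

lemma ftc_kernel_representation:
  fixes g g' :: "real \<Rightarrow> real"
  assumes d: "\<And>x. (g has_real_derivative g' x) (at x)" and c: "continuous_on UNIV g'"
  shows "integrable lborel (\<lambda>x. g' x * ftc_kernel x y)"
    and "(LINT x|lborel. g' x * ftc_kernel x y) = g y - g 0"
proof -
  have hv: "(g has_vector_derivative g' x) (at x within A)" for x A
    using d[of x] by (simp add: has_real_derivative_iff_has_vector_derivative has_vector_derivative_at_within)
  have ftc: "has_bochner_integral lborel (\<lambda>x. indicator {a..b} x *\<^sub>R g' x) (g b - g a)" if "a \<le> b" for a b
    by (rule has_bochner_integral_FTC_Icc[OF that]) (auto intro: hv continuous_on_subset[OF c])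
  have cm[measurable]: "g' \<in> borel_measurable borel" using c by (rule borel_measurable_continuous_onI)
  have "has_bochner_integral lborel (\<lambda>x. g' x * ftc_kernel x y) (g y - g 0)"
  proof (cases "0 \<le> y")
    case True
    have ae: "AE x in lborel. indicator {0..y} x *\<^sub>R g' x = g' x * ftc_kernel x y"
      using AE_lborel_singleton[of y] by eventually_elim (use True in \<open>auto simp: ftc_kernel_def indicator_def\<close>)
    show ?thesis
      using ftc[OF True] by (subst has_bochner_integral_cong_AE[OF _ _ ae, symmetric]) auto
  next
    case False
    have ae: "AE x in lborel. - (indicator {y..0} x *\<^sub>R g' x) = g' x * ftc_kernel x y"
      using AE_lborel_singleton[of 0] by eventually_elim (use False in \<open>auto simp: ftc_kernel_def indicator_def\<close>)
    have "has_bochner_integral lborel (\<lambda>x. - (indicator {y..0} x *\<^sub>R g' x)) (- (g 0 - g y))"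
      using ftc[of y 0] False by (intro has_bochner_integral_minus) auto
    then show ?thesis by (subst has_bochner_integral_cong_AE[OF _ _ ae, symmetric]) auto
  qed
  then show "integrable lborel (\<lambda>x. g' x * ftc_kernel x y)"
    "(LINT x|lborel. g' x * ftc_kernel x y) = g y - g 0"
    by (auto simp: has_bochner_integral_iff)
qed

lemma nn_integral_inverse_one_plus_square:
  "(\<integral>\<^sup>+x. ennreal (inverse (1 + x\<^sup>2)) \<partial>lborel) = ennreal pi"
proof -
  have i: "integrable lborel (\<lambda>x::real. inverse (1 + x^2))"
    using integrable_inverse_1_plus_square by (simp add: set_integrable_def)
  have "(LINT x|lborel. inverse (1 + x^2)) = pi"
    using LBINT_inverse_1_plus_square by (simp add: interval_lebesgue_integral_def set_lebesgue_integral_def)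
  with i show ?thesis by (subst nn_integral_eq_integral) (auto simp: add_nonneg_nonneg)
qed

text \<open>The sixth power is what the weight \<open>(1 + x\<^sup>2)\<^sup>2\<close> requires: the second moment of the kernel at \<open>x\<close> is then of order \<open>(1 + x\<^sup>2) ^ (- 6)\<close>,
its square root is of order \<open>(1 + x\<^sup>2) ^ (- 3)\<close>, and the product with the weight is still integrable.\<close>

locale moment_measure = prob_space Q for Q :: "real measure" +
  assumes sets_Q: "sets Q = sets borel"
    and moment: "integrable Q (\<lambda>y. (1 + y\<^sup>2) ^ 6)"
begin

definition "mom = (LINT y|Q. (1 + y\<^sup>2) ^ 6)"

lemma mom_nonneg: "mom \<ge> 0" unfolding mom_def by (intro Bochner_Integration.integral_nonneg) auto

lemma meas_Q: "f \<in> borel_measurable borel \<Longrightarrow> f \<in> borel_measurable Q"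
  using sets_Q by (simp cong: measurable_cong_sets)

lemma poly_integrable:
  fixes f :: "real \<Rightarrow> real"
  assumes "f \<in> borel_measurable borel" "\<And>x. \<bar>f x\<bar> \<le> C * (1 + x\<^sup>2) ^ k" "k \<le> 6"
  shows "integrable Q f"
proof (rule Bochner_Integration.integrable_bound[OF integrable_mult_right[OF moment, of C]])
  have C: "C \<ge> 0" using assms(2)[of 0] by simp
  show "AE x in Q. norm (f x) \<le> norm (C * (1 + x\<^sup>2) ^ 6)"
  proof (rule AE_I2)
    fix x :: real
    have "(1 + x\<^sup>2) ^ k \<le> (1 + x\<^sup>2) ^ 6" using assms(3) by (intro power_increasing) auto
    then have "C * (1 + x\<^sup>2) ^ k \<le> C * (1 + x\<^sup>2) ^ 6" using C by (rule mult_left_mono)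
    with assms(2)[of x] show "norm (f x) \<le> norm (C * (1 + x\<^sup>2) ^ 6)" by simp
  qed
qed (use assms meas_Q in auto)

lemma kernel_bound: "\<bar>ftc_kernel x y\<bar> \<le> 1 / (1 + x\<^sup>2) ^ 6 * (1 + y\<^sup>2) ^ 6"
  using ftc_kernel_bound[of x y 6] by (simp add: power_divide)

lemma kernel_int: "integrable Q (ftc_kernel x)" "integrable Q (\<lambda>y. \<bar>ftc_kernel x y\<bar>)"
  "integrable Q (\<lambda>y. (ftc_kernel x y)\<^sup>2)"
proof -
  show i: "integrable Q (ftc_kernel x)"
    by (rule poly_integrable[OF _ kernel_bound]) auto
  then show "integrable Q (\<lambda>y. \<bar>ftc_kernel x y\<bar>)" by simp
  have "(ftc_kernel x y)\<^sup>2 = \<bar>ftc_kernel x y\<bar>" for y by (auto simp: ftc_kernel_def indicator_def)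
  with i show "integrable Q (\<lambda>y. (ftc_kernel x y)\<^sup>2)" by simp
qed

lemma kernel_abs_integral: "(LINT y|Q. \<bar>ftc_kernel x y\<bar>) \<le> mom / (1 + x\<^sup>2) ^ 6"
proof -
  have "(LINT y|Q. \<bar>ftc_kernel x y\<bar>) \<le> (LINT y|Q. 1 / (1 + x\<^sup>2) ^ 6 * (1 + y\<^sup>2) ^ 6)"
    by (intro integral_mono kernel_int integrable_mult_right moment kernel_bound)
  then show ?thesis by (simp add: mom_def)
qed

lemma kernel_sq_integral: "(LINT y|Q. (ftc_kernel x y)\<^sup>2) \<le> mom / (1 + x\<^sup>2) ^ 6"
proof -
  have "(ftc_kernel x y)\<^sup>2 = \<bar>ftc_kernel x y\<bar>" for y by (auto simp: ftc_kernel_def indicator_def)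
  with kernel_abs_integral show ?thesis by simp
qed

definition kbar :: "real \<Rightarrow> real" where "kbar x = (LINT y|Q. ftc_kernel x y)"

lemma kbar_measurable[measurable]: "kbar \<in> borel_measurable borel"
proof -
  have "(\<lambda>(x, y). ftc_kernel x y) \<in> borel_measurable (borel \<Otimes>\<^sub>M Q)"
    using ftc_kernel_measurable sets_Q by (simp cong: measurable_cong_sets sets_pair_measure_cong)
  then show ?thesis unfolding kbar_def[abs_def] by (rule borel_measurable_lebesgue_integral)
qed

text \<open>The representation of \<open>g y - g 0\<close> integrated over \<open>y\<close>, by Fubini.\<close>

lemma kbar_representation:
  fixes g g' :: "real \<Rightarrow> real"
  assumes d: "\<And>x. (g has_real_derivative g' x) (at x)" and c: "continuous_on UNIV g'"
    and b: "\<And>x. \<bar>g' x\<bar> \<le> C * (1 + x\<^sup>2)\<^sup>2"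
  shows "integrable lborel (\<lambda>x. g' x * kbar x)"
    and "integrable Q g" and "(LINT x|lborel. g' x * kbar x) = (LINT y|Q. g y) - g 0"
proof -
  note meas_integral = borel_measurable_lebesgue_integral
  interpret pair_sigma_finite lborel Q ..
  have C: "C \<ge> 0" using b[of 0] by simp
  have cm[measurable]: "g' \<in> borel_measurable borel" using c by (rule borel_measurable_continuous_onI)
  have m: "(\<lambda>p. g' (fst p) * ftc_kernel (fst p) (snd p)) \<in> borel_measurable (lborel \<Otimes>\<^sub>M Q)"
  proof -
    have "(\<lambda>p. g' (fst p) * ftc_kernel (fst p) (snd p)) \<in> borel_measurable (borel \<Otimes>\<^sub>M borel)" by measurable
    moreover have "sets (lborel \<Otimes>\<^sub>M Q) = sets (borel \<Otimes>\<^sub>M borel)"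
      by (rule sets_pair_measure_cong[OF sets_lborel sets_Q])
    ultimately show ?thesis using measurable_cong_sets[of "lborel \<Otimes>\<^sub>M Q" "borel \<Otimes>\<^sub>M borel" borel borel] by blast
  qed
  have dom: "integrable lborel (\<lambda>x. C * mom * inverse (1 + x\<^sup>2))"
    using integrable_inverse_1_plus_square by (simp add: set_integrable_def)
  have int: "integrable (lborel \<Otimes>\<^sub>M Q) (\<lambda>p. g' (fst p) * ftc_kernel (fst p) (snd p))"
  proof (rule Fubini_integrable[OF m])
    show "AE x in lborel. integrable Q (\<lambda>y. g' (fst (x, y)) * ftc_kernel (fst (x, y)) (snd (x, y)))"
      using kernel_int by simp
    have eq: "(LINT y|Q. norm (g' (fst (x, y)) * ftc_kernel (fst (x, y)) (snd (x, y))))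
       = \<bar>g' x\<bar> * (LINT y|Q. \<bar>ftc_kernel x y\<bar>)" for x
      by (simp add: abs_mult)
    show "integrable lborel (\<lambda>x. LINT y|Q. norm (g' (fst (x, y)) * ftc_kernel (fst (x, y)) (snd (x, y))))"
    proof (rule Bochner_Integration.integrable_bound[OF dom])
      show "(\<lambda>x. LINT y|Q. norm (g' (fst (x, y)) * ftc_kernel (fst (x, y)) (snd (x, y)))) \<in> borel_measurable lborel"
        using meas_integral[of "\<lambda>x y. norm (g' (fst (x, y)) * ftc_kernel (fst (x, y)) (snd (x, y)))" lborel] m
        by (simp add: case_prod_unfold)
      show "AE x in lborel. norm (LINT y|Q. norm (g' (fst (x, y)) * ftc_kernel (fst (x, y)) (snd (x, y))))
          \<le> norm (C * mom * inverse (1 + x\<^sup>2))"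
      proof (rule AE_I2)
        fix x :: real
        have n: "(LINT y|Q. \<bar>ftc_kernel x y\<bar>) \<ge> 0" by (intro Bochner_Integration.integral_nonneg) auto
        have "\<bar>g' x\<bar> * (LINT y|Q. \<bar>ftc_kernel x y\<bar>) \<le> (C * (1 + x\<^sup>2)\<^sup>2) * (mom / (1 + x\<^sup>2) ^ 6)"
          using b[of x] kernel_abs_integral[of x] n C by (intro mult_mono) auto
        also have "\<dots> = C * mom * (inverse (1 + x\<^sup>2)) ^ 4"
        proof -
          have "1 + x\<^sup>2 > 0" by (simp add: add_pos_nonneg)
          moreover have "(C * q\<^sup>2) * (mom / q ^ 6) = C * mom * (inverse q) ^ 4" if "q > 0" for q :: real
            using that by (simp add: field_simps eval_nat_numeral)
          ultimately show ?thesis by blast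
        qed
        also have "\<dots> \<le> C * mom * (inverse (1 + x\<^sup>2)) ^ 1"
          using C mom_nonneg by (intro mult_left_mono power_decreasing) (auto simp: inverse_le_1_iff add_nonneg_nonneg)
        finally show "norm (LINT y|Q. norm (g' (fst (x, y)) * ftc_kernel (fst (x, y)) (snd (x, y))))
          \<le> norm (C * mom * inverse (1 + x\<^sup>2))"
          unfolding eq using n C mom_nonneg by (simp add: abs_mult)
      qed
    qed
  qed
  have e1: "(LINT y|Q. g' (fst (x, y)) * ftc_kernel (fst (x, y)) (snd (x, y))) = g' x * kbar x" for x
    by (simp add: kbar_def)
  have e2: "(LINT x|lborel. g' (fst (x, y)) * ftc_kernel (fst (x, y)) (snd (x, y))) = g y - g 0" for y
    using ftc_kernel_representation(2)[OF d c] by simp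
  show "integrable lborel (\<lambda>x. g' x * kbar x)"
    using integrable_fst'[OF int] unfolding e1 .
  have "integrable Q (\<lambda>y. g y - g 0)"
    using integrable_snd[of "\<lambda>x y. g' x * ftc_kernel x y"] int unfolding case_prod_unfold
    using ftc_kernel_representation(2)[OF d c] by simp
  from Bochner_Integration.integrable_add[OF this, of "\<lambda>_. g 0"] show gi: "integrable Q g" by simp
  have "(LINT x|lborel. g' x * kbar x) = (LINT y|Q. g y - g 0)"
    using Fubini_integral[of "\<lambda>x y. g' x * ftc_kernel x y"] int
    unfolding case_prod_unfold kbar_def ftc_kernel_representation(2)[OF d c]
    by simp
  then show "(LINT x|lborel. g' x * kbar x) = (LINT y|Q. g y) - g 0"
    using gi by (simp add: prob_space)
qed

text \<open>The first indicator of the kernel cancels on centring, and the inner sum is minus \<open>n\<close> times the difference of the empirical and the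
true distribution functions at \<open>x\<close>.  So this is a weighted \<open>L\<^sup>1\<close> norm of the unnormalised empirical process.\<close>

definition emp_norm :: "nat \<Rightarrow> (nat \<Rightarrow> real) \<Rightarrow> ennreal" where
  "emp_norm n z = (\<integral>\<^sup>+x. ennreal ((1 + x\<^sup>2)\<^sup>2 * \<bar>\<Sum>i<n. ftc_kernel x (z i) - kbar x\<bar>) \<partial>lborel)"

text \<open>The right-hand side does not involve \<open>g\<close> other than through \<open>C\<close>; this is the uniform bound that stands in for a maximal
inequality over a class of functions.\<close>

lemma emp_norm_controls:
  fixes g g' :: "real \<Rightarrow> real"
  assumes d: "\<And>x. (g has_real_derivative g' x) (at x)" and c: "continuous_on UNIV g'"
    and b: "\<And>x. \<bar>g' x\<bar> \<le> C * (1 + x\<^sup>2)\<^sup>2" and T: "emp_norm n z \<le> ennreal T" "T \<ge> 0"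
  shows "\<bar>(\<Sum>i<n. g (z i)) - real n * (LINT y|Q. g y)\<bar> \<le> C * T"
proof -
  have C: "C \<ge> 0" using b[of 0] by simp
  have cm[measurable]: "g' \<in> borel_measurable borel" using c by (rule borel_measurable_continuous_onI)
  note r = ftc_kernel_representation[OF d c] kbar_representation[OF d c b]
  have i: "integrable lborel (\<lambda>x. g' x * (\<Sum>i<n. ftc_kernel x (z i) - kbar x))"
    unfolding sum_distrib_left right_diff_distrib
    by (intro Bochner_Integration.integrable_sum Bochner_Integration.integrable_diff r)
  have eq: "(LINT x|lborel. g' x * (\<Sum>i<n. ftc_kernel x (z i) - kbar x)) = (\<Sum>i<n. g (z i)) - real n * (LINT y|Q. g y)"
    unfolding sum_distrib_left right_diff_distrib
    using r(1,3) by (subst Bochner_Integration.integral_sum) (auto simp: r(2,5) sum_subtractf algebra_simps)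
  have "ennreal \<bar>(\<Sum>i<n. g (z i)) - real n * (LINT y|Q. g y)\<bar>
      \<le> (\<integral>\<^sup>+x. ennreal \<bar>g' x * (\<Sum>i<n. ftc_kernel x (z i) - kbar x)\<bar> \<partial>lborel)"
    using integral_norm_bound_ennreal[OF i] by (simp add: eq)
  also have "\<dots> \<le> (\<integral>\<^sup>+x. ennreal C * ennreal ((1 + x\<^sup>2)\<^sup>2 * \<bar>\<Sum>i<n. ftc_kernel x (z i) - kbar x\<bar>) \<partial>lborel)"
  proof (rule nn_integral_mono)
    fix x
    have "\<bar>g' x * (\<Sum>i<n. ftc_kernel x (z i) - kbar x)\<bar> \<le> (C * (1 + x\<^sup>2)\<^sup>2) * \<bar>\<Sum>i<n. ftc_kernel x (z i) - kbar x\<bar>"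
      unfolding abs_mult using b[of x] by (intro mult_right_mono) auto
    then show "ennreal \<bar>g' x * (\<Sum>i<n. ftc_kernel x (z i) - kbar x)\<bar>
        \<le> ennreal C * ennreal ((1 + x\<^sup>2)\<^sup>2 * \<bar>\<Sum>i<n. ftc_kernel x (z i) - kbar x\<bar>)"
      using C by (simp add: ennreal_mult[symmetric] ennreal_leI mult.assoc)
  qed
  also have "\<dots> = ennreal C * emp_norm n z"
    unfolding emp_norm_def by (rule nn_integral_cmult) measurable
  also have "\<dots> \<le> ennreal C * ennreal T" by (intro mult_left_mono T) auto
  also have "\<dots> = ennreal (C * T)" using C T by (simp add: ennreal_mult)
  finally show ?thesis using C T by (simp add: ennreal_le_iff)
qed

text \<open>Tonelli reduces the expectation to the mean absolute value of a centred sum at each \<open>x\<close>, which is at most the standard deviation.\<close>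

lemma emp_norm_expectation:
  fixes Z :: "nat \<Rightarrow> 'w \<Rightarrow> real"
  assumes P: "prob_space P" and ind: "prob_space.indep_vars P (\<lambda>_. borel) Z UNIV"
    and dist: "\<And>i. distr P borel (Z i) = Q"
  shows "(\<lambda>\<omega>. emp_norm n (\<lambda>i. Z i \<omega>)) \<in> borel_measurable P"
    and "(\<integral>\<^sup>+\<omega>. emp_norm n (\<lambda>i. Z i \<omega>) \<partial>P) \<le> ennreal (pi * sqrt (real n * mom))"
proof -
  interpret P: prob_space P by fact
  interpret pair_sigma_finite P lborel ..
  have [measurable]: "Z i \<in> borel_measurable P" for i using ind by (auto simp: P.indep_vars_def2)
  have m: "(\<lambda>(\<omega>, x). ennreal ((1 + x\<^sup>2)\<^sup>2 * \<bar>\<Sum>i<n. ftc_kernel x (Z i \<omega>) - kbar x\<bar>)) \<in> borel_measurable (P \<Otimes>\<^sub>M lborel)"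
    by measurable
  show "(\<lambda>\<omega>. emp_norm n (\<lambda>i. Z i \<omega>)) \<in> borel_measurable P"
    unfolding emp_norm_def by (rule lborel.borel_measurable_nn_integral) (rule m)
  have "(\<integral>\<^sup>+\<omega>. emp_norm n (\<lambda>i. Z i \<omega>) \<partial>P)
      = (\<integral>\<^sup>+x. (\<integral>\<^sup>+\<omega>. ennreal ((1 + x\<^sup>2)\<^sup>2 * \<bar>\<Sum>i<n. ftc_kernel x (Z i \<omega>) - kbar x\<bar>) \<partial>P) \<partial>lborel)"
    unfolding emp_norm_def using Fubini[OF m] by simp
  also have "\<dots> \<le> (\<integral>\<^sup>+x. ennreal (sqrt (real n * mom)) * ennreal (inverse (1 + x\<^sup>2)) \<partial>lborel)"
  proof (rule nn_integral_mono)
    fix x :: real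
    have pos: "1 + x\<^sup>2 > 0" by (simp add: add_pos_nonneg)
    have "(\<integral>\<^sup>+\<omega>. ennreal ((1 + x\<^sup>2)\<^sup>2 * \<bar>\<Sum>i<n. ftc_kernel x (Z i \<omega>) - kbar x\<bar>) \<partial>P)
      = ennreal ((1 + x\<^sup>2)\<^sup>2) * (\<integral>\<^sup>+\<omega>. ennreal \<bar>\<Sum>i<n. ftc_kernel x (Z i \<omega>) - kbar x\<bar> \<partial>P)"
      by (subst nn_integral_cmult[symmetric]) (auto simp: ennreal_mult intro!: nn_integral_cong)
    also have "\<dots> \<le> ennreal ((1 + x\<^sup>2)\<^sup>2) * ennreal (sqrt (real n * (LINT y|Q. (ftc_kernel x y)\<^sup>2)))"
      unfolding kbar_def
      by (intro mult_left_mono P.iid_centered_sum_abs[OF ind dist] kernel_int) auto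
    also have "\<dots> \<le> ennreal ((1 + x\<^sup>2)\<^sup>2) * ennreal (sqrt (real n * (mom / (1 + x\<^sup>2) ^ 6)))"
      by (intro mult_left_mono ennreal_leI real_sqrt_le_mono kernel_sq_integral) auto
    also have "\<dots> = ennreal ((1 + x\<^sup>2)\<^sup>2 * sqrt (real n * (mom / (1 + x\<^sup>2) ^ 6)))"
      by (simp add: ennreal_mult mom_nonneg)
    also have "(1 + x\<^sup>2)\<^sup>2 * sqrt (real n * (mom / (1 + x\<^sup>2) ^ 6)) = sqrt (real n * mom) * inverse (1 + x\<^sup>2)"
    proof -
      have "(1 + x\<^sup>2) ^ 6 = ((1 + x\<^sup>2) ^ 3)\<^sup>2" by (simp flip: power_mult)
      then have "sqrt ((1 + x\<^sup>2) ^ 6) = (1 + x\<^sup>2) ^ 3"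
        using pos by (simp only: real_sqrt_abs) simp
      then have "sqrt (real n * (mom / (1 + x\<^sup>2) ^ 6)) = sqrt (real n * mom) / (1 + x\<^sup>2) ^ 3"
        by (simp add: real_sqrt_divide)
      moreover have "q\<^sup>2 * (s / q ^ 3) = s * inverse q" if "q > 0" for q s :: real
        using that by (simp add: field_simps eval_nat_numeral)
      ultimately show ?thesis using pos by simp
    qed
    finally show "(\<integral>\<^sup>+\<omega>. ennreal ((1 + x\<^sup>2)\<^sup>2 * \<bar>\<Sum>i<n. ftc_kernel x (Z i \<omega>) - kbar x\<bar>) \<partial>P)
       \<le> ennreal (sqrt (real n * mom)) * ennreal (inverse (1 + x\<^sup>2))"
      using mom_nonneg pos by (simp add: ennreal_mult)
  qed
  also have "\<dots> = ennreal (sqrt (real n * mom)) * ennreal pi"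
    using nn_integral_inverse_one_plus_square by (subst nn_integral_cmult) auto
  also have "\<dots> = ennreal (pi * sqrt (real n * mom))"
    by (simp add: ennreal_mult mom_nonneg mult.commute)
  finally show "(\<integral>\<^sup>+\<omega>. emp_norm n (\<lambda>i. Z i \<omega>) \<partial>P) \<le> ennreal (pi * sqrt (real n * mom))" .
qed

end

section \<open>The log-likelihood ratio\<close>

lemma taylor_second_order:
  fixes f f' f'' :: "real \<Rightarrow> real"
  assumes "\<And>x. (f has_real_derivative f' x) (at x)" "\<And>x. (f' has_real_derivative f'' x) (at x)"
  shows "\<exists>\<xi>. \<bar>\<xi>\<bar> \<le> \<bar>u\<bar> \<and> f (z - u) = f z - u * f' z + u\<^sup>2 / 2 * f'' (z - \<xi>)"
proof -
  define d where "d m t = (if m = 0 then f (z + t) else if m = 1 then f' (z + t) else f'' (z + t))"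
    for m :: nat and t
  have "\<forall>m t. m < 2 \<and> \<bar>t\<bar> \<le> \<bar>- u\<bar> \<longrightarrow> (d m has_real_derivative d (Suc m) t) (at t)"
  proof (intro allI impI)
    fix m :: nat and t assume "m < 2 \<and> \<bar>t\<bar> \<le> \<bar>- u\<bar>"
    then consider "m = 0" | "m = 1" by linarith
    then show "(d m has_real_derivative d (Suc m) t) (at t)"
    proof cases
      case 1
      have "((\<lambda>t. f (z + t)) has_real_derivative f' (z + t) * (0 + 1)) (at t)"
        by (intro DERIV_chain2[OF assms(1)] derivative_intros)
      then show ?thesis unfolding d_def 1 by simp
    next
      case 2
      have "((\<lambda>t. f' (z + t)) has_real_derivative f'' (z + t) * (0 + 1)) (at t)"
        by (intro DERIV_chain2[OF assms(2)] derivative_intros)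
      then show ?thesis unfolding d_def 2 by simp
    qed
  qed
  from Maclaurin_bi_le[OF _ this, of "d 0"] obtain t where t: "\<bar>t\<bar> \<le> \<bar>- u\<bar>"
    "d 0 (- u) = (\<Sum>m<2. d m 0 / fact m * (- u) ^ m) + d 2 t / fact 2 * (- u) ^ 2" by auto
  then have "f (z - u) = f z - u * f' z + u\<^sup>2 / 2 * f'' (z - (- t))"
    by (simp add: d_def numeral_2_eq_2)
  with t(1) show ?thesis by (intro exI[of _ "- t"]) auto
qed

context mixture_box begin

text \<open>The log-likelihood ratio against the truth, for the sample \<open>z\<close> of errors and the location shift \<open>u\<close>.\<close>

definition llr :: "(real \<times> real) measure \<Rightarrow> nat \<Rightarrow> (nat \<Rightarrow> real) \<Rightarrow> real \<Rightarrow> (real \<times> real) measure \<Rightarrow> real" where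
  "llr \<eta>0 n z u \<eta> = (\<Sum>i<n. log_density \<eta> (z i - u) - log_density \<eta>0 (z i))"

text \<open>What the proof needs from the sample: a bound for all empirical sums of smooth functions at once, a moment bound, and the law of large
numbers for the second derivative of the true log-density.\<close>

definition controlled :: "(real \<times> real) measure \<Rightarrow> nat \<Rightarrow> (nat \<Rightarrow> real) \<Rightarrow> real \<Rightarrow> real \<Rightarrow> real \<Rightarrow> bool" where
  "controlled \<eta>0 n z t v \<rho> \<longleftrightarrow>
     (\<forall>g g' C. (\<forall>x. (g has_real_derivative g' x) (at x)) \<longrightarrow> continuous_on UNIV g' \<longrightarrow>
        (\<forall>x. \<bar>g' x\<bar> \<le> C * (1 + x\<^sup>2)\<^sup>2) \<longrightarrow>
        \<bar>(\<Sum>i<n. g (z i)) - real n * (LINT x|lborel. g x * mix_deriv 0 \<eta>0 x)\<bar> \<le> C * t * sqrt n) \<and>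
     (\<Sum>i<n. (1 + (z i)\<^sup>2)\<^sup>2) \<le> v * n \<and>
     \<bar>(\<Sum>i<n. log_curv \<eta>0 (z i)) + n * info \<eta>0\<bar> \<le> \<rho> * n"

lemma controlled_moment: "controlled \<eta>0 n z t v \<rho> \<Longrightarrow> (\<Sum>i<n. (1 + (z i)\<^sup>2)\<^sup>2) \<le> v * n"
  by (simp add: controlled_def)

lemma controlled_curv: "controlled \<eta>0 n z t v \<rho> \<Longrightarrow> \<bar>(\<Sum>i<n. log_curv \<eta>0 (z i)) + n * info \<eta>0\<bar> \<le> \<rho> * n"
  by (simp add: controlled_def)

lemma controlled_emp:
  assumes "controlled \<eta>0 n z t v \<rho>" "\<And>x. (g has_real_derivative g' x) (at x)" "continuous_on UNIV g'"
    "\<And>x. \<bar>g' x\<bar> \<le> C * (1 + x\<^sup>2)\<^sup>2"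
  shows "\<bar>(\<Sum>i<n. g (z i)) - real n * (LINT x|lborel. g x * mix_deriv 0 \<eta>0 x)\<bar> \<le> C * t * sqrt n"
  using assms unfolding controlled_def by blast

text \<open>In the linear term the score of \<open>\<eta>\<close> is replaced by the true score.  The difference of the two scores has mean zero, and its derivative is
small in the weighted supremum norm, so its sum over a controlled sample is at most \<open>\<rho> * t * sqrt n\<close>.\<close>

lemma llr_local_expansion:
  assumes \<eta>0: "\<eta>0 \<in> mixing" and \<eta>: "\<eta> \<in> mixing" and \<rho>: "\<rho> > 0" and c: "controlled \<eta>0 n z t v \<rho>"
    and lc: "log_close \<eta>0 \<rho> e \<eta>"
    and u: "\<bar>u\<bar> \<le> e"
  shows "\<bar>llr \<eta>0 n z u \<eta> - llr \<eta>0 n z 0 \<eta> - (- u * (\<Sum>i<n. log_slope \<eta>0 (z i)) - u\<^sup>2 * n * info \<eta>0 / 2)\<bar>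
    \<le> \<rho> * t * (sqrt n * \<bar>u\<bar>) + \<rho> * (v + 1) / 2 * (n * u\<^sup>2)"
proof -
  have e: "e \<ge> 0" using u by linarith
  note close = log_closeD(2)[OF lc]
  have "\<forall>i. \<exists>\<xi>. \<bar>\<xi>\<bar> \<le> \<bar>u\<bar> \<and>
    log_density \<eta> (z i - u) = log_density \<eta> (z i) - u * log_slope \<eta> (z i) + u\<^sup>2 / 2 * log_curv \<eta> (z i - \<xi>)"
    using taylor_second_order[OF log_density_has_derivative[OF \<eta>] log_slope_has_derivative[OF \<eta>]] by blast
  from choice[OF this] obtain \<xi> where \<xi>: "\<And>i. \<bar>\<xi> i\<bar> \<le> \<bar>u\<bar>"
    "\<And>i. log_density \<eta> (z i - u) = log_density \<eta> (z i) - u * log_slope \<eta> (z i) + u\<^sup>2 / 2 * log_curv \<eta> (z i - \<xi> i)"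
    by blast
  have eq: "llr \<eta>0 n z u \<eta> - llr \<eta>0 n z 0 \<eta> = - u * (\<Sum>i<n. log_slope \<eta> (z i)) + u\<^sup>2 / 2 * (\<Sum>i<n. log_curv \<eta> (z i - \<xi> i))"
    unfolding llr_def sum_subtractf[symmetric] sum_distrib_left sum.distrib[symmetric]
    by (intro sum.cong) (auto simp: \<xi>(2))
  obtain C where C: "\<And>\<eta> x. \<eta> \<in> mixing \<Longrightarrow> \<bar>log_slope \<eta> x\<bar> \<le> C * (1 + \<bar>x\<bar>)" "C > 0"
    using log_slope_bound by blast
  have si: "integrable lborel (\<lambda>x. log_slope \<nu> x * mix_deriv 0 \<eta>0 x)" if "\<nu> \<in> mixing" for \<nu>
  proof (rule polynomial_density_integrable[OF \<eta>0, of _ "2 * C" 1])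
    fix x :: real
    have "2 * \<bar>x\<bar> \<le> 1 + x\<^sup>2" using zero_le_power2[of "1 - \<bar>x\<bar>"] by (simp add: power2_diff)
    moreover have "1 + p \<le> 2 * w" if "2 * p \<le> w" "1 \<le> w" for p w :: real using that by linarith
    ultimately have "1 + \<bar>x\<bar> \<le> 2 * (1 + x\<^sup>2)" using zero_le_power2[of x] by (metis le_add_same_cancel1)
    then have "C * (1 + \<bar>x\<bar>) \<le> C * (2 * (1 + x\<^sup>2))" using C(2) by (intro mult_left_mono) auto
    also have "\<dots> = 2 * C * (1 + x\<^sup>2) ^ 1" by simp
    finally show "\<bar>log_slope \<nu> x\<bar> \<le> 2 * C * (1 + x\<^sup>2) ^ 1" using C(1)[OF that, of x] by linarith
  qed (rule log_measurable[OF that])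
  have z: "(LINT x|lborel. (log_slope \<eta> x - log_slope \<eta>0 x) * mix_deriv 0 \<eta>0 x) = 0"
    using si[OF \<eta>] si[OF \<eta>0] score_mean_zero[OF \<eta> \<eta>0] score_mean_zero[OF \<eta>0 \<eta>0]
    by (simp add: left_diff_distrib)
  have "\<bar>(\<Sum>i<n. log_slope \<eta> (z i) - log_slope \<eta>0 (z i)) - real n * (LINT x|lborel. (log_slope \<eta> x - log_slope \<eta>0 x) * mix_deriv 0 \<eta>0 x)\<bar>
      \<le> \<rho> * t * sqrt n"
    by (rule controlled_emp[OF c, of "\<lambda>x. log_slope \<eta> x - log_slope \<eta>0 x" "\<lambda>x. log_curv \<eta> x - log_curv \<eta>0 x" \<rho>])
      (use close[of 0] e in \<open>auto intro!: DERIV_diff log_slope_has_derivative \<eta> \<eta>0 continuous_intros log_curv_continuous\<close>)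
  then have A: "\<bar>(\<Sum>i<n. log_slope \<eta> (z i)) - (\<Sum>i<n. log_slope \<eta>0 (z i))\<bar> \<le> \<rho> * t * sqrt n"
    unfolding z by (simp add: sum_subtractf)
  have "\<bar>(\<Sum>i<n. log_curv \<eta> (z i - \<xi> i)) - (\<Sum>i<n. log_curv \<eta>0 (z i))\<bar>
      \<le> (\<Sum>i<n. \<bar>log_curv \<eta> (z i - \<xi> i) - log_curv \<eta>0 (z i)\<bar>)"
    unfolding sum_subtractf[symmetric] by (rule sum_abs)
  also have "\<dots> \<le> (\<Sum>i<n. \<rho> * (1 + (z i)\<^sup>2)\<^sup>2)"
    using \<xi>(1) u by (intro sum_mono close) (meson order_trans)
  also have "\<dots> \<le> \<rho> * (v * n)"
    unfolding sum_distrib_left[symmetric] using controlled_moment[OF c] \<rho> by (intro mult_left_mono) auto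
  finally have "\<bar>(\<Sum>i<n. log_curv \<eta> (z i - \<xi> i)) - (\<Sum>i<n. log_curv \<eta>0 (z i))\<bar> \<le> \<rho> * (v * n)" .
  with controlled_curv[OF c] have B: "\<bar>(\<Sum>i<n. log_curv \<eta> (z i - \<xi> i)) + n * info \<eta>0\<bar> \<le> \<rho> * (v + 1) * n"
    by (simp add: algebra_simps)
  have "llr \<eta>0 n z u \<eta> - llr \<eta>0 n z 0 \<eta> - (- u * (\<Sum>i<n. log_slope \<eta>0 (z i)) - u\<^sup>2 * n * info \<eta>0 / 2)
     = - u * ((\<Sum>i<n. log_slope \<eta> (z i)) - (\<Sum>i<n. log_slope \<eta>0 (z i)))
       + u\<^sup>2 / 2 * ((\<Sum>i<n. log_curv \<eta> (z i - \<xi> i)) + n * info \<eta>0)"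
    unfolding eq by (simp add: algebra_simps)
  also have "\<bar>- u * ((\<Sum>i<n. log_slope \<eta> (z i)) - (\<Sum>i<n. log_slope \<eta>0 (z i)))
       + u\<^sup>2 / 2 * ((\<Sum>i<n. log_curv \<eta> (z i - \<xi> i)) + n * info \<eta>0)\<bar>
     \<le> \<bar>u\<bar> * \<bar>(\<Sum>i<n. log_slope \<eta> (z i)) - (\<Sum>i<n. log_slope \<eta>0 (z i))\<bar>
       + u\<^sup>2 / 2 * \<bar>(\<Sum>i<n. log_curv \<eta> (z i - \<xi> i)) + n * info \<eta>0\<bar>"
    by (rule order_trans[OF abs_triangle_ineq]) (simp add: abs_mult)
  also have "\<dots> \<le> \<bar>u\<bar> * (\<rho> * t * sqrt n) + u\<^sup>2 / 2 * (\<rho> * (v + 1) * n)"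
    using A B by (intro add_mono mult_left_mono) auto
  finally show ?thesis by (simp add: algebra_simps add_divide_distrib)
qed

lemma llr_small:
  assumes c: "controlled \<eta>0 n z t v \<rho>'" and \<rho>: "\<rho> \<ge> 0"
    and lc: "log_close \<eta>0 \<rho> e \<eta>"
    and u: "\<bar>u\<bar> \<le> e"
  shows "\<bar>llr \<eta>0 n z u \<eta>\<bar> \<le> \<rho> * v * n"
proof -
  have "\<bar>llr \<eta>0 n z u \<eta>\<bar> \<le> (\<Sum>i<n. \<rho> * (1 + (z i)\<^sup>2)\<^sup>2)"
    unfolding llr_def by (rule order_trans[OF sum_abs sum_mono]) (rule log_closeD(1)[OF lc u])
  also have "\<dots> \<le> \<rho> * (v * n)"
    unfolding sum_distrib_left[symmetric] using controlled_moment[OF c] \<rho> by (intro mult_left_mono) auto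
  finally show ?thesis by (simp add: mult.assoc)
qed

text \<open>For very large shifts the Gaussian tail of the density alone makes the sample unlikely; of the controls on the sample, this needs the moment bound only.\<close>

lemma llr_far_location:
  assumes \<eta>0: "\<eta>0 \<in> mixing"
  shows "\<exists>R. \<forall>n z t \<rho> \<eta> u. controlled \<eta>0 n z t v \<rho> \<longrightarrow> \<eta> \<in> mixing \<longrightarrow> \<bar>u\<bar> > R \<longrightarrow> llr \<eta>0 n z u \<eta> \<le> - real n"
proof -
  obtain B where B: "\<And>\<eta> x. \<eta> \<in> mixing \<Longrightarrow> log_density \<eta> x \<le> B - x\<^sup>2 / (4 * s2\<^sup>2)"
    using log_density_upper by blast
  obtain C where C: "C > 0" "\<And>\<eta> x. \<eta> \<in> mixing \<Longrightarrow> \<bar>log_density \<eta> x\<bar> \<le> C * (1 + x\<^sup>2)"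
    using log_density_bound by blast
  have s2: "s2 > 0" using s1_pos s1_less_s2 by simp
  define K where "K = \<bar>B\<bar> + (1 / (4 * s2\<^sup>2) + C) * \<bar>v\<bar> + 1"
  define R where "R = sqrt (8 * s2\<^sup>2 * K)"
  have K: "K \<ge> 1" unfolding K_def using C(1) s2 by simp
  have "llr \<eta>0 n z u \<eta> \<le> - real n"
    if c: "controlled \<eta>0 n z t v \<rho>" and \<eta>: "\<eta> \<in> mixing" and u: "\<bar>u\<bar> > R" for n z t \<rho> \<eta> u
  proof -
    have "R\<^sup>2 \<le> \<bar>u\<bar>\<^sup>2" using u K s2 by (intro power_mono) (auto simp: R_def)
    moreover have "R\<^sup>2 = 8 * s2\<^sup>2 * K" unfolding R_def using K s2 by simp
    ultimately have uK: "u\<^sup>2 / (8 * s2\<^sup>2) \<ge> K" using s2 by (simp add: field_simps)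
    have each: "log_density \<eta> (z i - u) - log_density \<eta>0 (z i)
       \<le> (\<bar>B\<bar> - K) + (1 / (4 * s2\<^sup>2) + C) * (1 + (z i)\<^sup>2)\<^sup>2" for i
    proof -
      have "0 \<le> (2 * z i - u)\<^sup>2" by simp
      then have "u\<^sup>2 / 2 - (z i)\<^sup>2 \<le> (z i - u)\<^sup>2" by (simp add: power2_eq_square algebra_simps)
      then have "(u\<^sup>2 / 2 - (z i)\<^sup>2) / (4 * s2\<^sup>2) \<le> (z i - u)\<^sup>2 / (4 * s2\<^sup>2)" by (intro divide_right_mono) auto
      moreover have "(u\<^sup>2 / 2 - (z i)\<^sup>2) / (4 * s2\<^sup>2) = u\<^sup>2 / (8 * s2\<^sup>2) - 1 / (4 * s2\<^sup>2) * (z i)\<^sup>2"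
        by (simp add: diff_divide_distrib)
      moreover have w: "1 + (z i)\<^sup>2 \<le> (1 + (z i)\<^sup>2)\<^sup>2"
        using mult_left_mono[of 1 "1 + (z i)\<^sup>2" "1 + (z i)\<^sup>2"] by (simp add: power2_eq_square)
      moreover have "1 / (4 * s2\<^sup>2) * (z i)\<^sup>2 \<le> 1 / (4 * s2\<^sup>2) * (1 + (z i)\<^sup>2)\<^sup>2"
        using w by (intro mult_left_mono) auto
      moreover have "C * (1 + (z i)\<^sup>2) \<le> C * (1 + (z i)\<^sup>2)\<^sup>2" using w C(1) by (intro mult_left_mono) auto
      ultimately show ?thesis
        using B[OF \<eta>, of "z i - u"] C(2)[OF \<eta>0, of "z i"] uK unfolding distrib_right by linarith
    qed
    have "llr \<eta>0 n z u \<eta> \<le> (\<Sum>i<n. (\<bar>B\<bar> - K) + (1 / (4 * s2\<^sup>2) + C) * (1 + (z i)\<^sup>2)\<^sup>2)"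
      unfolding llr_def by (intro sum_mono each)
    also have "\<dots> = n * (\<bar>B\<bar> - K) + (1 / (4 * s2\<^sup>2) + C) * (\<Sum>i<n. (1 + (z i)\<^sup>2)\<^sup>2)"
      by (simp add: sum.distrib sum_distrib_left)
    also have "\<dots> \<le> n * (\<bar>B\<bar> - K) + (1 / (4 * s2\<^sup>2) + C) * (\<bar>v\<bar> * n)"
    proof -
      have "(\<Sum>i<n. (1 + (z i)\<^sup>2)\<^sup>2) \<le> \<bar>v\<bar> * n"
        by (rule order_trans[OF controlled_moment[OF c]]) (intro mult_right_mono, auto)
      then show ?thesis using C(1) s2 by (intro add_left_mono mult_left_mono) auto
    qed
    also have "\<dots> = - real n" unfolding K_def by (simp add: algebra_simps)
    finally show ?thesis .
  qed
  then show ?thesis by blast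
qed

text \<open>For bounded shifts the expected log-likelihood ratio is at most \<open>- k * n\<close> by the separation of Kullback-Leibler divergences, and the
deviation from the expectation is of order \<open>sqrt n\<close> uniformly, since the derivatives of the summands share an envelope.\<close>

lemma llr_far:
  assumes \<eta>0: "\<eta>0 \<in> mixing" and e: "e > 0" "e' > 0" and t: "t \<ge> 0"
  shows "\<exists>c>0. \<exists>N. \<forall>n\<ge>N. \<forall>z \<rho> \<eta> u. controlled \<eta>0 n z t v \<rho> \<longrightarrow> \<eta> \<in> mixing \<longrightarrow>
     \<bar>u\<bar> > e' \<or> \<eta> \<notin> density_nbhd \<eta>0 G e \<longrightarrow> llr \<eta>0 n z u \<eta> \<le> - c * real n"
proof -
  obtain R where R: "\<And>n z t \<rho> \<eta> u. controlled \<eta>0 n z t v \<rho> \<Longrightarrow> \<eta> \<in> mixing \<Longrightarrow> \<bar>u\<bar> > R \<Longrightarrow> llr \<eta>0 n z u \<eta> \<le> - real n"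
    using llr_far_location[OF \<eta>0, of v] by blast
  obtain k where k: "k > 0" "\<And>\<eta> u. \<eta> \<in> mixing \<Longrightarrow> \<bar>u\<bar> > e' \<or> \<eta> \<notin> density_nbhd \<eta>0 G e \<Longrightarrow> kl \<eta>0 u \<eta> \<ge> k"
    using kl_separation[OF \<eta>0 e] by blast
  obtain B where B: "B > 0" "\<And>\<eta> x. \<eta> \<in> mixing \<Longrightarrow> \<bar>log_slope \<eta> x\<bar> \<le> B * (1 + \<bar>x\<bar>)"
    using log_slope_bound by blast
  define K where "K = B * (4 + \<bar>R\<bar>)"
  have K: "K > 0" using B(1) by (simp add: K_def add_pos_nonneg)
  have main: "llr \<eta>0 n z u \<eta> \<le> - k * n + K * t * sqrt n"
    if c: "controlled \<eta>0 n z t v \<rho>" and \<eta>: "\<eta> \<in> mixing" and u: "\<bar>u\<bar> \<le> R"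
      and far: "\<bar>u\<bar> > e' \<or> \<eta> \<notin> density_nbhd \<eta>0 G e" for n z \<rho> \<eta> u
  proof -
    let ?g = "\<lambda>x. log_density \<eta> (x - u) - log_density \<eta>0 x" and ?g' = "\<lambda>x. log_slope \<eta> (x - u) - log_slope \<eta>0 x"
    have "\<bar>(\<Sum>i<n. ?g (z i)) - real n * (LINT x|lborel. ?g x * mix_deriv 0 \<eta>0 x)\<bar> \<le> K * t * sqrt n"
    proof (rule controlled_emp[OF c])
      fix x :: real
      have "((\<lambda>x. log_density \<eta> (x - u)) has_real_derivative log_slope \<eta> (x - u) * (1 - 0)) (at x)"
        by (intro DERIV_chain2[OF log_density_has_derivative[OF \<eta>]] derivative_intros)
      then show "(?g has_real_derivative ?g' x) (at x)"
        using log_density_has_derivative[OF \<eta>0, of x] by (auto intro: DERIV_diff)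
      have "2 * \<bar>x\<bar> \<le> 1 + x\<^sup>2" using zero_le_power2[of "1 - \<bar>x\<bar>"] by (simp add: power2_diff)
      moreover have "\<bar>x - u\<bar> \<le> \<bar>x\<bar> + \<bar>R\<bar>" using u by linarith
      moreover have "\<bar>R\<bar> \<le> \<bar>R\<bar> * (1 + x\<^sup>2)" by (simp add: algebra_simps)
      moreover have "1 \<le> 1 + x\<^sup>2" by simp
      moreover have "(1 + p) + (1 + q) \<le> 4 * w + rw"
        if "2 * q \<le> w" "p \<le> q + r" "r \<le> rw" "1 \<le> w" for p q r rw w :: real
        using that by linarith
      ultimately have "(1 + \<bar>x - u\<bar>) + (1 + \<bar>x\<bar>) \<le> (4 + \<bar>R\<bar>) * (1 + x\<^sup>2)"
        unfolding distrib_right[of 4] by blast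
      from mult_left_mono[OF this, of B] B(1)
      have "B * (1 + \<bar>x - u\<bar>) + B * (1 + \<bar>x\<bar>) \<le> K * (1 + x\<^sup>2)"
        unfolding K_def distrib_left[of B "1 + _"] mult.assoc by simp
      then have "\<bar>?g' x\<bar> \<le> K * (1 + x\<^sup>2)" using B(2)[OF \<eta>, of "x - u"] B(2)[OF \<eta>0, of x] by linarith
      also have "\<dots> \<le> K * (1 + x\<^sup>2)\<^sup>2"
        using K mult_left_mono[of 1 "1 + x\<^sup>2" "1 + x\<^sup>2"] by (intro mult_left_mono) (auto simp: power2_eq_square)
      finally show "\<bar>?g' x\<bar> \<le> K * (1 + x\<^sup>2)\<^sup>2" .
    next
      show "continuous_on UNIV ?g'"
        by (intro continuous_on_diff log_slope_continuous \<eta>0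
            continuous_on_compose2[OF log_slope_continuous[OF \<eta>, of UNIV]] continuous_intros) auto
    qed
    moreover have "(LINT x|lborel. ?g x * mix_deriv 0 \<eta>0 x) = - kl \<eta>0 u \<eta>"
      unfolding kl_def by (subst Bochner_Integration.integral_minus[symmetric])
        (intro Bochner_Integration.integral_cong, auto simp: algebra_simps)
    ultimately have "llr \<eta>0 n z u \<eta> + n * kl \<eta>0 u \<eta> \<le> K * t * sqrt n"
      by (simp add: llr_def)
    moreover have "n * k \<le> n * kl \<eta>0 u \<eta>" using k(2)[OF \<eta> far] by (intro mult_left_mono) auto
    ultimately show ?thesis by (simp add: algebra_simps)
  qed
  define N where "N = nat \<lceil>(2 * K * t / k)\<^sup>2\<rceil>"
  define c where "c = min 1 (k / 2)"
  have c0: "c > 0" using k(1) by (simp add: c_def)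
  have "llr \<eta>0 n z u \<eta> \<le> - c * real n"
    if n: "n \<ge> N" and co: "controlled \<eta>0 n z t v \<rho>" and \<eta>: "\<eta> \<in> mixing"
      and far: "\<bar>u\<bar> > e' \<or> \<eta> \<notin> density_nbhd \<eta>0 G e" for n z \<rho> \<eta> u
  proof (cases "\<bar>u\<bar> \<le> R")
    case True
    have "(2 * K * t / k)\<^sup>2 \<le> n" using n unfolding N_def by linarith
    then have "2 * K * t / k \<le> sqrt n" by (rule real_le_rsqrt)
    then have "2 * K * t * sqrt n \<le> k * sqrt n * sqrt n"
      using k(1) by (intro mult_right_mono) (auto simp: field_simps)
    also have "\<dots> = k * n" by (simp add: mult.assoc)
    finally have "K * t * sqrt n \<le> k / 2 * n" by simp
    then have "llr \<eta>0 n z u \<eta> \<le> - (k / 2) * n" using main[OF co \<eta> True far] by simp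
    also have "\<dots> \<le> - c * n" by (intro mult_right_mono) (auto simp: c_def)
    finally show ?thesis .
  next
    case False
    then have "llr \<eta>0 n z u \<eta> \<le> - 1 * real n" using R[OF co \<eta>, of u] by simp
    also have "\<dots> \<le> - c * n" by (intro mult_right_mono) (auto simp: c_def)
    finally show ?thesis .
  qed
  with c0 show ?thesis by blast
qed

end

section \<open>Perturbed normal densities\<close>

text \<open>The normal density with mean \<open>S / I\<close> and variance \<open>1 / I\<close>, written as an exponentially tilted quadratic exponential.\<close>

lemma normal_density_tilt:
  assumes I: "I > 0"
  shows "normal_density (S / I) (sqrt (inverse I)) h = sqrt (I / (2 * pi)) * exp (- S\<^sup>2 / (2 * I)) * exp (h * S - h\<^sup>2 * I / 2)"
proof -
  have v: "(sqrt (inverse I))\<^sup>2 = inverse I" using I by simp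
  have A: "1 / sqrt (2 * pi * inverse I) = sqrt (I / (2 * pi))"
  proof -
    have e: "2 * pi * inverse I = inverse (I / (2 * pi))"
      unfolding inverse_divide by (simp only: divide_inverse)
    have r: "1 / inverse x = x" for x :: real by (simp add: inverse_eq_divide)
    show ?thesis unfolding e real_sqrt_inverse r ..
  qed
  have B: "- (h - S / I)\<^sup>2 / (2 * inverse I) = - S\<^sup>2 / (2 * I) + (h * S - h\<^sup>2 * I / 2)"
    using I by (simp add: field_simps power2_eq_square)
  show ?thesis unfolding normal_density_def v A B exp_add by (rule mult.assoc[symmetric])
qed

lemma exp_quadratic_integrable:
  assumes I: "I > 0"
  shows "integrable lborel (\<lambda>h::real. exp (h * S - h\<^sup>2 * I / 2))"
proof -
  define c where "c = sqrt (I / (2 * pi)) * exp (- S\<^sup>2 / (2 * I))"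
  have c: "c > 0" using I by (simp add: c_def)
  have "integrable lborel (\<lambda>h. inverse c * normal_density (S / I) (sqrt (inverse I)) h)"
    using I by (intro integrable_mult_right integrable_normal_density) auto
  moreover have "inverse c * normal_density (S / I) (sqrt (inverse I)) h = exp (h * S - h\<^sup>2 * I / 2)" for h
    unfolding normal_density_tilt[OF I] c_def[symmetric] using c by simp
  ultimately show ?thesis by simp
qed

lemma exp_abs_quadratic_integrable:
  assumes I: "I > 0"
  shows "integrable lborel (\<lambda>h::real. exp (L * \<bar>h\<bar> - h\<^sup>2 * I / 2))"
proof (rule Bochner_Integration.integrable_bound)
  show "integrable lborel (\<lambda>h::real. exp (h * L - h\<^sup>2 * I / 2) + exp (h * (- L) - h\<^sup>2 * I / 2))"
    by (intro Bochner_Integration.integrable_add exp_quadratic_integrable I)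
  show "AE h in lborel. norm (exp (L * \<bar>h\<bar> - h\<^sup>2 * I / 2)) \<le> norm (exp (h * L - h\<^sup>2 * I / 2) + exp (h * (- L) - h\<^sup>2 * I / 2))"
  proof (rule AE_I2)
    fix h :: real
    have "exp (L * \<bar>h\<bar> - h\<^sup>2 * I / 2) = exp (h * L - h\<^sup>2 * I / 2) \<or> exp (L * \<bar>h\<bar> - h\<^sup>2 * I / 2) = exp (h * (- L) - h\<^sup>2 * I / 2)"
      by (cases "h \<ge> 0") (auto simp: mult.commute)
    moreover have "exp (h * L - h\<^sup>2 * I / 2) > 0" "exp (h * (- L) - h\<^sup>2 * I / 2) > 0" by simp_all
    ultimately show "norm (exp (L * \<bar>h\<bar> - h\<^sup>2 * I / 2)) \<le> norm (exp (h * L - h\<^sup>2 * I / 2) + exp (h * (- L) - h\<^sup>2 * I / 2))"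
      unfolding real_norm_def by linarith
  qed
qed measurable

text \<open>An integrable majorant for the distance between \<open>exp (h * S - h\<^sup>2 * I / 2)\<close>, with \<open>\<bar>S\<bar> \<le> L\<close>, and a perturbation of it: the bracket collects
the relative error \<open>\<delta>\<close>, the error \<open>\<delta> * (\<bar>h\<bar> + h\<^sup>2)\<close> in the exponent, and the truncation at \<open>m\<close>.\<close>

definition tilt_error :: "real \<Rightarrow> real \<Rightarrow> real \<Rightarrow> real \<Rightarrow> real \<Rightarrow> real" where
  "tilt_error I L \<delta> m h = exp (L * \<bar>h\<bar> - h\<^sup>2 * I / 2) *
     ((1 + \<delta>) * exp (\<delta> * (\<bar>h\<bar> + h\<^sup>2)) - 1 + indicator {h. \<bar>h\<bar> > m} h)"

text \<open>Dominated convergence along \<open>\<delta> = d k \<longlonglongrightarrow> 0\<close> and \<open>m = k\<close>; the condition \<open>d k \<le> I / 4\<close> leaves a quadratic decay in the majorant.\<close>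

lemma tilt_error_small:
  fixes I L \<kappa> :: real
  assumes I: "I > 0" and \<kappa>: "\<kappa> > 0"
  shows "\<exists>\<delta>>0. \<exists>m. integrable lborel (tilt_error I L \<delta> m) \<and> (LINT h|lborel. tilt_error I L \<delta> m h) < \<kappa>"
proof -
  define d where "d k = min 1 (I / 4) * inverse (real (Suc k))" for k
  have d: "d k > 0" "d k \<le> 1" "d k \<le> I / 4" for k
  proof -
    have "inverse (real (Suc k)) \<le> 1" by (simp add: field_simps)
    then have "d k \<le> min 1 (I/4) * 1" unfolding d_def using I by (intro mult_left_mono) auto
    then show "d k \<le> 1" "d k \<le> I / 4" by auto
    show "d k > 0" unfolding d_def using I by auto
  qed
  have dlim: "d \<longlonglongrightarrow> 0"
    unfolding d_def[abs_def] by (intro tendsto_mult_right_zero LIMSEQ_inverse_real_of_nat)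
  let ?w = "\<lambda>k. tilt_error I L (d k) (real k)"
  let ?D = "\<lambda>h::real. 3 * exp ((L + 1) * \<bar>h\<bar> - h\<^sup>2 * (I / 2) / 2)"
  have Di: "integrable lborel ?D"
    using I by (intro integrable_mult_right exp_abs_quadratic_integrable) auto
  have wm: "?w k \<in> borel_measurable lborel" for k
    unfolding tilt_error_def[abs_def] by measurable
  have bd: "norm (?w k h) \<le> ?D h" for k h
  proof -
    have e1: "exp (d k * (\<bar>h\<bar> + h\<^sup>2)) \<le> exp (\<bar>h\<bar> + I / 4 * h\<^sup>2)"
    proof -
      have "d k * \<bar>h\<bar> \<le> 1 * \<bar>h\<bar>" by (intro mult_right_mono d) auto
      moreover have "d k * h\<^sup>2 \<le> I / 4 * h\<^sup>2" by (intro mult_right_mono d) auto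
      ultimately show ?thesis by (simp add: distrib_left)
    qed
    have e2: "1 \<le> exp (d k * (\<bar>h\<bar> + h\<^sup>2))" "1 \<le> exp (\<bar>h\<bar> + I / 4 * h\<^sup>2)" using d[of k] I by auto
    have f: "(1 + d k) * exp (d k * (\<bar>h\<bar> + h\<^sup>2)) \<le> 2 * exp (\<bar>h\<bar> + I / 4 * h\<^sup>2)"
      using d[of k] e1 by (intro mult_mono) auto
    have f0: "1 * 1 \<le> (1 + d k) * exp (d k * (\<bar>h\<bar> + h\<^sup>2))" using d[of k] e2 by (intro mult_mono) auto
    have ind: "indicator {h. \<bar>h\<bar> > real k} h \<le> (1::real)" "0 \<le> (indicator {h. \<bar>h\<bar> > real k} h :: real)" by (auto simp: indicator_def)
    have nn: "0 \<le> (1 + d k) * exp (d k * (\<bar>h\<bar> + h\<^sup>2)) - 1 + indicator {h. \<bar>h\<bar> > real k} h" using f0 ind by linarith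
    have b3: "(1 + d k) * exp (d k * (\<bar>h\<bar> + h\<^sup>2)) - 1 + indicator {h. \<bar>h\<bar> > real k} h \<le> 3 * exp (\<bar>h\<bar> + I / 4 * h\<^sup>2)"
      using f ind(1) e2(2) by linarith
    have "norm (?w k h) = exp (L * \<bar>h\<bar> - h\<^sup>2 * I / 2) * ((1 + d k) * exp (d k * (\<bar>h\<bar> + h\<^sup>2)) - 1 + indicator {h. \<bar>h\<bar> > real k} h)"
      unfolding tilt_error_def real_norm_def abs_mult using nn by simp
    also have "\<dots> \<le> exp (L * \<bar>h\<bar> - h\<^sup>2 * I / 2) * (3 * exp (\<bar>h\<bar> + I / 4 * h\<^sup>2))"
      using b3 by (intro mult_left_mono) auto
    also have "\<dots> = 3 * exp ((L * \<bar>h\<bar> - h\<^sup>2 * I / 2) + (\<bar>h\<bar> + I / 4 * h\<^sup>2))"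
      unfolding exp_add by simp
    also have "(L * \<bar>h\<bar> - h\<^sup>2 * I / 2) + (\<bar>h\<bar> + I / 4 * h\<^sup>2) = (L + 1) * \<bar>h\<bar> - h\<^sup>2 * (I / 2) / 2"
      by (simp add: algebra_simps)
    finally show ?thesis .
  qed
  have lim: "(\<lambda>k. ?w k h) \<longlonglongrightarrow> 0" for h
  proof -
    have A: "(\<lambda>k. (1 + d k) * exp (d k * (\<bar>h\<bar> + h\<^sup>2)) - 1) \<longlonglongrightarrow> (1 + 0) * exp (0 * (\<bar>h\<bar> + h\<^sup>2)) - 1"
      by (intro tendsto_intros dlim)
    have "\<forall>\<^sub>F k in sequentially. (indicator {h. \<bar>h\<bar> > real k} h :: real) = 0"
    proof -
      have "\<forall>\<^sub>F k in sequentially. real k \<ge> \<bar>h\<bar>"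
        using filterlim_real_sequentially by (auto simp: filterlim_at_top)
      then show ?thesis by eventually_elim (auto simp: indicator_def)
    qed
    then have B: "(\<lambda>k. indicator {h. \<bar>h\<bar> > real k} h :: real) \<longlonglongrightarrow> 0"
      by (rule tendsto_eventually)
    have "(\<lambda>k. exp (L * \<bar>h\<bar> - h\<^sup>2 * I / 2) * ((1 + d k) * exp (d k * (\<bar>h\<bar> + h\<^sup>2)) - 1 + indicator {h. \<bar>h\<bar> > real k} h))
        \<longlonglongrightarrow> exp (L * \<bar>h\<bar> - h\<^sup>2 * I / 2) * (((1 + 0) * exp (0 * (\<bar>h\<bar> + h\<^sup>2)) - 1) + 0)"
      by (rule tendsto_mult[OF tendsto_const tendsto_add[OF A B]])
    then show ?thesis unfolding tilt_error_def by simp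
  qed
  have "(\<lambda>k. LINT h|lborel. ?w k h) \<longlonglongrightarrow> (LINT h::real|lborel. 0)"
    by (rule integral_dominated_convergence[OF _ _ Di]) (use wm lim bd in auto)
  then have "\<forall>\<^sub>F k in sequentially. (LINT h|lborel. ?w k h) < \<kappa>"
    using \<kappa> by (auto dest: order_tendstoD)
  then obtain k where k: "(LINT h|lborel. ?w k h) < \<kappa>" by (auto simp: eventually_sequentially)
  have "integrable lborel (?w k)"
    by (rule Bochner_Integration.integrable_bound[OF Di wm]) (rule AE_I2, rule order_trans[OF bd], simp)
  with k d(1)[of k] show ?thesis by blast
qed

text \<open>Densities that, up to the error \<open>\<delta>\<close>, are the quadratic exponential truncated at \<open>m\<close>.  The local likelihood ratio of a controlled
sample has this form for every mixing measure close to the truth.\<close>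

definition near_gaussian :: "real \<Rightarrow> real \<Rightarrow> real \<Rightarrow> real \<Rightarrow> (real \<Rightarrow> real) \<Rightarrow> bool" where
  "near_gaussian I S \<delta> m j \<longleftrightarrow> j \<in> borel_measurable borel \<and>
    (\<forall>h. \<bar>h\<bar> \<le> m \<longrightarrow> (1 - \<delta>) * exp (h * S - h\<^sup>2 * I / 2 - \<delta> * (\<bar>h\<bar> + h\<^sup>2)) \<le> j h \<and>
        j h \<le> (1 + \<delta>) * exp (h * S - h\<^sup>2 * I / 2 + \<delta> * (\<bar>h\<bar> + h\<^sup>2))) \<and>
    (\<forall>h. \<bar>h\<bar> > m \<longrightarrow> j h = 0)"

lemma gaussian_perturbation:
  fixes I L \<kappa> :: real
  assumes I: "I > 0" and \<kappa>: "\<kappa> > 0"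
  shows "\<exists>\<delta>>0. \<exists>m. \<forall>S m' j. \<bar>S\<bar> \<le> L \<longrightarrow> m \<le> m' \<longrightarrow> near_gaussian I S \<delta> m' j \<longrightarrow>
    integrable lborel j \<and> (LINT h|lborel. \<bar>j h - exp (h * S - h\<^sup>2 * I / 2)\<bar>) \<le> \<kappa>"
proof -
  obtain \<delta> m where \<delta>: "\<delta> > 0" and w: "integrable lborel (tilt_error I L \<delta> m)" "(LINT h|lborel. tilt_error I L \<delta> m h) < \<kappa>"
    using tilt_error_small[OF I \<kappa>] by blast
  have "integrable lborel j \<and> (LINT h|lborel. \<bar>j h - exp (h * S - h\<^sup>2 * I / 2)\<bar>) \<le> \<kappa>"
    if S: "\<bar>S\<bar> \<le> L" and mm: "m \<le> m'" and j: "near_gaussian I S \<delta> m' j" for S m' j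
  proof -
    have jm: "j \<in> borel_measurable borel"
      and inner: "\<And>h. \<bar>h\<bar> \<le> m' \<Longrightarrow> (1 - \<delta>) * exp (h * S - h\<^sup>2 * I / 2 - \<delta> * (\<bar>h\<bar> + h\<^sup>2)) \<le> j h \<and>
        j h \<le> (1 + \<delta>) * exp (h * S - h\<^sup>2 * I / 2 + \<delta> * (\<bar>h\<bar> + h\<^sup>2))"
      and outer: "\<And>h. \<bar>h\<bar> > m' \<Longrightarrow> j h = 0"
      using j unfolding near_gaussian_def by blast+
    let ?q = "\<lambda>h. exp (h * S - h\<^sup>2 * I / 2)"
    have le: "\<bar>j h - ?q h\<bar> \<le> tilt_error I L \<delta> m h" for h
    proof -
      define E where "E = exp (\<delta> * (\<bar>h\<bar> + h\<^sup>2))"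
      have E: "E \<ge> 1" unfolding E_def using \<delta> by auto
      have "h * S \<le> L * \<bar>h\<bar>"
      proof -
        have "h * S \<le> \<bar>h\<bar> * \<bar>S\<bar>" by (simp add: abs_mult[symmetric])
        also have "\<dots> \<le> L * \<bar>h\<bar>" using S by (subst mult.commute) (intro mult_right_mono, auto)
        finally show ?thesis .
      qed
      then have q: "?q h \<le> exp (L * \<bar>h\<bar> - h\<^sup>2 * I / 2)" by simp
      have gE: "(1 + \<delta>) * E - 1 \<ge> 0" using mult_mono[of 1 "1 + \<delta>" 1 E] E \<delta> by auto
      show ?thesis
      proof (cases "\<bar>h\<bar> \<le> m'")
        case True
        have up: "j h \<le> (1 + \<delta>) * (?q h * E)" using inner[OF True] by (simp add: E_def exp_add)
        have lo: "(1 - \<delta>) * (?q h / E) \<le> j h" using inner[OF True] by (simp add: E_def exp_diff)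
        have "2 \<le> (1 + \<delta>) * E + (1 - \<delta>) / E"
        proof -
          have "0 \<le> (E - 1)\<^sup>2 + \<delta> * (E\<^sup>2 - 1)" using \<delta> E by (intro add_nonneg_nonneg mult_nonneg_nonneg) (auto simp: one_le_power)
          then show ?thesis using E by (simp add: field_simps power2_eq_square)
        qed
        then have "?q h * (1 - ((1 + \<delta>) * E - 1)) \<le> ?q h * ((1 - \<delta>) / E)" by (intro mult_left_mono) auto
        then have "?q h - j h \<le> ?q h * ((1 + \<delta>) * E - 1)" using lo by (simp add: algebra_simps)
        moreover have "j h - ?q h \<le> ?q h * ((1 + \<delta>) * E - 1)" using up by (simp add: algebra_simps)
        ultimately have "\<bar>j h - ?q h\<bar> \<le> ?q h * ((1 + \<delta>) * E - 1)" by linarith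
        also have "\<dots> \<le> exp (L * \<bar>h\<bar> - h\<^sup>2 * I / 2) * ((1 + \<delta>) * E - 1 + indicator {h. \<bar>h\<bar> > m} h)"
          using q gE by (intro mult_mono) auto
        finally show ?thesis by (simp add: tilt_error_def E_def)
      next
        case False
        then have "\<bar>j h - ?q h\<bar> = ?q h * 1" using outer by simp
        also have "\<dots> \<le> exp (L * \<bar>h\<bar> - h\<^sup>2 * I / 2) * ((1 + \<delta>) * E - 1 + indicator {h. \<bar>h\<bar> > m} h)"
          using q gE False mm by (intro mult_mono) (auto simp: indicator_def)
        finally show ?thesis by (simp add: tilt_error_def E_def)
      qed
    qed
    have qi: "integrable lborel ?q" by (rule exp_quadratic_integrable[OF I])
    have di: "integrable lborel (\<lambda>h. j h - ?q h)"
    proof (rule Bochner_Integration.integrable_bound[OF w(1)])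
      show "AE h in lborel. norm (j h - ?q h) \<le> norm (tilt_error I L \<delta> m h)"
        using le by (intro AE_I2) (metis abs_ge_self order_trans real_norm_def)
    qed (use jm in measurable)
    have "integrable lborel (\<lambda>h. (j h - ?q h) + ?q h)" using di qi by (rule Bochner_Integration.integrable_add)
    then have "integrable lborel j" by simp
    moreover have "(LINT h|lborel. \<bar>j h - ?q h\<bar>) \<le> (LINT h|lborel. tilt_error I L \<delta> m h)"
      using le by (intro integral_mono integrable_abs di w)
    ultimately show ?thesis using w(2) by simp
  qed
  with \<delta> show ?thesis by blast
qed

lemma measure_normal_measure:
  assumes B: "B \<in> sets borel" and v: "v > 0"
  shows "measure (normal_measure \<mu> v) B = (LINT h|lborel. indicator B h * normal_density \<mu> (sqrt v) h)"
proof -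
  have i: "integrable lborel (\<lambda>h. indicator B h * normal_density \<mu> (sqrt v) h)"
    using integrable_mult_indicator[OF _ integrable_normal_density[of "sqrt v" \<mu>], of B] B v by simp
  have "emeasure (normal_measure \<mu> v) B = (\<integral>\<^sup>+h. ennreal (indicator B h * normal_density \<mu> (sqrt v) h) \<partial>lborel)"
    unfolding normal_measure_def using B
    by (subst emeasure_density) (auto intro!: nn_integral_cong simp: indicator_def)
  also have "\<dots> = ennreal (LINT h|lborel. indicator B h * normal_density \<mu> (sqrt v) h)"
    by (rule nn_integral_eq_integral[OF i]) auto
  finally show ?thesis
    unfolding measure_def by (simp add: Bochner_Integration.integral_nonneg)
qed

lemma prob_space_normal_measure: "v > 0 \<Longrightarrow> prob_space (normal_measure \<mu> v)"
  unfolding normal_measure_def by (rule prob_space_normal_density) simp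

text \<open>The normalising constant \<open>c\<close> depends on \<open>S\<close> but not on \<open>j\<close>.  That is essential for averaging over mixing measures: all the conditional
posteriors are compared with the same multiple of the same normal distribution.\<close>

lemma normal_approximation:
  fixes I L \<kappa> :: real
  assumes I: "I > 0" and \<kappa>: "\<kappa> > 0"
  shows "\<exists>\<delta>>0. \<exists>m. \<forall>S. \<bar>S\<bar> \<le> L \<longrightarrow> (\<exists>c>0. \<forall>m' j. m \<le> m' \<longrightarrow> near_gaussian I S \<delta> m' j \<longrightarrow>
    integrable lborel j \<and> (\<forall>B\<in>sets borel.
      \<bar>c * (LINT h|lborel. indicator B h * j h) - measure (normal_measure (S / I) (inverse I)) B\<bar> \<le> \<kappa>))"
proof -
  define s where "s = sqrt (I / (2 * pi))"
  have s: "s > 0" using I by (simp add: s_def)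
  have "\<kappa> / s > 0" using s \<kappa> by simp
  from gaussian_perturbation[OF I this, of L] obtain \<delta> m where \<delta>: "\<delta> > 0"
    and G: "\<forall>S m' j. \<bar>S\<bar> \<le> L \<longrightarrow> m \<le> m' \<longrightarrow> near_gaussian I S \<delta> m' j \<longrightarrow>
    integrable lborel j \<and> (LINT h|lborel. \<bar>j h - exp (h * S - h\<^sup>2 * I / 2)\<bar>) \<le> \<kappa> / s"
    by blast
  show ?thesis
  proof (rule exI[of _ \<delta>], rule conjI[OF \<delta>], rule exI[of _ m], intro allI impI)
    fix S assume S: "\<bar>S\<bar> \<le> L"
    define c where "c = s * exp (- S\<^sup>2 / (2 * I))"
    have c: "c > 0" "c \<le> s" using s I by (auto simp: c_def mult_le_cancel_left1)
    show "\<exists>c>0. \<forall>m' j. m \<le> m' \<longrightarrow> near_gaussian I S \<delta> m' j \<longrightarrow>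
    integrable lborel j \<and> (\<forall>B\<in>sets borel.
      \<bar>c * (LINT h|lborel. indicator B h * j h) - measure (normal_measure (S / I) (inverse I)) B\<bar> \<le> \<kappa>)"
    proof (rule exI[of _ c], rule conjI[OF c(1)], intro allI impI)
      fix m' j
      assume *: "m \<le> m'" "near_gaussian I S \<delta> m' j"
      let ?q = "\<lambda>h. exp (h * S - h\<^sup>2 * I / 2)"
      have g: "integrable lborel j" "(LINT h|lborel. \<bar>j h - ?q h\<bar>) \<le> \<kappa> / s"
        using G S * by blast+
      have qi: "integrable lborel ?q" by (rule exp_quadratic_integrable[OF I])
      have "\<bar>c * (LINT h|lborel. indicator B h * j h) - measure (normal_measure (S / I) (inverse I)) B\<bar> \<le> \<kappa>"
        if B: "B \<in> sets borel" for B
      proof -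
        have i: "integrable lborel (\<lambda>h. indicator B h * f h)" if "integrable lborel f" for f :: "real \<Rightarrow> real"
          using integrable_mult_indicator[of B lborel f] that B by simp
        have "measure (normal_measure (S / I) (inverse I)) B = c * (LINT h|lborel. indicator B h * ?q h)"
          using I by (subst measure_normal_measure[OF B])
            (auto simp: normal_density_tilt s_def c_def mult_ac simp flip: integral_mult_right_zero)
        then have "c * (LINT h|lborel. indicator B h * j h) - measure (normal_measure (S / I) (inverse I)) B
          = c * (LINT h|lborel. indicator B h * (j h - ?q h))"
          using i[OF g(1)] i[OF qi] by (simp add: right_diff_distrib)
        then have "\<bar>c * (LINT h|lborel. indicator B h * j h) - measure (normal_measure (S / I) (inverse I)) B\<bar>
          = c * \<bar>LINT h|lborel. indicator B h * (j h - ?q h)\<bar>" using c(1) by (simp add: abs_mult)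
        also have "\<dots> \<le> c * (LINT h|lborel. \<bar>j h - ?q h\<bar>)"
        proof (rule mult_left_mono)
          have "\<bar>LINT h|lborel. indicator B h * (j h - ?q h)\<bar> \<le> (LINT h|lborel. \<bar>indicator B h * (j h - ?q h)\<bar>)"
            by (rule integral_abs_bound)
          also have "\<dots> \<le> (LINT h|lborel. \<bar>j h - ?q h\<bar>)"
            by (intro integral_mono integrable_abs i Bochner_Integration.integrable_diff g qi)
              (auto simp: indicator_def)
          finally show "\<bar>LINT h|lborel. indicator B h * (j h - ?q h)\<bar> \<le> (LINT h|lborel. \<bar>j h - ?q h\<bar>)" .
        qed (use c in simp)
        also have "\<dots> \<le> s * (\<kappa> / s)" using g(2) c s by (intro mult_mono) (auto intro!: Bochner_Integration.integral_nonneg)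
        finally show ?thesis using s by simp
      qed
      with g(1) show "integrable lborel j \<and> (\<forall>B\<in>sets borel.
        \<bar>c * (LINT h|lborel. indicator B h * j h) - measure (normal_measure (S / I) (inverse I)) B\<bar> \<le> \<kappa>)" by blast
    qed
  qed
qed

section \<open>Total variation distance and weak measurability\<close>

text \<open>Finite unions of sets of a countable base: a Borel set is approximated from outside by an open set, and the open set from inside
by finite unions of basic sets.\<close>

lemma countable_approximating_family:
  "\<exists>\<A> :: real set set. countable \<A> \<and> \<A> \<subseteq> sets borel \<and> \<A> \<noteq> {} \<and>
     (\<forall>\<mu> \<nu>. finite_measure \<mu> \<longrightarrow> finite_measure \<nu> \<longrightarrow> sets \<mu> = sets borel \<longrightarrow> sets \<nu> = sets borel \<longrightarrow>
       (\<forall>B\<in>sets borel. \<forall>\<delta>>0. \<exists>A\<in>\<A>. \<bar>measure \<mu> B - measure \<mu> A\<bar> \<le> \<delta> \<and> \<bar>measure \<nu> B - measure \<nu> A\<bar> \<le> \<delta>))"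
proof -
  obtain \<B> :: "real set set" where \<B>: "countable \<B>" "topological_basis \<B>" using ex_countable_basis by blast
  define \<A> where "\<A> = Union ` {F. finite F \<and> F \<subseteq> \<B>}"
  have op: "open A" if "A \<in> \<A>" for A
    using that \<B>(2) by (auto simp: \<A>_def intro!: open_Union topological_basis_open)
  have outer: "\<exists>U. open U \<and> B \<subseteq> U \<and> measure \<mu> U \<le> measure \<mu> B + \<delta>"
    if \<mu>: "finite_measure \<mu>" "sets \<mu> = sets borel" and B: "B \<in> sets borel" and \<delta>: "\<delta> > 0" for \<mu> and B :: "real set" and \<delta> :: real
  proof -
    interpret finite_measure \<mu> by fact
    have "emeasure \<mu> B < emeasure \<mu> B + ennreal \<delta>" using \<delta> by (simp add: emeasure_eq_measure ennreal_plus[symmetric] ennreal_less_iff del: ennreal_plus)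
    then have "(INF U \<in> {U. B \<subseteq> U \<and> open U}. emeasure \<mu> U) < emeasure \<mu> B + ennreal \<delta>"
      using outer_regular[of \<mu> B] \<mu> B by simp
    then obtain U where U: "B \<subseteq> U" "open U" "emeasure \<mu> U < emeasure \<mu> B + ennreal \<delta>"
      by (auto simp: Inf_less_iff)
    then have "measure \<mu> U \<le> measure \<mu> B + \<delta>"
      using \<delta> by (simp add: emeasure_eq_measure ennreal_plus[symmetric] ennreal_less_iff del: ennreal_plus)
    with U show ?thesis by blast
  qed
  have "\<exists>A\<in>\<A>. \<bar>measure \<mu> B - measure \<mu> A\<bar> \<le> \<delta> \<and> \<bar>measure \<nu> B - measure \<nu> A\<bar> \<le> \<delta>"
    if \<mu>: "finite_measure \<mu>" "sets \<mu> = sets borel" and \<nu>: "finite_measure \<nu>" "sets \<nu> = sets borel"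
      and B: "B \<in> sets borel" and \<delta>: "\<delta> > 0" for \<mu> \<nu> :: "real measure" and B \<delta>
  proof -
    interpret \<mu>: finite_measure \<mu> by fact
    interpret \<nu>: finite_measure \<nu> by fact
    obtain U1 where U1: "open U1" "B \<subseteq> U1" "measure \<mu> U1 \<le> measure \<mu> B + \<delta>/2" using outer[OF \<mu> B, of "\<delta>/2"] \<delta> by auto
    obtain U2 where U2: "open U2" "B \<subseteq> U2" "measure \<nu> U2 \<le> measure \<nu> B + \<delta>/2" using outer[OF \<nu> B, of "\<delta>/2"] \<delta> by auto
    define U where "U = U1 \<inter> U2"
    have U: "open U" "B \<subseteq> U" using U1 U2 by (auto simp: U_def)
    have "measure \<mu> U \<le> measure \<mu> U1" "measure \<nu> U \<le> measure \<nu> U2"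
      using U1 U2 \<mu> \<nu> by (auto intro!: \<mu>.finite_measure_mono \<nu>.finite_measure_mono simp: U_def)
    moreover have "measure \<mu> B \<le> measure \<mu> U" "measure \<nu> B \<le> measure \<nu> U"
      using U \<mu> \<nu> by (auto intro!: \<mu>.finite_measure_mono \<nu>.finite_measure_mono)
    ultimately have cl: "\<bar>measure \<mu> B - measure \<mu> U\<bar> \<le> \<delta>/2" "\<bar>measure \<nu> B - measure \<nu> U\<bar> \<le> \<delta>/2"
      using U1 U2 by auto
    obtain \<U> where \<U>: "\<U> \<subseteq> \<B>" "\<Union>\<U> = U" using \<B>(2) U(1) unfolding topological_basis_def by metis
    define A where "A n = \<Union>{from_nat_into (insert {} \<U>) i | i. i \<le> n}" for n :: nat
    have cU: "countable (insert {} \<U>)" using \<U>(1) \<B>(1) countable_subset by auto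
    have mem: "from_nat_into (insert {} \<U>) i \<in> insert {} \<U>" for i by (rule from_nat_into) simp
    have AA: "A n \<in> \<A>" for n
    proof -
      have "A n = \<Union>({from_nat_into (insert {} \<U>) i | i. i \<le> n} - {{}})" unfolding A_def by auto
      moreover have "finite ({from_nat_into (insert {} \<U>) i | i. i \<le> n} - {{}})" by (intro finite_Diff) simp
      moreover have "{from_nat_into (insert {} \<U>) i | i. i \<le> n} - {{}} \<subseteq> \<B>" using mem \<U>(1) by blast
      ultimately show ?thesis unfolding \<A>_def by blast
    qed
    have inc: "incseq A" unfolding incseq_def A_def by (auto intro: order_trans)
    have un: "(\<Union>n. A n) = U"
    proof -
      have "(\<Union>n. A n) = \<Union>(range (from_nat_into (insert {} \<U>)))" unfolding A_def by blast
      also have "\<dots> = \<Union>(insert {} \<U>)" using cU by (subst range_from_nat_into) auto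
      finally show ?thesis using \<U>(2) by simp
    qed
    have rng: "range A \<subseteq> sets \<mu>" "range A \<subseteq> sets \<nu>" using AA op \<mu> \<nu> by auto
    have "(\<lambda>n. measure \<mu> (A n)) \<longlonglongrightarrow> measure \<mu> U" "(\<lambda>n. measure \<nu> (A n)) \<longlonglongrightarrow> measure \<nu> U"
      using \<mu>.finite_Lim_measure_incseq[OF rng(1) inc] \<nu>.finite_Lim_measure_incseq[OF rng(2) inc] un by auto
    then have "\<forall>\<^sub>F n in sequentially. dist (measure \<mu> (A n)) (measure \<mu> U) < \<delta>/2"
      "\<forall>\<^sub>F n in sequentially. dist (measure \<nu> (A n)) (measure \<nu> U) < \<delta>/2"
      using half_gt_zero[OF \<delta>] by (blast dest: tendstoD)+
    then have "\<forall>\<^sub>F n in sequentially. dist (measure \<mu> (A n)) (measure \<mu> U) < \<delta>/2 \<and> dist (measure \<nu> (A n)) (measure \<nu> U) < \<delta>/2"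
      by eventually_elim auto
    then obtain n where n: "dist (measure \<mu> (A n)) (measure \<mu> U) < \<delta>/2" "dist (measure \<nu> (A n)) (measure \<nu> U) < \<delta>/2"
      by (auto simp: eventually_sequentially)
    show ?thesis
      using n cl AA[of n] unfolding dist_real_def by (intro bexI[of _ "A n"]) linarith+
  qed
  moreover have "countable \<A>" unfolding \<A>_def using countable_Collect_finite_subset[OF \<B>(1)] by simp
  moreover have "\<A> \<subseteq> sets borel" using op by auto
  moreover have "\<A> \<noteq> {}" unfolding \<A>_def by auto
  ultimately show ?thesis by (intro exI[of _ \<A>]) blast
qed

text \<open>Reduces the supremum over all Borel sets to a countable one, as its measurability requires.\<close>

lemma SUP_borel_eq_countable:
  obtains \<A> :: "real set set" where "countable \<A>" "\<A> \<subseteq> sets borel"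
    "\<And>\<mu> \<nu>. prob_space \<mu> \<Longrightarrow> prob_space \<nu> \<Longrightarrow> sets \<mu> = sets borel \<Longrightarrow> sets \<nu> = sets borel \<Longrightarrow>
       (SUP B\<in>sets borel. \<bar>measure \<mu> B - measure \<nu> B\<bar>) = (SUP B\<in>\<A>. \<bar>measure \<mu> B - measure \<nu> B\<bar>)"
proof -
  obtain \<A> :: "real set set" where \<A>: "countable \<A>" "\<A> \<subseteq> sets borel" "\<A> \<noteq> {}"
    and approx: "\<forall>\<mu> \<nu>. finite_measure \<mu> \<longrightarrow> finite_measure \<nu> \<longrightarrow> sets \<mu> = sets borel \<longrightarrow> sets \<nu> = sets borel \<longrightarrow>
       (\<forall>B\<in>sets borel. \<forall>\<delta>>0. \<exists>A\<in>\<A>. \<bar>measure \<mu> B - measure \<mu> A\<bar> \<le> \<delta> \<and> \<bar>measure \<nu> B - measure \<nu> A\<bar> \<le> \<delta>)"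
    using countable_approximating_family by blast
  have "(SUP B\<in>sets borel. \<bar>measure \<mu> B - measure \<nu> B\<bar>) = (SUP B\<in>\<A>. \<bar>measure \<mu> B - measure \<nu> B\<bar>)"
    if "prob_space \<mu>" "prob_space \<nu>" and s: "sets \<mu> = sets borel" "sets \<nu> = sets borel" for \<mu> \<nu> :: "real measure"
  proof -
    interpret \<mu>: prob_space \<mu> by fact
    interpret \<nu>: prob_space \<nu> by fact
    let ?d = "\<lambda>B. \<bar>measure \<mu> B - measure \<nu> B\<bar>"
    have "?d B \<le> 1" for B
      using \<mu>.prob_le_1[of B] \<nu>.prob_le_1[of B] measure_nonneg[of \<mu> B] measure_nonneg[of \<nu> B] by linarith
    then have bdd: "bdd_above (?d ` X)" for X by (intro bdd_aboveI[of _ 1]) auto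
    show ?thesis
    proof (rule antisym)
      show "(SUP B\<in>sets borel. ?d B) \<le> (SUP B\<in>\<A>. ?d B)"
      proof (rule cSUP_least)
        fix B :: "real set" assume B: "B \<in> sets borel"
        show "?d B \<le> (SUP B\<in>\<A>. ?d B)"
        proof (rule field_le_epsilon)
          fix e :: real assume "e > 0"
          then have "e / 2 > 0" by simp
          then obtain A where A: "A \<in> \<A>" "\<bar>measure \<mu> B - measure \<mu> A\<bar> \<le> e/2" "\<bar>measure \<nu> B - measure \<nu> A\<bar> \<le> e/2"
            using approx \<mu>.finite_measure_axioms \<nu>.finite_measure_axioms s B by blast
          have "?d A \<le> (SUP B\<in>\<A>. ?d B)" by (rule cSUP_upper[OF A(1) bdd])
          with A(2,3) show "?d B \<le> (SUP B\<in>\<A>. ?d B) + e" by linarith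
        qed
      qed auto
      show "(SUP B\<in>\<A>. ?d B) \<le> (SUP B\<in>sets borel. ?d B)"
        by (rule cSUP_subset_mono[OF \<A>(3) bdd \<A>(2)]) auto
    qed
  qed
  with \<A>(1,2) show ?thesis by (rule that)
qed

context mixture_box begin

lemma box_integral_eq:
  assumes "\<eta> \<in> mixing"
  shows "(LINT w:mix_box M s1 s2|\<eta>. gauss_deriv k (snd w) (y - fst w)) = mix_deriv k \<eta> y"
proof -
  have "mix_box M s1 s2 \<in> sets \<eta>"
    unfolding mixing_sets[OF assms] mix_box_def by (intro borel_closed closed_Times) auto
  then have [measurable]: "indicator (mix_box M s1 s2) \<in> borel_measurable \<eta>" by simp
  note [measurable] = kernel_measurable[OF assms]
  show ?thesis unfolding set_lebesgue_integral_def mix_deriv_def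
  proof (rule integral_cong_AE)
    show "AE w in \<eta>. indicat_real (mix_box M s1 s2) w *\<^sub>R gauss_deriv k (snd w) (y - fst w) = gauss_deriv k (snd w) (y - fst w)"
      using mixing_AE[OF assms] by eventually_elim (auto simp: mix_box_def indicator_def mem_Times_iff)
  qed measurable
qed

lemma kernel_test_function:
  "continuous_on (mix_box M s1 s2) (\<lambda>w. gauss_deriv k (snd w) (y - fst w))"
  "bounded ((\<lambda>w. gauss_deriv k (snd w) (y - fst w)) ` mix_box M s1 s2)"
proof -
  show c: "continuous_on (mix_box M s1 s2) (\<lambda>w. gauss_deriv k (snd w) (y - fst w))"
    using s1_pos by (intro gauss_deriv_continuous_on continuous_intros) (auto simp: mix_box_def)
  have "compact (mix_box M s1 s2)" unfolding mix_box_def by (intro compact_Times) auto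
  then show "bounded ((\<lambda>w. gauss_deriv k (snd w) (y - fst w)) ` mix_box M s1 s2)"
    by (intro compact_imp_bounded compact_continuous_image c)
qed

lemma weak_nbhd_finite_test:
  assumes G: "finite G" and e: "e > 0" and sub: "U \<subseteq> mixing"
    and U: "\<And>\<eta>. \<eta> \<in> mixing \<Longrightarrow> (\<forall>y\<in>G. \<bar>mix_deriv 0 \<eta> y - mix_deriv 0 \<eta>1 y\<bar> < e) \<Longrightarrow> \<eta> \<in> U" and \<eta>1: "\<eta>1 \<in> mixing"
  shows "weak_nbhd M s1 s2 \<eta>1 U"
  unfolding weak_nbhd_def
proof (intro conjI sub exI)
  let ?F = "(\<lambda>y w. gauss_deriv 0 (snd w) (y - fst w)) ` G"
  show "finite ?F" using G by simp
  show "e > 0" by fact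
  show "\<forall>f\<in>?F. continuous_on (mix_box M s1 s2) f \<and> bounded (f ` mix_box M s1 s2)"
    using kernel_test_function[of 0] by auto
  show "{\<eta> \<in> mixing. \<forall>f\<in>?F. \<bar>(LINT w:mix_box M s1 s2|\<eta>. f w) - (LINT w:mix_box M s1 s2|\<eta>1. f w)\<bar> < e} \<subseteq> U"
  proof
    fix \<eta> assume "\<eta> \<in> {\<eta> \<in> mixing. \<forall>f\<in>?F. \<bar>(LINT w:mix_box M s1 s2|\<eta>. f w) - (LINT w:mix_box M s1 s2|\<eta>1. f w)\<bar> < e}"
    then have \<eta>: "\<eta> \<in> mixing" and cl: "\<And>y. y \<in> G \<Longrightarrow>
      \<bar>(LINT w:mix_box M s1 s2|\<eta>. gauss_deriv 0 (snd w) (y - fst w)) - (LINT w:mix_box M s1 s2|\<eta>1. gauss_deriv 0 (snd w) (y - fst w))\<bar> < e"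
      by auto
    show "\<eta> \<in> U"
      by (rule U[OF \<eta>]) (use cl box_integral_eq[OF \<eta>, of 0] box_integral_eq[OF \<eta>1, of 0] in simp)
  qed
qed

lemma density_nbhd_weak_nbhd: "finite G \<Longrightarrow> e > 0 \<Longrightarrow> \<eta>0 \<in> mixing \<Longrightarrow> weak_nbhd M s1 s2 \<eta>0 (density_nbhd \<eta>0 G e)"
  by (rule weak_nbhd_finite_test[of G e]) (auto simp: density_nbhd_def)

lemma space_weak_borel: "space (weak_borel M s1 s2) = mixing"
  unfolding weak_borel_def by (rule space_measure_of) (auto simp: weakly_open_def)

lemma weakly_open_sets: "weakly_open M s1 s2 U \<Longrightarrow> U \<in> sets (weak_borel M s1 s2)"
  unfolding weak_borel_def by (subst sets_measure_of) (auto simp: weakly_open_def)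

lemma mix_deriv_weak_measurable: "(\<lambda>\<eta>. mix_deriv 0 \<eta> y) \<in> borel_measurable (weak_borel M s1 s2)"
proof (rule borel_measurableI)
  fix S :: "real set" assume S: "open S"
  have "weakly_open M s1 s2 ((\<lambda>\<eta>. mix_deriv 0 \<eta> y) -` S \<inter> mixing)"
    unfolding weakly_open_def
  proof (intro conjI ballI)
    fix \<eta>1 assume \<eta>1: "\<eta>1 \<in> (\<lambda>\<eta>. mix_deriv 0 \<eta> y) -` S \<inter> mixing"
    then obtain e where e: "e > 0" "ball (mix_deriv 0 \<eta>1 y) e \<subseteq> S" using S open_contains_ball by blast
    show "weak_nbhd M s1 s2 \<eta>1 ((\<lambda>\<eta>. mix_deriv 0 \<eta> y) -` S \<inter> mixing)"
      by (rule weak_nbhd_finite_test[of "{y}" e]) (use e \<eta>1 in \<open>auto simp: subset_eq dist_real_def abs_minus_commute\<close>)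
  qed auto
  then show "(\<lambda>\<eta>. mix_deriv 0 \<eta> y) -` S \<inter> space (weak_borel M s1 s2) \<in> sets (weak_borel M s1 s2)"
    unfolding space_weak_borel by (rule weakly_open_sets)
qed

lemma density_nbhd_sets: "finite G \<Longrightarrow> density_nbhd \<eta>0 G e \<in> sets (weak_borel M s1 s2)"
proof -
  assume G: "finite G"
  have "density_nbhd \<eta>0 G e = {\<eta> \<in> space (weak_borel M s1 s2). \<forall>y\<in>G. \<bar>mix_deriv 0 \<eta> y - mix_deriv 0 \<eta>0 y\<bar> < e}"
    by (auto simp: density_nbhd_def space_weak_borel)
  also have "\<dots> \<in> sets (weak_borel M s1 s2)"
    using G mix_deriv_weak_measurable by measurable
  finally show ?thesis .
qed

text \<open>A function that is continuous in one variable and measurable in the other is a limit of functions that are step functions in the first variable.\<close>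

lemma density_joint_measurable:
  "(\<lambda>p. mix_deriv 0 (snd p) (fst p)) \<in> borel_measurable (borel \<Otimes>\<^sub>M weak_borel M s1 s2)"
proof (rule borel_measurable_LIMSEQ_real)
  let ?g = "\<lambda>k p. mix_deriv 0 (snd p) (real_of_int \<lfloor>real (Suc k) * fst p\<rfloor> / real (Suc k))"
  show "?g k \<in> borel_measurable (borel \<Otimes>\<^sub>M weak_borel M s1 s2)" for k
  proof (rule measurable_compose_countable[of "\<lambda>j p. mix_deriv 0 (snd p) (real_of_int j / real (Suc k))"])
    show "(\<lambda>p. mix_deriv 0 (snd p) (real_of_int j / real (Suc k))) \<in> borel_measurable (borel \<Otimes>\<^sub>M weak_borel M s1 s2)" for j
      by (rule measurable_compose[OF measurable_snd mix_deriv_weak_measurable])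
    show "(\<lambda>p. \<lfloor>real (Suc k) * fst p\<rfloor>) \<in> borel \<Otimes>\<^sub>M weak_borel M s1 s2 \<rightarrow>\<^sub>M count_space UNIV" by measurable
  qed
  fix p :: "real \<times> (real \<times> real) measure" assume "p \<in> space (borel \<Otimes>\<^sub>M weak_borel M s1 s2)"
  then have \<eta>: "snd p \<in> mixing" by (auto simp: space_pair_measure space_weak_borel)
  have "(\<lambda>k. real_of_int \<lfloor>real (Suc k) * fst p\<rfloor> / real (Suc k)) \<longlonglongrightarrow> fst p"
  proof (rule LIMSEQ_I)
    fix r :: real assume "r > 0"
    then obtain N where N: "inverse (real (Suc N)) < r" using reals_Archimedean by blast
    have "norm (real_of_int \<lfloor>real (Suc k) * fst p\<rfloor> / real (Suc k) - fst p) < r" if "k \<ge> N" for k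
    proof -
      let ?m = "real (Suc k)"
      have m: "?m > 0" by simp
      have "\<bar>real_of_int \<lfloor>?m * fst p\<rfloor> - ?m * fst p\<bar> \<le> 1" by linarith
      moreover have "real_of_int \<lfloor>?m * fst p\<rfloor> / ?m - fst p = (real_of_int \<lfloor>?m * fst p\<rfloor> - ?m * fst p) / ?m"
        by (simp add: field_simps)
      ultimately have "\<bar>real_of_int \<lfloor>?m * fst p\<rfloor> / ?m - fst p\<bar> \<le> 1 / ?m"
        by (simp add: abs_divide divide_right_mono del: of_nat_Suc)
      also have "\<dots> \<le> inverse (real (Suc N))" using that by (simp add: field_simps)
      finally show ?thesis using N by simp
    qed
    then show "\<exists>no. \<forall>k\<ge>no. norm (real_of_int \<lfloor>real (Suc k) * fst p\<rfloor> / real (Suc k) - fst p) < r" by blast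
  qed
  then show "(\<lambda>k. ?g k p) \<longlonglongrightarrow> mix_deriv 0 (snd p) (fst p)"
    by (rule isCont_tendsto_compose[OF mix_deriv_isCont[OF \<eta>]])
qed

end

section \<open>The posterior as a measure\<close>

text \<open>Here \<open>a\<close> and \<open>b\<close> are the normalised contributions of the central part of the parameter space to the numerator and the
denominator of the posterior, and \<open>tB\<close> and \<open>t\<close> are those of the rest.\<close>

lemma posterior_ratio_close:
  fixes a b N tB t \<kappa> :: real
  assumes k: "\<kappa> \<le> 1/2" and a: "\<bar>a - N\<bar> \<le> \<kappa>" and b: "\<bar>b - 1\<bar> \<le> \<kappa>"
    and t: "0 \<le> tB" "tB \<le> t" "t \<le> \<kappa> * (b + t)" and N: "0 \<le> N" "N \<le> 1"
  shows "\<bar>(a + tB) / (b + t) - N\<bar> \<le> 5 * \<kappa>"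
proof -
  have d: "b + t \<ge> 1/2" using k b t by linarith
  have k0: "\<kappa> \<ge> 0" using a by linarith
  have "(a + tB) - N * (b + t) = (a - N) + N * (1 - b) + (tB - N * t)" by (simp add: algebra_simps)
  moreover have "\<bar>N * (1 - b)\<bar> \<le> 1 * \<kappa>" unfolding abs_mult using N b by (intro mult_mono) auto
  moreover have "\<bar>tB - N * t\<bar> \<le> t"
  proof -
    have "0 \<le> N * t" using N t by simp
    moreover have "N * t \<le> 1 * t" using N t by (intro mult_right_mono) linarith+
    ultimately show ?thesis using t by linarith
  qed
  ultimately have "\<bar>(a + tB) - N * (b + t)\<bar> \<le> 2 * \<kappa> + t" using a by linarith
  moreover have "2 * \<kappa> \<le> 4 * \<kappa> * (b + t)" using mult_left_mono[OF d, of "4 * \<kappa>"] k0 by simp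
  ultimately have "\<bar>(a + tB) - N * (b + t)\<bar> \<le> 5 * \<kappa> * (b + t)" using t(3) by (simp add: algebra_simps)
  moreover have "(a + tB) / (b + t) - N = ((a + tB) - N * (b + t)) / (b + t)" using d by (simp add: field_simps)
  ultimately show ?thesis using d by (simp add: pos_divide_le_eq)
qed

locale bvm_model = mixture_box M s1 s2 for M s1 s2 :: real +
  fixes \<Theta> :: "real set" and \<theta>0 :: real and \<eta>0 :: "(real \<times> real) measure"
    and \<pi>\<Theta> :: "real measure" and \<pi>H :: "(real \<times> real) measure measure"
  assumes eta0: "\<eta>0 \<in> mixing_measures M s1 s2"
    and prior_theta: "prob_space \<pi>\<Theta>" and sets_theta: "sets \<pi>\<Theta> = sets (restrict_space borel \<Theta>)"
    and thick: "thick_at \<pi>\<Theta> \<theta>0"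
    and prior_H: "prob_space \<pi>H" and sets_H: "sets \<pi>H = sets (weak_borel M s1 s2)"
    and prior_positive: "\<And>U. U \<in> sets \<pi>H \<Longrightarrow> weak_nbhd M s1 s2 \<eta>0 U \<Longrightarrow> emeasure \<pi>H U > 0"
begin

sublocale T: prob_space \<pi>\<Theta> by (rule prior_theta)
sublocale H: prob_space \<pi>H by (rule prior_H)
sublocale prior: pair_prob_space \<pi>\<Theta> \<pi>H ..

abbreviation \<pi> where "\<pi> \<equiv> \<pi>\<Theta> \<Otimes>\<^sub>M \<pi>H"

lemma space_H: "space \<pi>H = mixing"
  using sets_eq_imp_space_eq[OF sets_H] by (simp add: space_weak_borel)

lemma space_pi_snd: "p \<in> space \<pi> \<Longrightarrow> snd p \<in> mixing"
  by (auto simp: space_pair_measure space_H)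

lemma id_theta_measurable: "(\<lambda>\<theta>. \<theta>) \<in> borel_measurable \<pi>\<Theta>"
proof -
  have "(\<lambda>\<theta>. \<theta>) \<in> borel_measurable (restrict_space borel \<Theta>)"
    by (intro measurable_restrict_space1) simp
  then show ?thesis using sets_theta by (simp cong: measurable_cong_sets)
qed

lemma fst_measurable_pi[measurable]: "fst \<in> borel_measurable \<pi>"
  by (rule measurable_compose[OF measurable_fst id_theta_measurable])

lemma snd_measurable_pi: "snd \<in> \<pi> \<rightarrow>\<^sub>M weak_borel M s1 s2"
proof -
  have "snd \<in> \<pi> \<rightarrow>\<^sub>M \<pi>H" by (rule measurable_snd)
  then show ?thesis using measurable_cong_sets[OF refl sets_H, of \<pi>] by simp
qed

lemma density_measurable:
  assumes X: "X \<in> borel_measurable N"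
  shows "(\<lambda>q. mix_deriv 0 (snd (snd q)) (X (fst q) - fst (snd q))) \<in> borel_measurable (N \<Otimes>\<^sub>M \<pi>)"
proof -
  note X[measurable] snd_measurable_pi[measurable]
  have "(\<lambda>q. (X (fst q) - fst (snd q), snd (snd q))) \<in> N \<Otimes>\<^sub>M \<pi> \<rightarrow>\<^sub>M borel \<Otimes>\<^sub>M weak_borel M s1 s2"
    by measurable
  from measurable_compose[OF this density_joint_measurable] show ?thesis by simp
qed

lemma likelihood_measurable:
  assumes "\<And>i. X i \<in> borel_measurable N"
  shows "(\<lambda>q. likelihood n (\<lambda>i. X i (fst q)) (snd q)) \<in> borel_measurable (N \<Otimes>\<^sub>M \<pi>)"
proof -
  have "(\<lambda>q. likelihood n (\<lambda>i. X i (fst q)) (snd q)) = (\<lambda>q. \<Prod>i<n. mix_deriv 0 (snd (snd q)) (X i (fst q) - fst (snd q)))"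
    by (simp add: likelihood_def loc_density_def mix_density_eq case_prod_unfold)
  then show ?thesis using density_measurable[OF assms] by simp
qed

text \<open>The likelihood divided by its value at the truth; the division does not change the posterior.\<close>

definition lik_ratio :: "nat \<Rightarrow> (nat \<Rightarrow> real) \<Rightarrow> real \<times> (real \<times> real) measure \<Rightarrow> real" where
  "lik_ratio n z p = exp (llr \<eta>0 n z (fst p - \<theta>0) (snd p))"

lemma likelihood_eq_lik_ratio:
  assumes "p \<in> space \<pi>"
  shows "likelihood n xs p = (\<Prod>i<n. mix_deriv 0 \<eta>0 (xs i - \<theta>0)) * lik_ratio n (\<lambda>i. xs i - \<theta>0) p"
proof -
  have \<eta>: "snd p \<in> mixing" using space_pi_snd[OF assms] .
  have "exp (log_density (snd p) (xs i - \<theta>0 - (fst p - \<theta>0)) - log_density \<eta>0 (xs i - \<theta>0))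
      = mix_deriv 0 (snd p) (xs i - fst p) / mix_deriv 0 \<eta>0 (xs i - \<theta>0)" for i
    using mix_deriv_pos[OF \<eta>, of "xs i - fst p"] mix_deriv_pos[OF eta0, of "xs i - \<theta>0"]
    by (simp add: log_density_def exp_diff)
  then have "lik_ratio n (\<lambda>i. xs i - \<theta>0) p = (\<Prod>i<n. mix_deriv 0 (snd p) (xs i - fst p) / mix_deriv 0 \<eta>0 (xs i - \<theta>0))"
    unfolding lik_ratio_def llr_def by (simp add: exp_sum)
  then show ?thesis
    using mix_deriv_pos[OF eta0] 
    by (simp add: likelihood_def loc_density_def mix_density_eq case_prod_unfold prod_dividef prod_zero_iff less_imp_neq[symmetric])
qed

lemma likelihood_bounded: "\<exists>D. \<forall>p\<in>space \<pi>. \<bar>likelihood n xs p\<bar> \<le> D"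
proof -
  obtain D where D: "D > 0" "\<And>\<eta> x. \<eta> \<in> mixing \<Longrightarrow> \<bar>mix_deriv 0 \<eta> x\<bar> \<le> D" using mix_deriv_bounded by blast
  have "\<bar>likelihood n xs p\<bar> \<le> D ^ n" if "p \<in> space \<pi>" for p
  proof -
    have "\<bar>likelihood n xs p\<bar> = (\<Prod>i<n. \<bar>mix_deriv 0 (snd p) (xs i - fst p)\<bar>)"
      by (simp add: likelihood_def loc_density_def mix_density_eq case_prod_unfold abs_prod)
    also have "\<dots> \<le> (\<Prod>i<n. D)" using D(2) space_pi_snd[OF that] by (intro prod_mono) auto
    finally show ?thesis by simp
  qed
  then show ?thesis by blast
qed

lemma likelihood_measurable_pi: "likelihood n xs \<in> borel_measurable \<pi>"
proof -
  have "(\<lambda>p. (0::real, p)) \<in> \<pi> \<rightarrow>\<^sub>M borel \<Otimes>\<^sub>M \<pi>" by measurable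
  from measurable_compose[OF this likelihood_measurable[of "\<lambda>i _. xs i" borel n]]
  show ?thesis by simp
qed

lemma lik_ratio_pos: "lik_ratio n z p > 0" by (simp add: lik_ratio_def)

lemma norm_const_pos: "(\<Prod>i<n. mix_deriv 0 \<eta>0 (xs i - \<theta>0)) > 0"
  using mix_deriv_pos[OF eta0] by (intro prod_pos) auto

lemma lik_ratio_eq_likelihood: "p \<in> space \<pi> \<Longrightarrow> lik_ratio n z p = likelihood n (\<lambda>i. z i + \<theta>0) p / (\<Prod>i<n. mix_deriv 0 \<eta>0 (z i))"
proof -
  assume p: "p \<in> space \<pi>"
  have "(\<Prod>i<n. mix_deriv 0 \<eta>0 (z i)) > 0" using norm_const_pos[of "\<lambda>i. z i + \<theta>0" n] by simp
  then have c: "(\<Prod>i<n. mix_deriv 0 \<eta>0 (z i)) \<noteq> 0" by linarith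
  have "likelihood n (\<lambda>i. z i + \<theta>0) p = (\<Prod>i<n. mix_deriv 0 \<eta>0 (z i)) * lik_ratio n z p"
    using likelihood_eq_lik_ratio[OF p, of n "\<lambda>i. z i + \<theta>0"] by simp
  then show ?thesis using nonzero_mult_div_cancel_left[OF c, of "lik_ratio n z p"] by (simp only:)
qed

lemma lik_ratio_measurable[measurable]: "lik_ratio n z \<in> borel_measurable \<pi>"
  using likelihood_measurable_pi[of n "\<lambda>i. z i + \<theta>0"] by (subst measurable_cong[OF lik_ratio_eq_likelihood]) auto

lemma lik_ratio_integrable: "integrable \<pi> (lik_ratio n z)"
proof -
  obtain D where D: "\<And>p. p \<in> space \<pi> \<Longrightarrow> \<bar>likelihood n (\<lambda>i. z i + \<theta>0) p\<bar> \<le> D" using likelihood_bounded by blast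
  show ?thesis
  proof (rule prior.integrable_const_bound[of _ "D / (\<Prod>i<n. mix_deriv 0 \<eta>0 (z i))"])
    show "AE p in \<pi>. norm (lik_ratio n z p) \<le> D / (\<Prod>i<n. mix_deriv 0 \<eta>0 (z i))"
    proof (rule AE_I2)
      fix p assume p: "p \<in> space \<pi>"
      have "(\<Prod>i<n. mix_deriv 0 \<eta>0 (z i)) > 0" using norm_const_pos[of "\<lambda>i. z i + \<theta>0" n] by simp
      then show "norm (lik_ratio n z p) \<le> D / (\<Prod>i<n. mix_deriv 0 \<eta>0 (z i))"
        unfolding lik_ratio_eq_likelihood[OF p] real_norm_def abs_divide using D[OF p] by (simp add: divide_right_mono)
    qed
  qed simp
qed

lemma lik_ratio_indicator_integrable: "f \<in> borel_measurable \<pi> \<Longrightarrow> (\<And>p. \<bar>f p\<bar> \<le> 1) \<Longrightarrow> integrable \<pi> (\<lambda>p. f p * lik_ratio n z p)"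
  by (rule Bochner_Integration.integrable_bound[OF lik_ratio_integrable[of n z]])
    (auto simp: abs_mult intro!: mult_left_le_one_le less_imp_le[OF lik_ratio_pos] AE_I2 simp: lik_ratio_pos)

lemma lik_ratio_integral_pos: "(LINT p|\<pi>. lik_ratio n z p) > 0"
proof -
  have "(LINT p|\<pi>. lik_ratio n z p) \<noteq> 0"
  proof
    assume "(LINT p|\<pi>. lik_ratio n z p) = 0"
    then have "AE p in \<pi>. lik_ratio n z p = 0"
      using integral_nonneg_eq_0_iff_AE[OF lik_ratio_integrable[of n z]] lik_ratio_pos by (simp add: less_imp_le)
    then have "AE p in \<pi>. False" by eventually_elim (use lik_ratio_pos in \<open>auto simp: less_le\<close>)
    then show False by simp
  qed
  moreover have "(LINT p|\<pi>. lik_ratio n z p) \<ge> 0" using lik_ratio_pos by (intro Bochner_Integration.integral_nonneg) (simp add: less_imp_le)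
  ultimately show ?thesis by simp
qed

definition loc_event :: "nat \<Rightarrow> real set \<Rightarrow> (real \<times> (real \<times> real) measure) set" where
  "loc_event n B = {p \<in> space \<pi>. sqrt (real n) * (fst p - \<theta>0) \<in> B}"

lemma loc_event_sets[measurable]: "B \<in> sets borel \<Longrightarrow> loc_event n B \<in> sets \<pi>"
proof -
  assume B: "B \<in> sets borel"
  have "(\<lambda>p. sqrt (real n) * (fst p - \<theta>0)) -` B \<inter> space \<pi> \<in> sets \<pi>"
    by (rule measurable_sets[OF _ B]) measurable
  moreover have "(\<lambda>p. sqrt (real n) * (fst p - \<theta>0)) -` B \<inter> space \<pi> = loc_event n B"
    by (auto simp: loc_event_def)
  ultimately show ?thesis by simp
qed

lemma posterior_lik_ratio:
  "posterior \<pi> n xs (loc_event n B) =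
    (LINT p|\<pi>. indicator (loc_event n B) p * lik_ratio n (\<lambda>i. xs i - \<theta>0) p) / (LINT p|\<pi>. lik_ratio n (\<lambda>i. xs i - \<theta>0) p)"
proof -
  let ?c = "\<Prod>i<n. mix_deriv 0 \<eta>0 (xs i - \<theta>0)"
  have c: "?c \<noteq> 0" using norm_const_pos[of xs n] by linarith
  have "(LINT p|\<pi>. likelihood n xs p) = (LINT p|\<pi>. ?c * lik_ratio n (\<lambda>i. xs i - \<theta>0) p)"
    by (intro Bochner_Integration.integral_cong refl likelihood_eq_lik_ratio)
  moreover have "(LINT p:loc_event n B|\<pi>. likelihood n xs p) =
      (LINT p|\<pi>. ?c * (indicator (loc_event n B) p * lik_ratio n (\<lambda>i. xs i - \<theta>0) p))"
    unfolding set_lebesgue_integral_def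
    by (intro Bochner_Integration.integral_cong refl) (simp add: likelihood_eq_lik_ratio)
  ultimately show ?thesis unfolding posterior_def using c by simp
qed

text \<open>The posterior distribution of \<open>sqrt n * (\<theta> - \<theta>0)\<close> as a measure on the line.\<close>

definition post_measure :: "nat \<Rightarrow> (nat \<Rightarrow> real) \<Rightarrow> real measure" where
  "post_measure n xs = distr (density \<pi> (\<lambda>p. ennreal (lik_ratio n (\<lambda>i. xs i - \<theta>0) p / (LINT p|\<pi>. lik_ratio n (\<lambda>i. xs i - \<theta>0) p))))
     borel (\<lambda>p. sqrt (real n) * (fst p - \<theta>0))"

lemma post_measure:
  shows "prob_space (post_measure n xs)" "sets (post_measure n xs) = sets borel"
    and "B \<in> sets borel \<Longrightarrow> measure (post_measure n xs) B = posterior \<pi> n xs (loc_event n B)"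
proof -
  let ?z = "\<lambda>i. xs i - \<theta>0"
  let ?I = "LINT p|\<pi>. lik_ratio n ?z p"
  let ?d = "density \<pi> (\<lambda>p. ennreal (lik_ratio n ?z p / ?I))"
  have em: "emeasure ?d A = ennreal ((LINT p|\<pi>. indicator A p * lik_ratio n ?z p) / ?I)" if A: "A \<in> sets \<pi>" for A
  proof -
    have i: "integrable \<pi> (\<lambda>p. indicator A p * lik_ratio n ?z p / ?I)"
      using A by (intro integrable_divide lik_ratio_indicator_integrable) (auto simp: indicator_def)
    have "emeasure ?d A = (\<integral>\<^sup>+p. ennreal (indicator A p * lik_ratio n ?z p / ?I) \<partial>\<pi>)"
      using A by (subst emeasure_density) (auto intro!: nn_integral_cong simp: indicator_def)
    also have "\<dots> = ennreal (LINT p|\<pi>. indicator A p * lik_ratio n ?z p / ?I)"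
      using lik_ratio_integral_pos[of n ?z] lik_ratio_pos by (intro nn_integral_eq_integral i) (auto simp: less_imp_le)
    finally show ?thesis by simp
  qed
  have m: "(\<lambda>p. sqrt (real n) * (fst p - \<theta>0)) \<in> borel_measurable ?d" by measurable
  have "emeasure ?d (space ?d) = ennreal ((LINT p|\<pi>. indicator (space \<pi>) p * lik_ratio n ?z p) / ?I)" using em[of "space \<pi>"] by simp
  also have "(LINT p|\<pi>. indicator (space \<pi>) p * lik_ratio n ?z p) = ?I"
    by (intro Bochner_Integration.integral_cong) auto
  finally have "prob_space ?d" using lik_ratio_integral_pos[of n ?z] by (intro prob_spaceI) simp
  then show "prob_space (post_measure n xs)"
    unfolding post_measure_def using m by (rule prob_space.prob_space_distr)
  show "sets (post_measure n xs) = sets borel" by (simp add: post_measure_def)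
  show "measure (post_measure n xs) B = posterior \<pi> n xs (loc_event n B)" if B: "B \<in> sets borel"
  proof -
    have vi: "(\<lambda>p. sqrt (real n) * (fst p - \<theta>0)) -` B \<inter> space \<pi> = loc_event n B" by (auto simp: loc_event_def)
    have "emeasure (post_measure n xs) B = emeasure ?d (loc_event n B)"
      unfolding post_measure_def using m B by (subst emeasure_distr) (auto simp: vi)
    also have "\<dots> = ennreal (posterior \<pi> n xs (loc_event n B))"
      unfolding posterior_lik_ratio using em[OF loc_event_sets[OF B]] by simp
    finally have e: "emeasure (post_measure n xs) B = ennreal (posterior \<pi> n xs (loc_event n B))" .
    have "posterior \<pi> n xs (loc_event n B) \<ge> 0"
      unfolding posterior_lik_ratio using lik_ratio_integral_pos[of n ?z] lik_ratio_pos
      by (intro divide_nonneg_pos Bochner_Integration.integral_nonneg) (auto simp: less_imp_le)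
    then show ?thesis unfolding measure_def e by (rule enn2real_ennreal)
  qed
qed

lemma prior_interval_integral:
  assumes V: "open V" "V \<subseteq> space \<pi>\<Theta>" "continuous_on V f" "\<And>x. x \<in> V \<Longrightarrow> f x > (0::real)"
    and dens: "\<And>A. A \<in> sets borel \<Longrightarrow> A \<subseteq> V \<Longrightarrow> emeasure \<pi>\<Theta> A = (\<integral>\<^sup>+x\<in>A. ennreal (f x) \<partial>lborel)"
    and K: "K \<in> sets borel" "K \<subseteq> V" and g: "g \<in> borel_measurable borel"
  shows "(LINT \<theta>|\<pi>\<Theta>. indicator K \<theta> * g \<theta>) = (LINT \<theta>|lborel. indicator K \<theta> * f \<theta> * g \<theta>)"
proof -
  have fK: "(\<lambda>x. indicator K x *\<^sub>R f x) \<in> borel_measurable borel"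
    by (rule borel_measurable_continuous_on_indicator[OF K(1) continuous_on_subset[OF V(3) K(2)]])
  then have fK': "(\<lambda>x. indicator K x * f x) \<in> borel_measurable borel" by simp
  note g[measurable] fK'[measurable] K(1)[measurable]
  let ?P = "distr \<pi>\<Theta> borel (\<lambda>\<theta>. \<theta>)"
  have eq: "density ?P (\<lambda>x. ennreal (indicator K x)) = density lborel (\<lambda>x. ennreal (indicator K x * f x))"
  proof (rule measure_eqI)
    fix A :: "real set" assume "A \<in> sets (density ?P (\<lambda>x. ennreal (indicator K x)))"
    then have A[measurable]: "A \<in> sets borel" by simp
    have "emeasure (density ?P (\<lambda>x. ennreal (indicator K x))) A = (\<integral>\<^sup>+x. ennreal (indicator K x) * indicator A x \<partial>?P)"
      by (rule emeasure_density) auto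
    also have "\<dots> = (\<integral>\<^sup>+x. indicator (K \<inter> A) x \<partial>?P)"
      by (rule nn_integral_cong) (auto simp: indicator_def)
    also have "\<dots> = emeasure ?P (K \<inter> A)" by (rule nn_integral_indicator) simp
    also have "\<dots> = emeasure \<pi>\<Theta> (K \<inter> A)"
      using id_theta_measurable K V by (subst emeasure_distr) (auto intro!: arg_cong[where f="emeasure \<pi>\<Theta>"])
    also have "\<dots> = (\<integral>\<^sup>+x\<in>K \<inter> A. ennreal (f x) \<partial>lborel)" using K by (intro dens) auto
    also have "\<dots> = (\<integral>\<^sup>+x. ennreal (indicator K x * f x) * indicator A x \<partial>lborel)"
      by (intro nn_integral_cong) (auto simp: indicator_def)
    also have "\<dots> = emeasure (density lborel (\<lambda>x. ennreal (indicator K x * f x))) A"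
      by (subst emeasure_density) auto
    finally show "emeasure (density ?P (\<lambda>x. ennreal (indicator K x))) A = emeasure (density lborel (\<lambda>x. ennreal (indicator K x * f x))) A" .
  qed simp
  have "(LINT \<theta>|\<pi>\<Theta>. indicator K \<theta> * g \<theta>) = (LINT \<theta>|?P. indicator K \<theta> * g \<theta>)"
    using id_theta_measurable by (subst integral_distr) auto
  also have "\<dots> = (LINT \<theta>|density ?P (\<lambda>x. ennreal (indicator K x)). g \<theta>)"
    by (subst integral_density) auto
  also have "\<dots> = (LINT \<theta>|lborel. (indicator K \<theta> * f \<theta>) *\<^sub>R g \<theta>)"
    unfolding eq
  proof (rule integral_density)
    show "AE x in lborel. 0 \<le> indicator K x * f x"
      using V(4) K(2) by (intro AE_I2) (auto simp: indicator_def intro: less_imp_le)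
  qed measurable
  also have "\<dots> = (LINT \<theta>|lborel. indicator K \<theta> * f \<theta> * g \<theta>)" by simp
  finally show ?thesis .
qed

end

section \<open>Posterior mass close to the truth and away from it\<close>

context bvm_model begin

text \<open>The data of the thickness condition: near the true location the prior has the continuous positive density \<open>f\<close>.\<close>

definition prior_nbhd :: "real set \<Rightarrow> (real \<Rightarrow> real) \<Rightarrow> bool" where
  "prior_nbhd V f \<longleftrightarrow> open V \<and> \<theta>0 \<in> V \<and> V \<subseteq> space \<pi>\<Theta> \<and> continuous_on V f \<and> (\<forall>x\<in>V. f x > 0) \<and>
     (\<forall>A\<in>sets borel. A \<subseteq> V \<longrightarrow> emeasure \<pi>\<Theta> A = (\<integral>\<^sup>+x\<in>A. ennreal (f x) \<partial>lborel))"

lemma prior_nbhd_exists: "\<exists>V f. prior_nbhd V f"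
  using thick unfolding thick_at_def prior_nbhd_def by blast

lemma prior_nbhd_interval: "prior_nbhd V f \<Longrightarrow> \<exists>d>0. {\<theta>0 - d..\<theta>0 + d} \<subseteq> V"
proof -
  assume "prior_nbhd V f"
  then obtain d where d: "d > 0" "cball \<theta>0 d \<subseteq> V" unfolding prior_nbhd_def by (meson open_contains_cball)
  then show ?thesis by (auto simp: cball_eq_atLeastAtMost)
qed

lemma borel_sets_theta:
  assumes "K \<in> sets borel" "K \<subseteq> space \<pi>\<Theta>"
  shows "K \<in> sets \<pi>\<Theta>"
proof -
  have "(\<lambda>\<theta>. \<theta>) -` K \<inter> space \<pi>\<Theta> \<in> sets \<pi>\<Theta>"
    by (rule measurable_sets[OF id_theta_measurable assms(1)])
  moreover have "(\<lambda>\<theta>. \<theta>) -` K \<inter> space \<pi>\<Theta> = K" using assms(2) by auto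
  ultimately show ?thesis by simp
qed

lemma prior_interval_pos:
  assumes "prior_nbhd V f" "d > 0" "{\<theta>0 - d..\<theta>0 + d} \<subseteq> V"
  shows "emeasure \<pi>\<Theta> {\<theta>0 - d..\<theta>0 + d} > 0"
proof -
  let ?K = "{\<theta>0 - d..\<theta>0 + d}"
  have "emeasure \<pi>\<Theta> ?K \<noteq> 0"
  proof
    assume z: "emeasure \<pi>\<Theta> ?K = 0"
    have fK: "(\<lambda>x. indicator ?K x *\<^sub>R f x) \<in> borel_measurable borel"
      by (rule borel_measurable_continuous_on_indicator)
        (use assms in \<open>auto simp: prior_nbhd_def intro: continuous_on_subset\<close>)
    have "(\<integral>\<^sup>+x. ennreal (indicator ?K x *\<^sub>R f x) \<partial>lborel) = (\<integral>\<^sup>+x\<in>?K. ennreal (f x) \<partial>lborel)"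
      by (intro nn_integral_cong) (auto simp: indicator_def)
    also have "\<dots> = emeasure \<pi>\<Theta> ?K" using assms unfolding prior_nbhd_def by auto
    finally have "(\<integral>\<^sup>+x. ennreal (indicator ?K x *\<^sub>R f x) \<partial>lborel) = 0" using z by simp
    then have "AE x in lborel. ennreal (indicator ?K x *\<^sub>R f x) = 0"
      by (subst (asm) nn_integral_0_iff_AE) (use fK in measurable)
    then have "AE x in lborel. x \<notin> ?K"
      by eventually_elim (use assms in \<open>auto simp: prior_nbhd_def indicator_def ennreal_eq_0_iff not_le[symmetric] split: if_splits\<close>)
    then have "emeasure lborel {x \<in> space lborel. x \<in> ?K} = 0" by (rule emeasure_eq_0_AE)
    moreover have "{x \<in> space lborel. x \<in> ?K} = ?K" by auto
    ultimately show False using assms(2) by simp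
  qed
  then show ?thesis by (simp add: zero_less_iff_neq_zero)
qed

lemma density_nbhd_H_sets: "finite G \<Longrightarrow> density_nbhd \<eta>0 G e \<in> sets \<pi>H"
  using density_nbhd_sets sets_H by simp

lemma density_nbhd_H_pos: "finite G \<Longrightarrow> e > 0 \<Longrightarrow> emeasure \<pi>H (density_nbhd \<eta>0 G e) > 0"
  by (intro prior_positive density_nbhd_H_sets density_nbhd_weak_nbhd eta0)

text \<open>On a neighbourhood of the truth the log-likelihood ratio is at least \<open>- c * n\<close>, and the prior mass of this neighbourhood is positive.\<close>

lemma evidence_lower_bound:
  assumes c: "c > 0" and v: "v \<ge> 0"
  shows "\<exists>m>0. \<forall>n z t \<rho>. controlled \<eta>0 n z t v \<rho> \<longrightarrow> (LINT p|\<pi>. lik_ratio n z p) \<ge> m * exp (- c * n)"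
proof -
  define r where "r = c / (v + 1)"
  have r: "r > 0" "r * v \<le> c" using c v by (auto simp: r_def field_simps)
  obtain e where e: "e > 0" and loc: "locally_at \<eta>0 (\<lambda>\<eta>. log_close \<eta>0 r e \<eta>)"
    using locally_at_log_close[OF eta0 r(1)] by blast
  from loc obtain G \<epsilon> where G: "finite G" "\<epsilon> > 0" and close: "\<And>\<eta>. \<eta> \<in> density_nbhd \<eta>0 G \<epsilon> \<Longrightarrow> log_close \<eta>0 r e \<eta>"
    unfolding locally_at_def by blast
  obtain V f where Vf: "prior_nbhd V f" using prior_nbhd_exists by blast
  obtain d0 where d0: "d0 > 0" "{\<theta>0 - d0..\<theta>0 + d0} \<subseteq> V" using prior_nbhd_interval[OF Vf] by blast
  define d where "d = min d0 e"
  have d: "d > 0" "d \<le> e" "{\<theta>0 - d..\<theta>0 + d} \<subseteq> {\<theta>0 - d0..\<theta>0 + d0}" using d0 e by (auto simp: d_def)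
  then have d: "d > 0" "d \<le> e" "{\<theta>0 - d..\<theta>0 + d} \<subseteq> V" using d0(2) by auto
  let ?K = "{\<theta>0 - d..\<theta>0 + d}" and ?U = "density_nbhd \<eta>0 G \<epsilon>"
  have Ks: "?K \<in> sets \<pi>\<Theta>" using d Vf by (intro borel_sets_theta) (auto simp: prior_nbhd_def)
  note Us = density_nbhd_H_sets[OF G(1)]
  define m where "m = measure \<pi> (?K \<times> ?U)"
  have "emeasure \<pi> (?K \<times> ?U) = emeasure \<pi>\<Theta> ?K * emeasure \<pi>H ?U"
    by (rule H.emeasure_pair_measure_Times[OF Ks Us])
  also have "\<dots> > 0" using prior_interval_pos[OF Vf d(1,3)] density_nbhd_H_pos[OF G] by (simp add: ennreal_zero_less_mult_iff)
  finally have m: "m > 0" unfolding m_def by (simp add: prior.emeasure_eq_measure)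
  have "(LINT p|\<pi>. lik_ratio n z p) \<ge> m * exp (- c * n)" if co: "controlled \<eta>0 n z t v \<rho>" for n z t \<rho>
  proof -
    have KU: "?K \<times> ?U \<in> sets \<pi>" using Ks Us by auto
    have "m * exp (- c * n) = (LINT p|\<pi>. exp (- c * n) * indicator (?K \<times> ?U) p)"
      using KU by (simp add: m_def)
    also have "\<dots> \<le> (LINT p|\<pi>. lik_ratio n z p)"
    proof (rule integral_mono[OF _ lik_ratio_integrable])
      show "integrable \<pi> (\<lambda>p. exp (- c * n) * indicator (?K \<times> ?U) p)"
        using KU by (intro integrable_mult_right integrable_real_indicator) (auto simp: prior.emeasure_eq_measure)
      fix p assume "p \<in> space \<pi>"
      show "exp (- c * n) * indicator (?K \<times> ?U) p \<le> lik_ratio n z p"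
      proof (cases "p \<in> ?K \<times> ?U")
        case True
        then have "\<bar>fst p - \<theta>0\<bar> \<le> e" "snd p \<in> ?U" using d by auto
        then have "\<bar>llr \<eta>0 n z (fst p - \<theta>0) (snd p)\<bar> \<le> r * v * n"
          using r by (intro llr_small[OF co]) (auto intro: close)
        also have "\<dots> \<le> c * n" using r(2) by (intro mult_right_mono) auto
        finally show ?thesis using True by (simp add: lik_ratio_def)
      qed (use lik_ratio_pos[of n z p] in simp)
    qed
    finally show ?thesis .
  qed
  with m show ?thesis by blast
qed

text \<open>The conditional posterior density of \<open>h\<close> for a fixed \<open>\<eta>\<close>, restricted to \<open>\<bar>\<theta> - \<theta>0\<bar> \<le> d\<close> and normalised to the value \<open>1\<close> at \<open>h = 0\<close>.\<close>

definition fibre_density :: "(real \<Rightarrow> real) \<Rightarrow> real \<Rightarrow> nat \<Rightarrow> (nat \<Rightarrow> real) \<Rightarrow> (real \<times> real) measure \<Rightarrow> real \<Rightarrow> real" where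
  "fibre_density f d n z \<eta> h = indicator {h. \<bar>h\<bar> \<le> sqrt n * d} h * (f (\<theta>0 + h / sqrt n) / f \<theta>0) *
     exp (llr \<eta>0 n z (h / sqrt n) \<eta> - llr \<eta>0 n z 0 \<eta>)"

lemma llr_measurable_location: "\<eta> \<in> mixing \<Longrightarrow> (\<lambda>u. llr \<eta>0 n z u \<eta>) \<in> borel_measurable borel"
proof -
  assume \<eta>: "\<eta> \<in> mixing"
  note [measurable] = log_measurable(1)[OF \<eta>] log_measurable(1)[OF eta0]
  show ?thesis unfolding llr_def by measurable
qed

lemma fibre_density_measurable:
  assumes Vf: "prior_nbhd V f" and d: "{\<theta>0 - d..\<theta>0 + d} \<subseteq> V" and n: "n > 0" and \<eta>: "\<eta> \<in> mixing"
  shows "fibre_density f d n z \<eta> \<in> borel_measurable borel"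
proof -
  have fK: "(\<lambda>x. indicator {\<theta>0 - d..\<theta>0 + d} x *\<^sub>R f x) \<in> borel_measurable borel"
    by (rule borel_measurable_continuous_on_indicator)
      (use Vf d in \<open>auto simp: prior_nbhd_def intro: continuous_on_subset\<close>)
  define F where "F x = indicator {\<theta>0 - d..\<theta>0 + d} x *\<^sub>R f x" for x
  have [measurable]: "F \<in> borel_measurable borel" unfolding F_def[abs_def] by (rule fK)
  note [measurable] = llr_measurable_location[OF \<eta>]
  have "fibre_density f d n z \<eta> = (\<lambda>h. indicator {\<theta>0 - d..\<theta>0 + d} (\<theta>0 + h / sqrt n) *\<^sub>R f (\<theta>0 + h / sqrt n) / f \<theta>0 *
     exp (llr \<eta>0 n z (h / sqrt n) \<eta> - llr \<eta>0 n z 0 \<eta>))"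
  proof
    fix h
    have "\<bar>h\<bar> \<le> sqrt n * d \<longleftrightarrow> \<theta>0 + h / sqrt n \<in> {\<theta>0 - d..\<theta>0 + d}"
      using n by (auto simp: field_simps abs_le_iff)
    then show "fibre_density f d n z \<eta> h = indicator {\<theta>0 - d..\<theta>0 + d} (\<theta>0 + h / sqrt n) *\<^sub>R f (\<theta>0 + h / sqrt n) / f \<theta>0 *
     exp (llr \<eta>0 n z (h / sqrt n) \<eta> - llr \<eta>0 n z 0 \<eta>)"
      by (simp add: fibre_density_def indicator_def)
  qed
  then have "fibre_density f d n z \<eta> = (\<lambda>h. F (\<theta>0 + h / sqrt n) / f \<theta>0 *
     exp (llr \<eta>0 n z (h / sqrt n) \<eta> - llr \<eta>0 n z 0 \<eta>))" by (simp only: F_def)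
  moreover have "(\<lambda>h. F (\<theta>0 + h / sqrt n) / f \<theta>0 *
     exp (llr \<eta>0 n z (h / sqrt n) \<eta> - llr \<eta>0 n z 0 \<eta>)) \<in> borel_measurable borel" by measurable
  ultimately show ?thesis by simp
qed

lemma fibre_integral:
  assumes Vf: "prior_nbhd V f" and d: "{\<theta>0 - d..\<theta>0 + d} \<subseteq> V" and n: "n > 0" and \<eta>: "\<eta> \<in> mixing"
    and B: "B \<in> sets borel"
  shows "(LINT \<theta>|\<pi>\<Theta>. indicator {\<theta>0 - d..\<theta>0 + d} \<theta> * (indicator B (sqrt n * (\<theta> - \<theta>0)) * exp (llr \<eta>0 n z (\<theta> - \<theta>0) \<eta>)))
    = f \<theta>0 / sqrt n * (exp (llr \<eta>0 n z 0 \<eta>) * (LINT h|lborel. indicator B h * fibre_density f d n z \<eta> h))"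
proof -
  let ?K = "{\<theta>0 - d..\<theta>0 + d}"
  let ?g = "\<lambda>\<theta>. indicator B (sqrt n * (\<theta> - \<theta>0)) * exp (llr \<eta>0 n z (\<theta> - \<theta>0) \<eta>)"
  have f0: "f \<theta>0 > 0" using Vf by (auto simp: prior_nbhd_def)
  note B[measurable] llr_measurable_location[OF \<eta>, measurable]
  have "(LINT \<theta>|\<pi>\<Theta>. indicator ?K \<theta> * ?g \<theta>) = (LINT \<theta>|lborel. indicator ?K \<theta> * f \<theta> * ?g \<theta>)"
    by (rule prior_interval_integral[of V]) (use Vf d in \<open>auto simp: prior_nbhd_def\<close>)
  also have "\<dots> = \<bar>1 / sqrt n\<bar> *\<^sub>R (LINT h|lborel. indicator ?K (\<theta>0 + 1 / sqrt n * h) * f (\<theta>0 + 1 / sqrt n * h) * ?g (\<theta>0 + 1 / sqrt n * h))"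
    by (rule lborel_integral_real_affine) (use n in simp)
  also have "\<dots> = \<bar>1 / sqrt n\<bar> *\<^sub>R (LINT h|lborel. f \<theta>0 * exp (llr \<eta>0 n z 0 \<eta>) * (indicator B h * fibre_density f d n z \<eta> h))"
  proof (intro arg_cong2[where f="(*\<^sub>R)"] refl Bochner_Integration.integral_cong)
    fix h
    have "\<bar>h\<bar> \<le> sqrt n * d \<longleftrightarrow> \<theta>0 + 1 / sqrt n * h \<in> ?K"
      using n by (auto simp: field_simps abs_le_iff)
    moreover have "sqrt n * (\<theta>0 + 1 / sqrt n * h - \<theta>0) = h" using n by simp
    ultimately show "indicator ?K (\<theta>0 + 1 / sqrt n * h) * f (\<theta>0 + 1 / sqrt n * h) * ?g (\<theta>0 + 1 / sqrt n * h)
      = f \<theta>0 * exp (llr \<eta>0 n z 0 \<eta>) * (indicator B h * fibre_density f d n z \<eta> h)"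
      using f0 by (simp add: fibre_density_def indicator_def exp_diff)
  qed
  finally show ?thesis by simp
qed

lemma fibre_density_bounds:
  assumes \<eta>: "\<eta> \<in> mixing" and \<rho>: "\<rho> > 0" and c: "controlled \<eta>0 n z t v \<rho>" and n: "n > 0"
    and close: "log_close \<eta>0 \<rho> d \<eta>"
    and \<delta>: "\<rho> * t \<le> \<delta>" "\<rho> * (v + 1) / 2 \<le> \<delta>"
    and f: "\<And>\<theta>. \<bar>\<theta> - \<theta>0\<bar> \<le> d \<Longrightarrow> \<bar>f \<theta> / f \<theta>0 - 1\<bar> \<le> \<delta> \<and> f \<theta> / f \<theta>0 \<ge> 0"
    and h: "\<bar>h\<bar> \<le> sqrt n * d"
  defines "S \<equiv> - (\<Sum>i<n. log_slope \<eta>0 (z i)) / sqrt n"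
  shows "(1 - \<delta>) * exp (h * S - h\<^sup>2 * info \<eta>0 / 2 - \<delta> * (\<bar>h\<bar> + h\<^sup>2)) \<le> fibre_density f d n z \<eta> h \<and>
    fibre_density f d n z \<eta> h \<le> (1 + \<delta>) * exp (h * S - h\<^sup>2 * info \<eta>0 / 2 + \<delta> * (\<bar>h\<bar> + h\<^sup>2))"
proof -
  define u where "u = h / sqrt n"
  have sn: "sqrt n > 0" using n by simp
  have u: "\<bar>u\<bar> \<le> d" using h sn by (simp add: u_def field_simps)
  have hu: "sqrt n * \<bar>u\<bar> = \<bar>h\<bar>" using sn by (simp add: u_def)
  have "(sqrt n * u)\<^sup>2 = h\<^sup>2" using sn by (simp add: u_def)
  then have hu2: "n * u\<^sup>2 = h\<^sup>2" by (simp add: power_mult_distrib)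
  have uS: "- u * (\<Sum>i<n. log_slope \<eta>0 (z i)) = h * S" by (simp add: u_def S_def)
  have uI: "u\<^sup>2 * n * info \<eta>0 / 2 = h\<^sup>2 * info \<eta>0 / 2" using hu2 by (simp add: mult.commute)
  define \<Lambda> where "\<Lambda> = llr \<eta>0 n z u \<eta> - llr \<eta>0 n z 0 \<eta>"
  have "\<bar>\<Lambda> - (h * S - h\<^sup>2 * info \<eta>0 / 2)\<bar> \<le> \<rho> * t * \<bar>h\<bar> + \<rho> * (v + 1) / 2 * h\<^sup>2"
    using llr_local_expansion[OF eta0 \<eta> \<rho> c close u] unfolding uS uI hu hu2 \<Lambda>_def .
  also have "\<dots> \<le> \<delta> * \<bar>h\<bar> + \<delta> * h\<^sup>2" using \<delta> by (intro add_mono mult_right_mono) auto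
  finally have L: "\<bar>\<Lambda> - (h * S - h\<^sup>2 * info \<eta>0 / 2)\<bar> \<le> \<delta> * (\<bar>h\<bar> + h\<^sup>2)" by (simp add: distrib_left)
  define \<phi> where "\<phi> = f (\<theta>0 + u) / f \<theta>0"
  have \<phi>: "1 - \<delta> \<le> \<phi>" "\<phi> \<le> 1 + \<delta>" "\<phi> \<ge> 0"
    using f[of "\<theta>0 + u"] u by (auto simp: \<phi>_def abs_le_iff)
  have eq: "fibre_density f d n z \<eta> h = \<phi> * exp \<Lambda>"
    using h by (simp add: fibre_density_def \<phi>_def \<Lambda>_def u_def)
  have "(1 - \<delta>) * exp (h * S - h\<^sup>2 * info \<eta>0 / 2 - \<delta> * (\<bar>h\<bar> + h\<^sup>2)) \<le> \<phi> * exp (h * S - h\<^sup>2 * info \<eta>0 / 2 - \<delta> * (\<bar>h\<bar> + h\<^sup>2))"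
    using \<phi> by (intro mult_right_mono) auto
  also have "\<dots> \<le> \<phi> * exp \<Lambda>" using \<phi>(3) L by (intro mult_left_mono) auto
  finally have lo: "(1 - \<delta>) * exp (h * S - h\<^sup>2 * info \<eta>0 / 2 - \<delta> * (\<bar>h\<bar> + h\<^sup>2)) \<le> \<phi> * exp \<Lambda>" .
  have "\<phi> * exp \<Lambda> \<le> (1 + \<delta>) * exp (h * S - h\<^sup>2 * info \<eta>0 / 2 + \<delta> * (\<bar>h\<bar> + h\<^sup>2))"
    using \<phi> L by (intro mult_mono) auto
  with lo show ?thesis unfolding eq by blast
qed

definition central :: "real \<Rightarrow> (real \<times> real) measure set \<Rightarrow> real \<times> (real \<times> real) measure \<Rightarrow> real" where
  "central d U p = indicator {\<theta>0 - d..\<theta>0 + d} (fst p) * indicator U (snd p)"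

lemma central_measurable: "U \<in> sets \<pi>H \<Longrightarrow> central d U \<in> borel_measurable \<pi>"
proof -
  assume U: "U \<in> sets \<pi>H"
  have "(\<lambda>p. indicator U (snd p) :: real) \<in> borel_measurable \<pi>"
    by (rule measurable_compose[OF measurable_snd borel_measurable_indicator[OF U]])
  then show ?thesis unfolding central_def[abs_def] by measurable
qed

text \<open>Fubini with the location as the inner variable: the central part of the posterior is an average over the mixing measures of fibre integrals,
with weights \<open>exp (llr \<eta>0 n z 0 \<eta>)\<close>.\<close>

lemma central_mass:
  assumes Vf: "prior_nbhd V f" and d: "{\<theta>0 - d..\<theta>0 + d} \<subseteq> V" and n: "n > 0" and U: "U \<in> sets \<pi>H" and B: "B \<in> sets borel"
  shows "integrable \<pi>H (\<lambda>\<eta>. indicator U \<eta> * (f \<theta>0 / sqrt n * (exp (llr \<eta>0 n z 0 \<eta>) * (LINT h|lborel. indicator B h * fibre_density f d n z \<eta> h))))"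
    and "(LINT p|\<pi>. (indicator (loc_event n B) p * central d U p) * lik_ratio n z p)
     = (LINT \<eta>|\<pi>H. indicator U \<eta> * (f \<theta>0 / sqrt n * (exp (llr \<eta>0 n z 0 \<eta>) * (LINT h|lborel. indicator B h * fibre_density f d n z \<eta> h))))"
proof -
  let ?F = "\<lambda>\<theta> \<eta>. (indicator (loc_event n B) (\<theta>, \<eta>) * central d U (\<theta>, \<eta>)) * lik_ratio n z (\<theta>, \<eta>)"
  have "integrable \<pi> (\<lambda>p. (indicator (loc_event n B) p * central d U p) * lik_ratio n z p)"
  proof (rule lik_ratio_indicator_integrable)
    show "(\<lambda>p. indicator (loc_event n B) p * central d U p) \<in> borel_measurable \<pi>"
      by (intro borel_measurable_times borel_measurable_indicator central_measurable[OF U] loc_event_sets[OF B])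
  qed (auto simp: central_def indicator_def)
  then have int: "integrable \<pi> (case_prod ?F)" by (simp add: case_prod_unfold)
  have inner: "(LINT \<theta>|\<pi>\<Theta>. ?F \<theta> \<eta>) = indicator U \<eta> * (f \<theta>0 / sqrt n * (exp (llr \<eta>0 n z 0 \<eta>) * (LINT h|lborel. indicator B h * fibre_density f d n z \<eta> h)))"
    if \<eta>: "\<eta> \<in> space \<pi>H" for \<eta>
  proof -
    have "(LINT \<theta>|\<pi>\<Theta>. ?F \<theta> \<eta>) = (LINT \<theta>|\<pi>\<Theta>. indicator U \<eta> * (indicator {\<theta>0 - d..\<theta>0 + d} \<theta> * (indicator B (sqrt n * (\<theta> - \<theta>0)) * exp (llr \<eta>0 n z (\<theta> - \<theta>0) \<eta>))))"
      using \<eta> by (intro Bochner_Integration.integral_cong refl)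
        (auto simp: loc_event_def central_def lik_ratio_def indicator_def space_pair_measure)
    also have "\<dots> = indicator U \<eta> * (LINT \<theta>|\<pi>\<Theta>. indicator {\<theta>0 - d..\<theta>0 + d} \<theta> * (indicator B (sqrt n * (\<theta> - \<theta>0)) * exp (llr \<eta>0 n z (\<theta> - \<theta>0) \<eta>)))"
      by (rule integral_mult_right_zero)
    finally show ?thesis using fibre_integral[OF Vf d n _ B] \<eta> by (simp add: space_H)
  qed
  show "integrable \<pi>H (\<lambda>\<eta>. indicator U \<eta> * (f \<theta>0 / sqrt n * (exp (llr \<eta>0 n z 0 \<eta>) * (LINT h|lborel. indicator B h * fibre_density f d n z \<eta> h))))"
    using prior.integrable_snd[OF int] by (subst (asm) Bochner_Integration.integrable_cong[OF refl inner]) auto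
  have "(LINT p|\<pi>. (indicator (loc_event n B) p * central d U p) * lik_ratio n z p) = (LINT p|\<pi>. case_prod ?F p)"
    by (simp add: case_prod_unfold)
  also have "\<dots> = (LINT \<eta>|\<pi>H. LINT \<theta>|\<pi>\<Theta>. ?F \<theta> \<eta>)" by (rule prior.integral_snd[OF int, symmetric])
  also have "\<dots> = (LINT \<eta>|\<pi>H. indicator U \<eta> * (f \<theta>0 / sqrt n * (exp (llr \<eta>0 n z 0 \<eta>) * (LINT h|lborel. indicator B h * fibre_density f d n z \<eta> h))))"
    by (intro Bochner_Integration.integral_cong refl inner)
  finally show "(LINT p|\<pi>. (indicator (loc_event n B) p * central d U p) * lik_ratio n z p)
     = (LINT \<eta>|\<pi>H. indicator U \<eta> * (f \<theta>0 / sqrt n * (exp (llr \<eta>0 n z 0 \<eta>) * (LINT h|lborel. indicator B h * fibre_density f d n z \<eta> h))))" .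
qed

end

section \<open>Asymptotic normality for a regular sample\<close>

context bvm_model begin

lemma llr_zero_measurable: "(\<lambda>\<eta>. llr \<eta>0 n z 0 \<eta>) \<in> borel_measurable \<pi>H"
proof -
  have "(\<lambda>\<eta>. mix_deriv 0 \<eta> y) \<in> borel_measurable \<pi>H" for y
    using mix_deriv_weak_measurable measurable_cong_sets[OF sets_H refl] by blast
  note [measurable] = this
  show ?thesis unfolding llr_def log_density_def by measurable
qed

text \<open>An average of functions that are all within \<open>\<kappa>\<close> of \<open>N B\<close> is within \<open>\<kappa>\<close> of \<open>N B\<close>, whatever the weights; this is why
nothing has to be known about the posterior of \<open>\<eta>\<close> inside the neighbourhood.\<close>

lemma bvm_central:
  assumes Vf: "prior_nbhd V f" and d: "{\<theta>0 - d..\<theta>0 + d} \<subseteq> V" and n: "n > 0"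
    and U: "U \<in> sets \<pi>H" "emeasure \<pi>H U > 0"
    and bd: "\<And>\<eta>. \<eta> \<in> U \<Longrightarrow> \<bar>llr \<eta>0 n z 0 \<eta>\<bar> \<le> D"
    and c: "c > 0" and \<kappa>: "\<kappa> \<ge> 0" and N: "\<And>B. B \<in> sets borel \<Longrightarrow> 0 \<le> N B"
    and approx: "\<And>\<eta> B. \<eta> \<in> U \<Longrightarrow> B \<in> sets borel \<Longrightarrow>
       \<bar>c * (LINT h|lborel. indicator B h * fibre_density f d n z \<eta> h) - N B\<bar> \<le> \<kappa>"
  shows "\<exists>q>0. \<forall>B\<in>sets borel. \<bar>q * (LINT p|\<pi>. (indicator (loc_event n B) p * central d U p) * lik_ratio n z p) - N B\<bar> \<le> \<kappa>"
proof -
  define s where "s = f \<theta>0 / sqrt n"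
  have s: "s > 0" using Vf n by (auto simp: s_def prior_nbhd_def)
  define a where "a \<eta> = indicator U \<eta> * exp (llr \<eta>0 n z 0 \<eta>)" for \<eta>
  define J where "J B \<eta> = (LINT h|lborel. indicator B h * fibre_density f d n z \<eta> h)" for B \<eta>
  note llr_zero_measurable[measurable] U(1)[measurable]
  have am: "a \<in> borel_measurable \<pi>H" unfolding a_def[abs_def] by measurable
  have a0: "a \<eta> \<ge> 0" for \<eta> by (simp add: a_def)
  have ai: "integrable \<pi>H a"
  proof (rule H.integrable_const_bound[OF _ am])
    show "AE \<eta> in \<pi>H. norm (a \<eta>) \<le> exp D"
      using bd by (intro AE_I2) (auto simp: a_def indicator_def abs_le_iff)
  qed
  define w where "w = (LINT \<eta>|\<pi>H. a \<eta>)"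
  have "exp (- D) * measure \<pi>H U = (LINT \<eta>|\<pi>H. exp (- D) * indicator U \<eta>)" using U(1) by simp
  also have "\<dots> \<le> w" unfolding w_def
  proof (rule integral_mono[OF _ ai])
    show "integrable \<pi>H (\<lambda>\<eta>. exp (- D) * indicator U \<eta>)"
      using U(1) by (intro integrable_mult_right integrable_real_indicator) (auto simp: H.emeasure_eq_measure)
    show "exp (- D) * indicator U \<eta> \<le> a \<eta>" for \<eta>
      using bd[of \<eta>] by (auto simp: a_def indicator_def abs_le_iff)
  qed
  finally have w: "w > 0" using U(2) by (intro less_le_trans[of 0 "exp (- D) * measure \<pi>H U" w]) (auto simp: H.emeasure_eq_measure)
  \<comment> \<open>\<open>w\<close> is the total weight, and \<open>s\<close> the prior density of \<open>h\<close> at \<open>0\<close>.\<close>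
  define q where "q = c / (s * w)"
  have q: "q > 0" using c s w by (simp add: q_def)
  have "\<bar>q * (LINT p|\<pi>. (indicator (loc_event n B) p * central d U p) * lik_ratio n z p) - N B\<bar> \<le> \<kappa>" if B: "B \<in> sets borel" for B
  proof -
    note cm = central_mass[OF Vf d n U(1) B, of z, folded J_def s_def]
    have e: "indicator U \<eta> * (s * (exp (llr \<eta>0 n z 0 \<eta>) * J B \<eta>)) = s / c * (a \<eta> * (c * J B \<eta>))" for \<eta>
      using c by (simp add: a_def)
    have i1: "integrable \<pi>H (\<lambda>\<eta>. a \<eta> * (c * J B \<eta>))"
    proof -
      have "integrable \<pi>H (\<lambda>\<eta>. c / s * (s / c * (a \<eta> * (c * J B \<eta>))))"
        using cm(1) unfolding e by (rule integrable_mult_right)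
      moreover have "c / s * (s / c * x) = x" for x using c s by simp
      ultimately show ?thesis by (simp only:)
    qed
    have "q * (LINT p|\<pi>. (indicator (loc_event n B) p * central d U p) * lik_ratio n z p) = (LINT \<eta>|\<pi>H. a \<eta> * (c * J B \<eta>)) / w"
      unfolding cm(2) e integral_mult_right_zero q_def using c s by simp
    also have "\<dots> - N B = ((LINT \<eta>|\<pi>H. a \<eta> * (c * J B \<eta>)) - N B * w) / w" using w by (simp add: field_simps)
    also have "(LINT \<eta>|\<pi>H. a \<eta> * (c * J B \<eta>)) - N B * w = (LINT \<eta>|\<pi>H. a \<eta> * (c * J B \<eta> - N B))"
    proof -
      have "(LINT \<eta>|\<pi>H. a \<eta> * (c * J B \<eta> - N B)) = (LINT \<eta>|\<pi>H. a \<eta> * (c * J B \<eta>) - N B * a \<eta>)"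
        by (simp add: algebra_simps)
      then show ?thesis using i1 ai by (simp add: w_def)
    qed
    finally have eq: "q * (LINT p|\<pi>. (indicator (loc_event n B) p * central d U p) * lik_ratio n z p) - N B
       = (LINT \<eta>|\<pi>H. a \<eta> * (c * J B \<eta> - N B)) / w" .
    have i2: "integrable \<pi>H (\<lambda>\<eta>. a \<eta> * (c * J B \<eta> - N B))"
    proof -
      have "integrable \<pi>H (\<lambda>\<eta>. a \<eta> * (c * J B \<eta>) - N B * a \<eta>)" using i1 ai by simp
      then show ?thesis by (simp add: algebra_simps)
    qed
    have "\<bar>LINT \<eta>|\<pi>H. a \<eta> * (c * J B \<eta> - N B)\<bar> \<le> (LINT \<eta>|\<pi>H. \<bar>a \<eta> * (c * J B \<eta> - N B)\<bar>)"
      by (rule integral_abs_bound)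
    also have "\<dots> \<le> (LINT \<eta>|\<pi>H. \<kappa> * a \<eta>)"
    proof (rule integral_mono)
      show "\<bar>a \<eta> * (c * J B \<eta> - N B)\<bar> \<le> \<kappa> * a \<eta>" for \<eta>
      proof (cases "\<eta> \<in> U")
        case True
        have "\<bar>a \<eta> * (c * J B \<eta> - N B)\<bar> = a \<eta> * \<bar>c * J B \<eta> - N B\<bar>" using a0[of \<eta>] by (simp add: abs_mult)
        also have "\<dots> \<le> a \<eta> * \<kappa>" using approx[OF True B] a0[of \<eta>] unfolding J_def by (intro mult_left_mono)
        finally show ?thesis by (simp add: mult.commute)
      qed (simp add: a_def)
    qed (use i2 ai in auto)
    also have "\<dots> = \<kappa> * w" by (simp add: w_def)
    finally show ?thesis unfolding eq using w by (simp add: abs_divide pos_divide_le_eq)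
  qed
  with q show ?thesis by blast
qed

lemma score_sum_bounded:
  "\<exists>C>0. \<forall>n z t v \<rho>. controlled \<eta>0 n z t v \<rho> \<longrightarrow> t \<ge> 0 \<longrightarrow> \<bar>- (\<Sum>i<n. log_slope \<eta>0 (z i)) / sqrt n\<bar> \<le> C * t"
proof -
  obtain C where C: "C > 0" "\<And>x. \<bar>log_curv \<eta>0 x\<bar> \<le> C * (1 + x\<^sup>2)" using log_curv_bound eta0 by blast
  have b: "\<bar>log_curv \<eta>0 x\<bar> \<le> C * (1 + x\<^sup>2)\<^sup>2" for x
  proof -
    have "(1 + x\<^sup>2) * 1 \<le> (1 + x\<^sup>2) * (1 + x\<^sup>2)" by (intro mult_left_mono) auto
    then have "C * (1 + x\<^sup>2) \<le> C * (1 + x\<^sup>2)\<^sup>2" using C(1) by (intro mult_left_mono) (auto simp: power2_eq_square)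
    with C(2)[of x] show ?thesis by linarith
  qed
  have "\<bar>- (\<Sum>i<n. log_slope \<eta>0 (z i)) / sqrt n\<bar> \<le> C * t" if co: "controlled \<eta>0 n z t v \<rho>" and t: "t \<ge> 0" for n z t v \<rho>
  proof (cases "n = 0")
    case False
    have "\<bar>(\<Sum>i<n. log_slope \<eta>0 (z i)) - real n * (LINT x|lborel. log_slope \<eta>0 x * mix_deriv 0 \<eta>0 x)\<bar> \<le> C * t * sqrt n"
      by (rule controlled_emp[OF co log_slope_has_derivative[OF eta0] log_curv_continuous[OF eta0] b])
    then have "\<bar>\<Sum>i<n. log_slope \<eta>0 (z i)\<bar> \<le> C * t * sqrt n" by (simp add: score_mean_zero[OF eta0 eta0])
    then show ?thesis using False by (simp add: abs_divide pos_divide_le_eq)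
  qed (use C t in simp)
  with C(1) show ?thesis by blast
qed

text \<open>The constants are chosen in this order: \<open>\<delta>\<close> from the normal approximation, \<open>\<rho>\<close> from \<open>\<delta>\<close>, the neighbourhood of the truth from \<open>\<rho>\<close>, and
the rate \<open>c\<close> from the neighbourhood.  The bounds \<open>t\<close> and \<open>v\<close> on the sample are fixed before all of them, so they can be taken
from the tightness of the sample statistics.\<close>

theorem bvm_deterministic:
  assumes t: "t \<ge> 0" and v: "v \<ge> 0" and \<kappa>: "0 < \<kappa>" "\<kappa> \<le> 1/2"
  shows "\<exists>\<rho>>0. \<exists>N0. \<forall>n\<ge>N0. \<forall>xs. controlled \<eta>0 n (\<lambda>i. xs i - \<theta>0) t v \<rho> \<longrightarrow>
    (\<forall>B\<in>sets borel. \<bar>posterior \<pi> n xs (loc_event n B) -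
       measure (normal_measure (- (\<Sum>i<n. log_slope \<eta>0 (xs i - \<theta>0)) / sqrt n / info \<eta>0) (inverse (info \<eta>0))) B\<bar> \<le> 5 * \<kappa>)"
proof -
  have I: "info \<eta>0 > 0" by (rule info_pos[OF eta0])
  obtain C where C: "C > 0" "\<And>n z v \<rho>. controlled \<eta>0 n z t v \<rho> \<Longrightarrow> \<bar>- (\<Sum>i<n. log_slope \<eta>0 (z i)) / sqrt n\<bar> \<le> C * t"
    using score_sum_bounded t by blast
  obtain \<delta> m where \<delta>: "\<delta> > 0" and NA: "\<forall>S. \<bar>S\<bar> \<le> C * t \<longrightarrow> (\<exists>c>0. \<forall>m' j. m \<le> m' \<longrightarrow> near_gaussian (info \<eta>0) S \<delta> m' j \<longrightarrow>
    integrable lborel j \<and> (\<forall>B\<in>sets borel.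
      \<bar>c * (LINT h|lborel. indicator B h * j h) - measure (normal_measure (S / info \<eta>0) (inverse (info \<eta>0))) B\<bar> \<le> \<kappa>))"
    using normal_approximation[OF I \<kappa>(1), of "C * t"] by blast
  define \<rho> where "\<rho> = \<delta> / (t + v + 1)"
  have tv: "t + v + 1 > 0" using t v by simp
  have \<rho>: "\<rho> > 0" "\<rho> * t \<le> \<delta>" "\<rho> * (v + 1) / 2 \<le> \<delta>"
  proof -
    show "\<rho> > 0" using \<delta> tv by (simp add: \<rho>_def)
    have "\<rho> * (t + v + 1) = \<delta>" using tv by (simp add: \<rho>_def)
    moreover have "\<rho> * t \<ge> 0" "\<rho> * (v + 1) \<ge> 0" using \<open>\<rho> > 0\<close> t v by auto
    ultimately show "\<rho> * t \<le> \<delta>" "\<rho> * (v + 1) / 2 \<le> \<delta>" by (auto simp: algebra_simps)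
  qed
  obtain e where e: "e > 0" and loc: "locally_at \<eta>0 (\<lambda>\<eta>. log_close \<eta>0 \<rho> e \<eta>)"
    using locally_at_log_close[OF eta0 \<rho>(1)] by blast
  from loc obtain G \<epsilon> where G: "finite G" "\<epsilon> > 0" and close: "\<And>\<eta>. \<eta> \<in> density_nbhd \<eta>0 G \<epsilon> \<Longrightarrow> log_close \<eta>0 \<rho> e \<eta>"
    unfolding locally_at_def by blast
  define U where "U = density_nbhd \<eta>0 G \<epsilon>"
  obtain V f where Vf: "prior_nbhd V f" using prior_nbhd_exists by blast
  obtain d0 where d0: "d0 > 0" "{\<theta>0 - d0..\<theta>0 + d0} \<subseteq> V" using prior_nbhd_interval[OF Vf] by blast
  have f0: "f \<theta>0 > 0" "\<And>x. x \<in> V \<Longrightarrow> f x > 0" using Vf by (auto simp: prior_nbhd_def)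
  have "isCont (\<lambda>\<theta>. f \<theta> / f \<theta>0) \<theta>0"
    using Vf f0(1) unfolding prior_nbhd_def by (intro continuous_intros) (auto simp: continuous_on_eq_continuous_at)
  then have "\<forall>e>0. \<exists>d>0. \<forall>x. dist x \<theta>0 < d \<longrightarrow> dist (f x / f \<theta>0) (f \<theta>0 / f \<theta>0) < e"
    by (simp only: continuous_at_eps_delta)
  then obtain d1 where d1: "d1 > 0" "\<And>x. dist x \<theta>0 < d1 \<Longrightarrow> dist (f x / f \<theta>0) (f \<theta>0 / f \<theta>0) < \<delta>"
    using \<delta> by blast
  define d where "d = min (min d0 e) (d1 / 2)"
  have d: "d > 0" "d \<le> e" "d \<le> d0" "d < d1" using d0 d1 e by (auto simp: d_def)
  have dV: "{\<theta>0 - d..\<theta>0 + d} \<subseteq> V"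
  proof -
    have "{\<theta>0 - d..\<theta>0 + d} \<subseteq> {\<theta>0 - d0..\<theta>0 + d0}" using d(3) by auto
    then show ?thesis using d0(2) by blast
  qed
  have fr: "\<bar>f \<theta> / f \<theta>0 - 1\<bar> \<le> \<delta> \<and> f \<theta> / f \<theta>0 \<ge> 0" if "\<bar>\<theta> - \<theta>0\<bar> \<le> d" for \<theta>
  proof -
    have "\<theta> \<in> V" using that dV by (auto simp: abs_le_iff)
    moreover have "dist (f \<theta> / f \<theta>0) (f \<theta>0 / f \<theta>0) < \<delta>" using that d by (intro d1(2)) (simp add: dist_real_def)
    ultimately show ?thesis using f0 by (auto simp: dist_real_def less_imp_le)
  qed
  obtain c N1 where c: "c > 0" and far: "\<And>n z \<rho> \<eta> u. n \<ge> N1 \<Longrightarrow> controlled \<eta>0 n z t v \<rho> \<Longrightarrow> \<eta> \<in> mixing \<Longrightarrow>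
     \<bar>u\<bar> > d \<or> \<eta> \<notin> density_nbhd \<eta>0 G \<epsilon> \<Longrightarrow> llr \<eta>0 n z u \<eta> \<le> - c * real n"
    using llr_far[OF eta0 G(2) d(1) t, of v G] by blast
  \<comment> \<open>Half the exponential rate is given to the evidence; the other half makes the outer posterior mass vanish.\<close>
  have "c / 2 > 0" using c by simp
  from evidence_lower_bound[OF this v] obtain mass where mass: "mass > 0"
    "\<And>n z \<rho>. controlled \<eta>0 n z t v \<rho> \<Longrightarrow> (LINT p|\<pi>. lik_ratio n z p) \<ge> mass * exp (- (c / 2) * n)" by blast
  obtain N2 where N2: "\<And>n. n \<ge> N2 \<Longrightarrow> exp (- (c / 2) * real n) \<le> \<kappa> * mass"
  proof -
    have "(\<lambda>n. exp (- (c / 2) * real n)) \<longlonglongrightarrow> 0"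
      by (intro filterlim_compose[OF exp_at_bot] filterlim_tendsto_neg_mult_at_bot[OF tendsto_const _ filterlim_real_sequentially])
        (use c in simp)
    moreover have "\<kappa> * mass > 0" using \<kappa> mass by simp
    ultimately have "\<forall>\<^sub>F n in sequentially. exp (- (c / 2) * real n) < \<kappa> * mass" by (rule order_tendstoD)
    then obtain N where "\<And>n. n \<ge> N \<Longrightarrow> exp (- (c / 2) * real n) < \<kappa> * mass"
      unfolding eventually_sequentially by blast
    then show ?thesis using that[of N] less_imp_le by blast
  qed
  obtain N3 where N3: "\<And>n. n \<ge> N3 \<Longrightarrow> m \<le> sqrt (real n) * d"
  proof -
    have "filterlim (\<lambda>n. sqrt (real n) * d) at_top sequentially"
      by (intro filterlim_at_top_mult_tendsto_pos[OF tendsto_const d(1)]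
          filterlim_compose[OF sqrt_at_top filterlim_real_sequentially])
    then show ?thesis using that by (auto simp: filterlim_at_top eventually_sequentially)
  qed
  have Us: "U \<in> sets \<pi>H" "emeasure \<pi>H U > 0" unfolding U_def using density_nbhd_H_sets density_nbhd_H_pos G by auto
  have main: "\<bar>posterior \<pi> n xs (loc_event n B) -
       measure (normal_measure (- (\<Sum>i<n. log_slope \<eta>0 (xs i - \<theta>0)) / sqrt n / info \<eta>0) (inverse (info \<eta>0))) B\<bar> \<le> 5 * \<kappa>"
    if n: "n \<ge> max (max N1 N2) (max N3 1)" and co: "controlled \<eta>0 n (\<lambda>i. xs i - \<theta>0) t v \<rho>" and B: "B \<in> sets borel" for n xs B
  proof -
    define z where "z = (\<lambda>i. xs i - \<theta>0)"
    define S where "S = - (\<Sum>i<n. log_slope \<eta>0 (z i)) / sqrt n"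
    define N where "N B = measure (normal_measure (S / info \<eta>0) (inverse (info \<eta>0))) B" for B
    have co: "controlled \<eta>0 n z t v \<rho>" using co by (simp add: z_def)
    have n0: "n > 0" using n by simp
    interpret nm: prob_space "normal_measure (S / info \<eta>0) (inverse (info \<eta>0))"
      by (rule prob_space_normal_measure) (use I in simp)
    have "\<bar>S\<bar> \<le> C * t" unfolding S_def by (rule C(2)[OF co])
    with NA obtain cc where cc: "cc > 0" and NA': "\<forall>m' j. m \<le> m' \<longrightarrow> near_gaussian (info \<eta>0) S \<delta> m' j \<longrightarrow>
      integrable lborel j \<and> (\<forall>B\<in>sets borel.
        \<bar>cc * (LINT h|lborel. indicator B h * j h) - measure (normal_measure (S / info \<eta>0) (inverse (info \<eta>0))) B\<bar> \<le> \<kappa>)"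
      by blast
    have approx: "\<bar>cc * (LINT h|lborel. indicator B h * fibre_density f d n z \<eta> h) - N B\<bar> \<le> \<kappa>"
      if \<eta>: "\<eta> \<in> U" and B: "B \<in> sets borel" for \<eta> B
    proof -
      have \<eta>m: "\<eta> \<in> mixing" using \<eta> density_nbhd_mixing by (auto simp: U_def)
      have bounds: "\<forall>h. \<bar>h\<bar> \<le> sqrt n * d \<longrightarrow> (1 - \<delta>) * exp (h * S - h\<^sup>2 * info \<eta>0 / 2 - \<delta> * (\<bar>h\<bar> + h\<^sup>2)) \<le> fibre_density f d n z \<eta> h \<and>
        fibre_density f d n z \<eta> h \<le> (1 + \<delta>) * exp (h * S - h\<^sup>2 * info \<eta>0 / 2 + \<delta> * (\<bar>h\<bar> + h\<^sup>2))"
        unfolding S_def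
      proof (intro allI impI, rule fibre_density_bounds[where d=d and f=f and t=t and v=v])
        show "log_close \<eta>0 \<rho> d \<eta>"
          using close[of \<eta>] d(2) \<eta> by (auto simp: U_def log_close_def)
      qed (use \<eta>m \<rho> co n0 fr in auto)
      have outer: "\<forall>h. \<bar>h\<bar> > sqrt n * d \<longrightarrow> fibre_density f d n z \<eta> h = 0"
        by (simp add: fibre_density_def)
      have "m \<le> sqrt n * d" using N3 n by simp
      moreover have "near_gaussian (info \<eta>0) S \<delta> (sqrt n * d) (fibre_density f d n z \<eta>)"
        unfolding near_gaussian_def
        using fibre_density_measurable[OF Vf dV n0 \<eta>m] bounds outer by blast
      ultimately have "\<forall>B\<in>sets borel. \<bar>cc * (LINT h|lborel. indicator B h * fibre_density f d n z \<eta> h) -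
          measure (normal_measure (S / info \<eta>0) (inverse (info \<eta>0))) B\<bar> \<le> \<kappa>"
        using NA' by blast
      then show ?thesis using B unfolding N_def by blast
    qed
    have "\<exists>q>0. \<forall>B\<in>sets borel. \<bar>q * (LINT p|\<pi>. (indicator (loc_event n B) p * central d U p) * lik_ratio n z p) - N B\<bar> \<le> \<kappa>"
    proof (rule bvm_central[OF Vf dV n0 Us _ cc _ _ approx])
      show "\<bar>llr \<eta>0 n z 0 \<eta>\<bar> \<le> \<rho> * v * n" if "\<eta> \<in> U" for \<eta>
        using that \<rho>(1) d(1,2) e by (intro llr_small[OF co, of \<rho> e]) (auto simp: U_def intro: close)
    qed (use \<kappa> in \<open>auto simp: N_def\<close>)
    then obtain q where q: "q > 0" and qB: "\<And>B. B \<in> sets borel \<Longrightarrow>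
      \<bar>q * (LINT p|\<pi>. (indicator (loc_event n B) p * central d U p) * lik_ratio n z p) - N B\<bar> \<le> \<kappa>" by blast
    have ci: "0 \<le> central d U p" "central d U p \<le> 1" for p by (auto simp: central_def indicator_def)
    have int1: "integrable \<pi> (\<lambda>p. (indicator (loc_event n B) p * central d U p) * lik_ratio n z p)" if "B \<in> sets borel" for B
    proof (rule lik_ratio_indicator_integrable)
      show "(\<lambda>p. indicator (loc_event n B) p * central d U p) \<in> borel_measurable \<pi>"
        by (intro borel_measurable_times borel_measurable_indicator central_measurable[OF Us(1)] loc_event_sets[OF that])
    qed (auto simp: central_def indicator_def)
    have int2: "integrable \<pi> (\<lambda>p. (indicator (loc_event n B) p * (1 - central d U p)) * lik_ratio n z p)" if "B \<in> sets borel" for B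
    proof (rule lik_ratio_indicator_integrable)
      show "(\<lambda>p. indicator (loc_event n B) p * (1 - central d U p)) \<in> borel_measurable \<pi>"
        by (intro borel_measurable_times borel_measurable_indicator borel_measurable_diff borel_measurable_const
            central_measurable[OF Us(1)] loc_event_sets[OF that])
    qed (auto simp: central_def indicator_def)
    define A where "A B = (LINT p|\<pi>. (indicator (loc_event n B) p * central d U p) * lik_ratio n z p)" for B
    define tail where "tail B = (LINT p|\<pi>. (indicator (loc_event n B) p * (1 - central d U p)) * lik_ratio n z p)" for B
    have split: "(LINT p|\<pi>. indicator (loc_event n B) p * lik_ratio n z p) = A B + tail B" if "B \<in> sets borel" for B
      unfolding A_def tail_def using int1[OF that] int2[OF that]
      by (subst Bochner_Integration.integral_add[symmetric]) (auto simp: algebra_simps intro!: Bochner_Integration.integral_cong)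
    have pt: "0 \<le> (1 - central d U p) * lik_ratio n z p" for p
      using lik_ratio_pos[of n z p] ci[of p] by (intro mult_nonneg_nonneg) auto
    have tail0: "0 \<le> tail B" for B
      unfolding tail_def using pt by (intro Bochner_Integration.integral_nonneg) (simp add: mult.assoc)
    have tail_mono: "tail B \<le> tail UNIV"
      unfolding tail_def
    proof (rule integral_mono[OF int2[OF B] int2])
      show "indicator (loc_event n B) p * (1 - central d U p) * lik_ratio n z p
          \<le> indicator (loc_event n UNIV) p * (1 - central d U p) * lik_ratio n z p" if "p \<in> space \<pi>" for p
        using pt[of p] that unfolding mult.assoc by (intro mult_right_mono) (auto simp: loc_event_def indicator_def)
    qed simp
    have "(LINT p|\<pi>. indicator (loc_event n UNIV) p * lik_ratio n z p) = (LINT p|\<pi>. lik_ratio n z p)"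
      by (intro Bochner_Integration.integral_cong) (auto simp: loc_event_def)
    then have total: "(LINT p|\<pi>. lik_ratio n z p) = A UNIV + tail UNIV" using split[of UNIV] by simp
    have "tail UNIV \<le> (LINT p|\<pi>. exp (- c * n))"
      unfolding tail_def
    proof (rule integral_mono[OF int2])
      fix p assume p: "p \<in> space \<pi>"
      show "indicator (loc_event n UNIV) p * (1 - central d U p) * lik_ratio n z p \<le> exp (- c * real n)"
      proof (cases "\<bar>fst p - \<theta>0\<bar> \<le> d \<and> snd p \<in> U")
        case True
        then have "central d U p = 1" by (auto simp: central_def indicator_def abs_le_iff)
        then show ?thesis by simp
      next
        case False
        have "llr \<eta>0 n z (fst p - \<theta>0) (snd p) \<le> - c * n"
          using False n by (intro far[OF _ co space_pi_snd[OF p]]) (auto simp: U_def)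
        then have le: "lik_ratio n z p \<le> exp (- c * n)" by (simp add: lik_ratio_def)
        have "indicator (loc_event n UNIV) p * (1 - central d U p) * lik_ratio n z p \<le> 1 * lik_ratio n z p"
          using ci[of p] lik_ratio_pos[of n z p] by (intro mult_right_mono) (auto simp: indicator_def)
        with le show ?thesis by simp
      qed
    qed auto
    also have "\<dots> = exp (- (c / 2) * n) * exp (- (c / 2) * n)" by (simp add: prior.prob_space flip: exp_add)
    also have "\<dots> \<le> (\<kappa> * mass) * exp (- (c / 2) * n)" using N2[of n] n by (intro mult_right_mono) auto
    also have "\<dots> \<le> \<kappa> * (LINT p|\<pi>. lik_ratio n z p)" using mass(2)[OF co] \<kappa> by (simp add: mult.assoc)
    finally have tailk: "tail UNIV \<le> \<kappa> * (A UNIV + tail UNIV)" unfolding total .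
    have NU: "N UNIV = 1"
    proof -
      have "space (normal_measure (S / info \<eta>0) (inverse (info \<eta>0))) = UNIV" by (simp add: normal_measure_def)
      then show ?thesis unfolding N_def using nm.prob_space by simp
    qed
    have "\<bar>(q * A B + q * tail B) / (q * A UNIV + q * tail UNIV) - N B\<bar> \<le> 5 * \<kappa>"
    proof (rule posterior_ratio_close[OF \<kappa>(2)])
      show "\<bar>q * A B - N B\<bar> \<le> \<kappa>" using qB[OF B] by (simp add: A_def)
      show "\<bar>q * A UNIV - 1\<bar> \<le> \<kappa>" using qB[of UNIV] by (simp add: A_def NU)
      show "q * tail UNIV \<le> \<kappa> * (q * A UNIV + q * tail UNIV)"
        using mult_left_mono[OF tailk, of q] q by (simp add: algebra_simps)
      show "0 \<le> q * tail B" "q * tail B \<le> q * tail UNIV" using q tail0 tail_mono by auto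
    qed (auto simp: N_def)
    moreover have "posterior \<pi> n xs (loc_event n B) = (q * A B + q * tail B) / (q * A UNIV + q * tail UNIV)"
      unfolding posterior_lik_ratio z_def[symmetric] split[OF B] total using q by (simp flip: distrib_left)
    ultimately show ?thesis by (simp add: N_def S_def z_def)
  qed
  show ?thesis
    by (rule exI[of _ \<rho>], rule conjI[OF \<rho>(1)], rule exI[of _ "max (max N1 N2) (max N3 1)"]) (use main in blast)
qed

end

section \<open>Regularity of a random sample\<close>

lemma (in prob_space) markov_tail:
  fixes u :: "'a \<Rightarrow> ennreal"
  assumes u[measurable]: "u \<in> borel_measurable M" and b: "(\<integral>\<^sup>+\<omega>. u \<omega> \<partial>M) \<le> ennreal b" "b \<ge> 0" and a: "a > 0"
  shows "prob {\<omega> \<in> space M. u \<omega> > ennreal a} \<le> b / a"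
proof -
  have "emeasure M {\<omega> \<in> space M. u \<omega> > ennreal a} \<le> emeasure M {\<omega> \<in> space M. 1 \<le> ennreal (1 / a) * u \<omega>}"
  proof (rule emeasure_mono)
    show "{\<omega> \<in> space M. u \<omega> > ennreal a} \<subseteq> {\<omega> \<in> space M. 1 \<le> ennreal (1 / a) * u \<omega>}"
    proof safe
      fix \<omega> assume "ennreal a < u \<omega>"
      then have "ennreal (1 / a) * ennreal a \<le> ennreal (1 / a) * u \<omega>" by (intro mult_left_mono) auto
      moreover have "ennreal (1 / a) * ennreal a = 1" using a by (simp add: ennreal_mult[symmetric])
      ultimately show "1 \<le> ennreal (1 / a) * u \<omega>" by simp
    qed
  qed measurable
  also have "\<dots> \<le> ennreal (1 / a) * (\<integral>\<^sup>+\<omega>. u \<omega> * indicator (space M) \<omega> \<partial>M)"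
    by (rule nn_integral_Markov_inequality) auto
  also have "(\<integral>\<^sup>+\<omega>. u \<omega> * indicator (space M) \<omega> \<partial>M) = (\<integral>\<^sup>+\<omega>. u \<omega> \<partial>M)"
    by (intro nn_integral_cong) simp
  also have "ennreal (1 / a) * (\<integral>\<^sup>+\<omega>. u \<omega> \<partial>M) \<le> ennreal (1 / a) * ennreal b" by (intro mult_left_mono b) auto
  also have "\<dots> = ennreal (b / a)" using a b by (simp add: ennreal_mult[symmetric])
  finally show ?thesis using a b by (simp add: emeasure_eq_measure)
qed

context mixture_box begin

definition error_dist :: "(real \<times> real) measure \<Rightarrow> real measure" where
  "error_dist \<eta> = density lborel (\<lambda>x. ennreal (mix_deriv 0 \<eta> x))"

lemma error_dist_moment_measure:
  assumes \<eta>: "\<eta> \<in> mixing"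
  shows "moment_measure (error_dist \<eta>)"
proof -
  note [measurable] = mix_deriv_measurable[OF \<eta>]
  have "emeasure (error_dist \<eta>) (space (error_dist \<eta>)) = (\<integral>\<^sup>+x. ennreal (mix_deriv 0 \<eta> x) \<partial>lborel)"
    unfolding error_dist_def by (subst emeasure_density) auto
  also have "\<dots> = ennreal (LINT x|lborel. mix_deriv 0 \<eta> x)"
    using mix_deriv_pos[OF \<eta>] by (intro nn_integral_eq_integral density_integrable \<eta>) (auto simp: less_imp_le)
  finally have "prob_space (error_dist \<eta>)" using density_integral[OF \<eta>] by (intro prob_spaceI) simp
  moreover have "sets (error_dist \<eta>) = sets borel" by (simp add: error_dist_def)
  moreover have "integrable (error_dist \<eta>) (\<lambda>y. (1 + y\<^sup>2) ^ 6)"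
  proof -
    have "integrable lborel (\<lambda>y. (1 + y\<^sup>2) ^ 6 * mix_deriv 0 \<eta> y)"
      by (rule polynomial_density_integrable[OF \<eta>, of _ 1 6]) auto
    then show ?thesis unfolding error_dist_def using mix_deriv_pos[OF \<eta>]
      by (subst integrable_density) (auto simp: less_imp_le mult.commute)
  qed
  ultimately show ?thesis by (simp add: moment_measure_def moment_measure_axioms_def)
qed

lemma error_dist_integral:
  fixes g :: "real \<Rightarrow> real"
  assumes \<eta>: "\<eta> \<in> mixing" and g: "g \<in> borel_measurable borel"
  shows "(LINT x|error_dist \<eta>. g x) = (LINT x|lborel. g x * mix_deriv 0 \<eta> x)"
proof -
  have "(LINT x|error_dist \<eta>. g x) = (LINT x|lborel. mix_deriv 0 \<eta> x *\<^sub>R g x)"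
    unfolding error_dist_def using g mix_deriv_measurable[OF \<eta>] mix_deriv_pos[OF \<eta>]
    by (intro integral_density) (auto simp: less_imp_le)
  then show ?thesis by (simp add: mult.commute)
qed

lemma shifted_loc_measure:
  assumes \<eta>: "\<eta> \<in> mixing"
  shows "distr (loc_measure \<theta> \<eta>) borel (\<lambda>x. x - \<theta>) = error_dist \<eta>"
proof (rule measure_eqI)
  note [measurable] = mix_deriv_measurable[OF \<eta>]
  fix A :: "real set" assume "A \<in> sets (distr (loc_measure \<theta> \<eta>) borel (\<lambda>x. x - \<theta>))"
  then have A[measurable]: "A \<in> sets borel" by simp
  have vA: "(\<lambda>x. x - \<theta>) -` A \<in> sets borel"
    using measurable_sets[of "\<lambda>x. x - \<theta>" borel borel A] by simp
  have "emeasure (distr (loc_measure \<theta> \<eta>) borel (\<lambda>x. x - \<theta>)) A = emeasure (loc_measure \<theta> \<eta>) ((\<lambda>x. x - \<theta>) -` A)"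
    by (subst emeasure_distr) (auto simp: loc_measure_def)
  also have "\<dots> = (\<integral>\<^sup>+x. ennreal (mix_deriv 0 \<eta> (x - \<theta>)) * indicator ((\<lambda>x. x - \<theta>) -` A) x \<partial>lborel)"
    unfolding loc_measure_def loc_density_def mix_density_eq
    by (rule emeasure_density) (use vA in auto)
  also have "\<dots> = (\<integral>\<^sup>+x. ennreal (mix_deriv 0 \<eta> (x - \<theta>)) * indicator A (x - \<theta>) \<partial>lborel)"
    by (intro nn_integral_cong) (simp add: indicator_def)
  also have "\<dots> = (\<integral>\<^sup>+x. ennreal (mix_deriv 0 \<eta> x) * indicator A x \<partial>lborel)"
    by (subst nn_integral_real_affine[of _ 1 \<theta>]) auto
  also have "\<dots> = emeasure (error_dist \<eta>) A" unfolding error_dist_def by (rule emeasure_density[symmetric]) auto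
  finally show "emeasure (distr (loc_measure \<theta> \<eta>) borel (\<lambda>x. x - \<theta>)) A = emeasure (error_dist \<eta>) A" .
qed (simp add: error_dist_def)

lemma score_eq:
  assumes \<eta>: "\<eta> \<in> mixing"
  shows "score \<theta> \<eta> x = - log_slope \<eta> (x - \<theta>)"
proof -
  have "((\<lambda>t. log_density \<eta> (x - t)) has_real_derivative log_slope \<eta> (x - \<theta>) * (0 - 1)) (at \<theta>)"
    by (intro DERIV_chain2[OF log_density_has_derivative[OF \<eta>]] derivative_intros)
  then show ?thesis
    unfolding score_def loc_density_def mix_density_eq log_density_def[symmetric]
    by (simp add: DERIV_imp_deriv)
qed

lemma fisher_info_eq:
  assumes \<eta>: "\<eta> \<in> mixing"
  shows "fisher_info \<theta> \<eta> = info \<eta>"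
proof -
  note [measurable] = mix_deriv_measurable[OF \<eta>] log_measurable[OF \<eta>]
  have "fisher_info \<theta> \<eta> = (LINT x|lborel. mix_deriv 0 \<eta> (x - \<theta>) *\<^sub>R (log_slope \<eta> (x - \<theta>))\<^sup>2)"
    unfolding fisher_info_def loc_measure_def loc_density_def mix_density_eq score_eq[OF \<eta>]
    using mix_deriv_pos[OF \<eta>] by (subst integral_density) (auto simp: less_imp_le)
  also have "\<dots> = info \<eta>"
    unfolding info_def by (subst lborel_integral_real_affine[of 1 _ \<theta>]) (auto simp: mult.commute)
  finally show ?thesis .
qed

text \<open>Markov's inequality for the three statistics.  The first two have expectations of order \<open>sqrt n\<close> and \<open>n\<close>, so \<open>t\<close> and \<open>v\<close> can be fixed in advance;
the third has an expectation of order \<open>sqrt n\<close> and is compared with \<open>\<rho> * n\<close>, so \<open>\<rho>\<close> may be arbitrarily small.\<close>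

lemma controlled_with_high_probability:
  fixes Z :: "nat \<Rightarrow> 'w \<Rightarrow> real"
  assumes \<eta>0: "\<eta>0 \<in> mixing" and P: "prob_space P" and ind: "prob_space.indep_vars P (\<lambda>_. borel) Z UNIV"
    and dist: "\<And>i. distr P borel (Z i) = error_dist \<eta>0" and \<tau>: "\<tau> > 0"
  shows "\<exists>t\<ge>0. \<exists>v\<ge>0. \<forall>\<rho>>0. \<exists>N. \<forall>n\<ge>N. \<exists>E\<in>sets P. measure P E \<le> \<tau> \<and>
     (\<forall>\<omega>\<in>space P - E. controlled \<eta>0 n (\<lambda>i. Z i \<omega>) t v \<rho>)"
proof -
  interpret P: prob_space P by fact
  interpret Q: moment_measure "error_dist \<eta>0" by (rule error_dist_moment_measure[OF \<eta>0])
  have Zm[measurable]: "Z i \<in> borel_measurable P" for i using ind by (auto simp: P.indep_vars_def2)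
  note [measurable] = log_measurable[OF \<eta>0]
  define K where "K = pi * sqrt Q.mom"
  have K: "K \<ge> 0" using Q.mom_nonneg by (simp add: K_def)
  define V where "V = (LINT y|error_dist \<eta>0. (1 + y\<^sup>2)\<^sup>2)"
  have V: "V \<ge> 0" unfolding V_def by (intro Bochner_Integration.integral_nonneg) auto
  have Vi: "integrable (error_dist \<eta>0) (\<lambda>y. (1 + y\<^sup>2)\<^sup>2)" by (rule Q.poly_integrable[of _ 1 2]) auto
  obtain C where C: "C > 0" "\<And>x. \<bar>log_curv \<eta>0 x\<bar> \<le> C * (1 + x\<^sup>2)" using log_curv_bound \<eta>0 by blast
  have ci: "integrable (error_dist \<eta>0) (\<lambda>x. (log_curv \<eta>0 x)\<^sup>2)"
  proof (rule Q.poly_integrable[of _ "C\<^sup>2" 2])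
    show "\<bar>(log_curv \<eta>0 x)\<^sup>2\<bar> \<le> C\<^sup>2 * (1 + x\<^sup>2)\<^sup>2" for x
      using power_mono[OF C(2)[of x], of 2] by (simp add: power_mult_distrib)
  qed auto
  define K2 where "K2 = (LINT x|error_dist \<eta>0. (log_curv \<eta>0 x)\<^sup>2)"
  have K2: "K2 \<ge> 0" unfolding K2_def by (intro Bochner_Integration.integral_nonneg) auto
  define t where "t = 3 * (K + 1) / \<tau>"
  define v where "v = 3 * (V + 1) / \<tau>"
  have tv: "t > 0" "v > 0" using K V \<tau> by (auto simp: t_def v_def)
  have "\<exists>N. \<forall>n\<ge>N. \<exists>E\<in>sets P. measure P E \<le> \<tau> \<and>
     (\<forall>\<omega>\<in>space P - E. controlled \<eta>0 n (\<lambda>i. Z i \<omega>) t v \<rho>)" if \<rho>: "\<rho> > 0" for \<rho>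
  proof -
    define N where "N = nat \<lceil>K2 / (\<rho> * \<tau> / 3)\<^sup>2\<rceil> + 1"
    have "\<exists>E\<in>sets P. measure P E \<le> \<tau> \<and> (\<forall>\<omega>\<in>space P - E. controlled \<eta>0 n (\<lambda>i. Z i \<omega>) t v \<rho>)" if n: "n \<ge> N" for n
    proof -
      have n0: "n > 0" using n by (simp add: N_def)
      let ?u1 = "\<lambda>\<omega>. Q.emp_norm n (\<lambda>i. Z i \<omega>)"
      let ?u2 = "\<lambda>\<omega>. ennreal (\<Sum>i<n. (1 + (Z i \<omega>)\<^sup>2)\<^sup>2)"
      let ?u3 = "\<lambda>\<omega>. ennreal \<bar>\<Sum>i<n. log_curv \<eta>0 (Z i \<omega>) - (LINT x|error_dist \<eta>0. log_curv \<eta>0 x)\<bar>"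
      let ?E1 = "{\<omega> \<in> space P. ?u1 \<omega> > ennreal (t * sqrt n)}"
      let ?E2 = "{\<omega> \<in> space P. ?u2 \<omega> > ennreal (v * n)}"
      let ?E3 = "{\<omega> \<in> space P. ?u3 \<omega> > ennreal (\<rho> * n)}"
      note [measurable] = Q.emp_norm_expectation(1)[OF P ind dist, of n]
      have m: "?E1 \<in> sets P" "?E2 \<in> sets P" "?E3 \<in> sets P" by measurable
      have "measure P ?E1 \<le> K * sqrt n / (t * sqrt n)"
      proof (rule P.markov_tail)
        show "(\<integral>\<^sup>+\<omega>. ?u1 \<omega> \<partial>P) \<le> ennreal (K * sqrt n)"
          using Q.emp_norm_expectation(2)[OF P ind dist, of n] by (simp add: K_def real_sqrt_mult mult_ac)
      qed (use K tv n0 in auto)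
      also have "\<dots> = K / t" using n0 by simp
      also have "\<dots> \<le> \<tau> / 3" using K \<tau> by (simp add: t_def field_simps)
      finally have p1: "measure P ?E1 \<le> \<tau> / 3" .
      have "measure P ?E2 \<le> V * n / (v * n)"
      proof (rule P.markov_tail)
        have iZ: "integrable P (\<lambda>\<omega>. (1 + (Z i \<omega>)\<^sup>2)\<^sup>2)" "(LINT \<omega>|P. (1 + (Z i \<omega>)\<^sup>2)\<^sup>2) = V" for i
          using Vi unfolding V_def dist[of i, symmetric]
          by (auto simp: integrable_distr_eq integral_distr)
        have "(\<integral>\<^sup>+\<omega>. ?u2 \<omega> \<partial>P) = ennreal (LINT \<omega>|P. (\<Sum>i<n. (1 + (Z i \<omega>)\<^sup>2)\<^sup>2))"
          using iZ by (intro nn_integral_eq_integral Bochner_Integration.integrable_sum) (auto intro!: sum_nonneg)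
        also have "(LINT \<omega>|P. (\<Sum>i<n. (1 + (Z i \<omega>)\<^sup>2)\<^sup>2)) = V * n"
          using iZ by (subst Bochner_Integration.integral_sum) auto
        finally show "(\<integral>\<^sup>+\<omega>. ?u2 \<omega> \<partial>P) \<le> ennreal (V * n)" by simp
      qed (use V tv n0 in auto)
      also have "\<dots> = V / v" using n0 by simp
      also have "\<dots> \<le> \<tau> / 3" using V \<tau> by (simp add: v_def field_simps)
      finally have p2: "measure P ?E2 \<le> \<tau> / 3" .
      have "measure P ?E3 \<le> sqrt (n * K2) / (\<rho> * n)"
        using P.iid_centered_sum_abs[OF ind dist _ ci, of n] \<rho> n0 K2
        by (intro P.markov_tail) (auto simp: K2_def)
      also have "\<dots> \<le> \<tau> / 3"
      proof -
        have "K2 / (\<rho> * \<tau> / 3)\<^sup>2 \<le> n" using n unfolding N_def by linarith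
        then have "K2 \<le> n * (\<rho> * \<tau> / 3)\<^sup>2" using \<rho> \<tau> by (simp add: pos_divide_le_eq)
        then have "n * K2 \<le> n * (n * (\<rho> * \<tau> / 3)\<^sup>2)" by (intro mult_left_mono) auto
        also have "\<dots> = (n * (\<rho> * \<tau> / 3))\<^sup>2" by (simp add: power2_eq_square)
        finally have "sqrt (n * K2) \<le> n * (\<rho> * \<tau> / 3)" using \<rho> \<tau> by (intro real_le_lsqrt) auto
        then show ?thesis using \<rho> n0 by (simp add: pos_divide_le_eq mult_ac)
      qed
      finally have p3: "measure P ?E3 \<le> \<tau> / 3" .
      have "measure P (?E1 \<union> ?E2 \<union> ?E3) \<le> measure P (?E1 \<union> ?E2) + measure P ?E3"
        by (rule measure_Un_le) (use m in auto)
      also have "measure P (?E1 \<union> ?E2) \<le> measure P ?E1 + measure P ?E2"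
        by (rule measure_Un_le) (use m in auto)
      finally have pE: "measure P (?E1 \<union> ?E2 \<union> ?E3) \<le> \<tau>" using p1 p2 p3 by linarith
      have "controlled \<eta>0 n (\<lambda>i. Z i \<omega>) t v \<rho>" if \<omega>: "\<omega> \<in> space P - (?E1 \<union> ?E2 \<union> ?E3)" for \<omega>
        unfolding controlled_def
      proof (intro conjI allI impI)
        fix g g' C
        assume g: "\<forall>x. (g has_real_derivative g' x) (at x)" "continuous_on UNIV g'" "\<forall>x. \<bar>g' x\<bar> \<le> C * (1 + x\<^sup>2)\<^sup>2"
        have "continuous_on UNIV g" using g(1) by (meson DERIV_isCont continuous_at_imp_continuous_on)
        then have gm: "g \<in> borel_measurable borel" by (rule borel_measurable_continuous_onI)
        have "\<bar>(\<Sum>i<n. g (Z i \<omega>)) - real n * (LINT y|error_dist \<eta>0. g y)\<bar> \<le> C * (t * sqrt n)"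
          by (rule Q.emp_norm_controls[of g g']) (use g \<omega> tv in \<open>auto simp: not_less\<close>)
        then show "\<bar>(\<Sum>i<n. g (Z i \<omega>)) - real n * (LINT x|lborel. g x * mix_deriv 0 \<eta>0 x)\<bar> \<le> C * t * sqrt n"
          by (simp add: error_dist_integral[OF \<eta>0 gm] mult.assoc)
      next
        have "ennreal (\<Sum>i<n. (1 + (Z i \<omega>)\<^sup>2)\<^sup>2) \<le> ennreal (v * n)" using \<omega> by (auto simp: not_less)
        then show "(\<Sum>i<n. (1 + (Z i \<omega>)\<^sup>2)\<^sup>2) \<le> v * n" using tv by (subst (asm) ennreal_le_iff) auto
      next
        have "?u3 \<omega> \<le> ennreal (\<rho> * n)" using \<omega> by (auto simp: not_less)
        then have "\<bar>\<Sum>i<n. log_curv \<eta>0 (Z i \<omega>) - (LINT x|error_dist \<eta>0. log_curv \<eta>0 x)\<bar> \<le> \<rho> * n"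
          using \<rho> by (subst (asm) ennreal_le_iff) auto
        moreover have "(LINT x|error_dist \<eta>0. log_curv \<eta>0 x) = - info \<eta>0"
          using information_identity[OF \<eta>0] by (simp add: error_dist_integral[OF \<eta>0])
        ultimately show "\<bar>(\<Sum>i<n. log_curv \<eta>0 (Z i \<omega>)) + n * info \<eta>0\<bar> \<le> \<rho> * n"
          by (simp add: sum.distrib)
      qed
      with pE m show ?thesis by (intro bexI[of _ "?E1 \<union> ?E2 \<union> ?E3"]) auto
    qed
    then show ?thesis by blast
  qed
  with tv show ?thesis by (intro exI[of _ t] exI[of _ v] conjI) auto
qed

end

context bvm_model begin

lemma posterior_borel_measurable:
  assumes X: "\<And>i. X i \<in> borel_measurable N" and B: "B \<in> sets borel"
  shows "(\<lambda>\<omega>. posterior \<pi> n (\<lambda>i. X i \<omega>) (loc_event n B)) \<in> borel_measurable N"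
proof -
  have l: "(\<lambda>(\<omega>, p). likelihood n (\<lambda>i. X i \<omega>) p) \<in> borel_measurable (N \<Otimes>\<^sub>M \<pi>)"
    using likelihood_measurable[OF X, of n] by (simp add: case_prod_unfold)
  have ind: "(\<lambda>q. indicator (loc_event n B) (snd q) :: real) \<in> borel_measurable (N \<Otimes>\<^sub>M \<pi>)"
    by (rule measurable_compose[OF measurable_snd borel_measurable_indicator[OF loc_event_sets[OF B]]])
  have "(\<lambda>(\<omega>, p). indicator (loc_event n B) p *\<^sub>R likelihood n (\<lambda>i. X i \<omega>) p) \<in> borel_measurable (N \<Otimes>\<^sub>M \<pi>)"
    using borel_measurable_times[OF ind likelihood_measurable[OF X, of n]] by (simp add: case_prod_unfold)
  then have "(\<lambda>\<omega>. LINT p:loc_event n B|\<pi>. likelihood n (\<lambda>i. X i \<omega>) p) \<in> borel_measurable N"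
    unfolding set_lebesgue_integral_def by (rule prior.borel_measurable_lebesgue_integral)
  moreover have "(\<lambda>\<omega>. LINT p|\<pi>. likelihood n (\<lambda>i. X i \<omega>) p) \<in> borel_measurable N"
    using l by (rule prior.borel_measurable_lebesgue_integral)
  ultimately show ?thesis unfolding posterior_def by (rule borel_measurable_divide)
qed

end

lemma normal_measure_measurable:
  assumes \<Delta>[measurable]: "\<Delta> \<in> borel_measurable N" and B[measurable]: "B \<in> sets borel" and v: "v > 0"
  shows "(\<lambda>\<omega>. measure (normal_measure (\<Delta> \<omega>) v) B) \<in> borel_measurable N"
  unfolding measure_normal_measure[OF B v] normal_density_def
  by (rule lborel.borel_measurable_lebesgue_integral) measurable

section \<open>The Bernstein-von Mises theorem\<close>

theorem theorem3p3p1: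
  fixes \<Theta> :: "real set" and M \<sigma>1 \<sigma>2 \<theta>0 :: real
    and \<eta>0 :: "(real \<times> real) measure"
    and \<pi>\<Theta> :: "real measure" and \<pi>H :: "(real \<times> real) measure measure"
    and P :: "'w measure" and X :: "nat \<Rightarrow> 'w \<Rightarrow> real"
    and \<Delta> :: "nat \<Rightarrow> 'w \<Rightarrow> real"
  assumes "open \<Theta>" and "0 < M" and "0 < \<sigma>1" and "\<sigma>1 < \<sigma>2"
    and "\<theta>0 \<in> \<Theta>" and "\<eta>0 \<in> mixing_measures M \<sigma>1 \<sigma>2"
    and "prob_space P"
    and "prob_space.indep_vars P (\<lambda>_. borel) X UNIV"
    and "\<And>i. distr P borel (X i) = loc_measure \<theta>0 \<eta>0"
    and "prob_space \<pi>\<Theta>" and "sets \<pi>\<Theta> = sets (restrict_space borel \<Theta>)"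
    and "thick_at \<pi>\<Theta> \<theta>0"
    and "prob_space \<pi>H" and "sets \<pi>H = sets (weak_borel M \<sigma>1 \<sigma>2)"
    and "\<And>U. U \<in> sets \<pi>H \<Longrightarrow> weak_nbhd M \<sigma>1 \<sigma>2 \<eta>0 U \<Longrightarrow> emeasure \<pi>H U > 0"
  defines "\<Delta> \<equiv> \<lambda>n \<omega>. 1 / sqrt (real n) *
             (\<Sum>i<n. inverse (fisher_info \<theta>0 \<eta>0) * score \<theta>0 \<eta>0 (X i \<omega>))"
  shows "tendsto_zero_in_prob P (\<lambda>n \<omega>.
    SUP B\<in>sets borel.
      \<bar>posterior (\<pi>\<Theta> \<Otimes>\<^sub>M \<pi>H) n (\<lambda>i. X i \<omega>)
          {(\<theta>, \<eta>) \<in> space (\<pi>\<Theta> \<Otimes>\<^sub>M \<pi>H). sqrt (real n) * (\<theta> - \<theta>0) \<in> B}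
        - measure (normal_measure (\<Delta> n \<omega>) (inverse (fisher_info \<theta>0 \<eta>0))) B\<bar>)"
proof -
  interpret P: prob_space P by fact
  interpret bvm_model M \<sigma>1 \<sigma>2 \<Theta> \<theta>0 \<eta>0 \<pi>\<Theta> \<pi>H
    by (intro bvm_model.intro mixture_box.intro bvm_model_axioms.intro)
      (fact assms | (rule assms(15), assumption+))+
  have Xm[measurable]: "X i \<in> borel_measurable P" for i
    using assms(8) by (auto simp: P.indep_vars_def2)
  define Z where "Z i \<omega> = X i \<omega> - \<theta>0" for i \<omega>
  have indZ: "P.indep_vars (\<lambda>_. borel) Z UNIV"
    unfolding Z_def[abs_def] by (rule P.indep_vars_compose2[OF assms(8)]) measurable
  have distZ: "distr P borel (Z i) = error_dist \<eta>0" for i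
  proof -
    have "distr P borel (Z i) = distr (distr P borel (X i)) borel (\<lambda>x. x - \<theta>0)"
      by (subst distr_distr) (auto simp: comp_def Z_def[abs_def])
    then show ?thesis unfolding assms(9) by (simp add: shifted_loc_measure[OF eta0])
  qed
  let ?v = "inverse (fisher_info \<theta>0 \<eta>0)"
  have v: "?v > 0" using info_pos[OF eta0] by (simp add: fisher_info_eq[OF eta0])
  have \<Delta>_eq: "\<Delta> n \<omega> = - (\<Sum>i<n. log_slope \<eta>0 (X i \<omega> - \<theta>0)) / sqrt n / info \<eta>0" for n \<omega>
    unfolding \<Delta>_def score_eq[OF eta0] fisher_info_eq[OF eta0]
    unfolding sum_distrib_left[symmetric] sum_negf
    by (simp only: divide_inverse mult_1_left mult_minus_right mult_minus_left mult_ac)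
  have \<Delta>m: "\<Delta> n \<in> borel_measurable P" for n
  proof -
    note [measurable] = log_measurable(2)[OF eta0]
    show ?thesis unfolding \<Delta>_eq[abs_def] by measurable
  qed
  have event: "{(\<theta>, \<eta>) \<in> space (\<pi>\<Theta> \<Otimes>\<^sub>M \<pi>H). sqrt (real n) * (\<theta> - \<theta>0) \<in> B} = loc_event n B" for n B
    by (auto simp: loc_event_def)
  define D where "D n \<omega> B = \<bar>posterior \<pi> n (\<lambda>i. X i \<omega>) (loc_event n B) - measure (normal_measure (\<Delta> n \<omega>) ?v) B\<bar>" for n \<omega> B
  define Y where "Y n \<omega> = (SUP B\<in>sets borel. D n \<omega> B)" for n \<omega>
  have D_measure: "D n \<omega> B = \<bar>measure (post_measure n (\<lambda>i. X i \<omega>)) B - measure (normal_measure (\<Delta> n \<omega>) ?v) B\<bar>"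
    if "B \<in> sets borel" for n \<omega> B
    unfolding D_def using post_measure(3)[OF that] by simp
  have D_bounds: "0 \<le> D n \<omega> B" "D n \<omega> B \<le> 1" if B: "B \<in> sets borel" for n \<omega> B
  proof -
    interpret p: prob_space "post_measure n (\<lambda>i. X i \<omega>)" by (rule post_measure(1))
    interpret q: prob_space "normal_measure (\<Delta> n \<omega>) ?v" by (rule prob_space_normal_measure[OF v])
    show "0 \<le> D n \<omega> B" by (simp add: D_def)
    show "D n \<omega> B \<le> 1" unfolding D_measure[OF B]
      using p.prob_le_1[of B] q.prob_le_1[of B] measure_nonneg[of "post_measure n (\<lambda>i. X i \<omega>)" B]
        measure_nonneg[of "normal_measure (\<Delta> n \<omega>) ?v" B] by linarith
  qed
  obtain \<A> :: "real set set" where \<A>: "countable \<A>" "\<A> \<subseteq> sets borel"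
    "\<And>\<mu> \<nu>. prob_space \<mu> \<Longrightarrow> prob_space \<nu> \<Longrightarrow> sets \<mu> = sets borel \<Longrightarrow> sets \<nu> = sets borel \<Longrightarrow>
       (SUP B\<in>sets borel. \<bar>measure \<mu> B - measure \<nu> B\<bar>) = (SUP B\<in>\<A>. \<bar>measure \<mu> B - measure \<nu> B\<bar>)"
    using SUP_borel_eq_countable by blast
  have Y_countable: "Y n \<omega> = (SUP B\<in>\<A>. D n \<omega> B)" for n \<omega>
  proof -
    have "Y n \<omega> = (SUP B\<in>sets borel. \<bar>measure (post_measure n (\<lambda>i. X i \<omega>)) B - measure (normal_measure (\<Delta> n \<omega>) ?v) B\<bar>)"
      unfolding Y_def by (intro SUP_cong refl D_measure)
    also have "\<dots> = (SUP B\<in>\<A>. \<bar>measure (post_measure n (\<lambda>i. X i \<omega>)) B - measure (normal_measure (\<Delta> n \<omega>) ?v) B\<bar>)"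
      by (rule \<A>(3)[OF post_measure(1) prob_space_normal_measure[OF v] post_measure(2)])
        (simp add: normal_measure_def)
    also have "\<dots> = (SUP B\<in>\<A>. D n \<omega> B)"
      using \<A>(2) by (intro SUP_cong refl D_measure[symmetric]) auto
    finally show ?thesis .
  qed
  have Ym: "Y n \<in> borel_measurable P" for n
  proof -
    have "(\<lambda>\<omega>. SUP B\<in>\<A>. D n \<omega> B) \<in> borel_measurable P"
    proof (rule borel_measurable_cSUP[OF \<A>(1)])
      fix B assume "B \<in> \<A>"
      then have B: "B \<in> sets borel" using \<A>(2) by auto
      show "(\<lambda>\<omega>. D n \<omega> B) \<in> borel_measurable P"
        unfolding D_def
        by (intro borel_measurable_abs borel_measurable_diff posterior_borel_measurable[OF Xm B]
            normal_measure_measurable[OF \<Delta>m B v])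
    next
      fix \<omega> show "bdd_above (D n \<omega> ` \<A>)"
        using D_bounds(2) \<A>(2) by (intro bdd_aboveI[of _ 1]) auto
    qed
    then show ?thesis using Y_countable by (simp cong: measurable_cong)
  qed
  have Y_nonneg: "Y n \<omega> \<ge> 0" for n \<omega>
  proof -
    have "D n \<omega> {} \<le> Y n \<omega>" unfolding Y_def
      by (rule cSUP_upper) (auto intro!: bdd_aboveI[of _ 1] D_bounds(2))
    then show ?thesis using D_bounds(1)[of "{}" n \<omega>] by simp
  qed
  have "(\<lambda>n. measure P {\<omega> \<in> space P. \<bar>Y n \<omega>\<bar> > \<epsilon>}) \<longlonglongrightarrow> 0" if \<epsilon>: "\<epsilon> > 0" for \<epsilon>
  proof (rule LIMSEQ_I)
    fix r :: real assume "r > 0"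
    then have r2: "r / 2 > 0" by simp
    define \<kappa> where "\<kappa> = min (1 / 2) (\<epsilon> / 5)"
    have \<kappa>: "0 < \<kappa>" "\<kappa> \<le> 1/2" "5 * \<kappa> \<le> \<epsilon>" using \<epsilon> by (auto simp: \<kappa>_def)
    obtain t v where t: "t \<ge> 0" and vv: "v \<ge> 0" and ctl: "\<And>\<rho>. \<rho> > 0 \<Longrightarrow> \<exists>N. \<forall>n\<ge>N. \<exists>E\<in>sets P. measure P E \<le> r / 2 \<and>
      (\<forall>\<omega>\<in>space P - E. controlled \<eta>0 n (\<lambda>i. Z i \<omega>) t v \<rho>)"
      using controlled_with_high_probability[OF eta0 assms(7) indZ distZ r2] by blast
    obtain \<rho> N0 where \<rho>: "\<rho> > 0" and det: "\<And>n xs B. n \<ge> N0 \<Longrightarrow> controlled \<eta>0 n (\<lambda>i. xs i - \<theta>0) t v \<rho> \<Longrightarrow> B \<in> sets borel \<Longrightarrow>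
      \<bar>posterior \<pi> n xs (loc_event n B) -
       measure (normal_measure (- (\<Sum>i<n. log_slope \<eta>0 (xs i - \<theta>0)) / sqrt n / info \<eta>0) (inverse (info \<eta>0))) B\<bar> \<le> 5 * \<kappa>"
      using bvm_deterministic[OF t vv \<kappa>(1,2)] by blast
    obtain N1 where N1: "\<And>n. n \<ge> N1 \<Longrightarrow> \<exists>E\<in>sets P. measure P E \<le> r / 2 \<and>
      (\<forall>\<omega>\<in>space P - E. controlled \<eta>0 n (\<lambda>i. Z i \<omega>) t v \<rho>)" using ctl[OF \<rho>] by blast
    have "measure P {\<omega> \<in> space P. \<bar>Y n \<omega>\<bar> > \<epsilon>} \<le> r / 2" if n: "n \<ge> max N0 N1" for n
    proof -
      from N1[of n] n obtain E where E: "E \<in> sets P" "measure P E \<le> r / 2"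
        "\<And>\<omega>. \<omega> \<in> space P - E \<Longrightarrow> controlled \<eta>0 n (\<lambda>i. Z i \<omega>) t v \<rho>" by auto
      have "\<bar>Y n \<omega>\<bar> \<le> \<epsilon>" if \<omega>: "\<omega> \<in> space P - E" for \<omega>
      proof -
        have "D n \<omega> B \<le> 5 * \<kappa>" if B: "B \<in> sets borel" for B
          using det[of n "\<lambda>i. X i \<omega>" B] n E(3)[OF \<omega>] B
          unfolding D_def \<Delta>_eq fisher_info_eq[OF eta0] Z_def by simp
        then have "Y n \<omega> \<le> 5 * \<kappa>" unfolding Y_def by (intro cSUP_least) auto
        then show ?thesis using Y_nonneg[of n \<omega>] \<kappa>(3) by simp
      qed
      then have "{\<omega> \<in> space P. \<bar>Y n \<omega>\<bar> > \<epsilon>} \<subseteq> E" by force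
      then have "measure P {\<omega> \<in> space P. \<bar>Y n \<omega>\<bar> > \<epsilon>} \<le> measure P E" using E(1) by (rule P.finite_measure_mono)
      then show ?thesis using E(2) by simp
    qed
    then show "\<exists>no. \<forall>n\<ge>no. norm (measure P {\<omega> \<in> space P. \<bar>Y n \<omega>\<bar> > \<epsilon>} - 0) < r"
      using r2 by (intro exI[of _ "max N0 N1"]) fastforce
  qed
  with Ym show ?thesis
    unfolding tendsto_zero_in_prob_def event D_def[symmetric] Y_def[symmetric] by blast
qed

end
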